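(* Let $P=\mathbb{Q}[x_1,\dots,x_n]$, let $I$ be a zero-dimensional ideal in $P$, let $\sigma$ be a term-ordering on $\mathbb{T}^n$, let $f\in P$, and let $p$ be a usable prime for $f$ with respect to $(I,\sigma)$. (a) The polynomial $\pi_p(\mu_{f,I}(z))$ is a multiple of $\mu_{\pi_p(f),I_{(p,\sigma)}}(z)$ in $\mathbb{F}_p[z]$. (b) There are only finitely many bad primes for $f$ (with respect to $(I,\sigma)$). (c) The prime $p$ is good if and only if $\deg(\mu_{\pi_p(f),I_{(p,\sigma)}}(z))=\deg(\mu_{f,I}(z))$.
   Context: $\mathbb{T}^n$ is the monoid of power-products in $x_1,\dots,x_n$. An ideal $J$ of a polynomial ring $K[x_1,\dots,x_n]$ over a field $K$ is zero-dimensional if the quotient ring is non-zero and finite-dimensional over $K$. For such $J$ and $g\in K[x_1,\dots,x_n]$, the minimal polynomial $\mu_{g,J}(z)\in K[z]$ is the monic generator of the kernel of the $K$-algebra homomorphism $K[z]\to K[x_1,\dots,x_n]/J$, $z\mapsto g \bmod J$. For $f\in P$, $\mathrm{den}(f)$ is $1$ if $f=0$ and otherwise the least common multiple of the denominators of the coefficients of $f$. If $G$ is the reduced $\sigma$-Gröbner basis of $I$, then $\mathrm{den}_\sigma(I)=\mathrm{lcm}\{\mathrm{den}(g):g\in G\}$. For a positive integer $\delta$, $\mathbb{Z}_\delta\subset\mathbb{Q}$ is the ring of fractions $a/\delta^k$ ($a\in\mathbb{Z}$, $k\in\mathbb{N}$); for a prime $p\nmid\delta$, $\pi_p$ denotes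 the canonical homomorphism $\mathbb{Z}_\delta\to\mathbb{F}_p=\mathbb{Z}/p\mathbb{Z}$ and its coefficientwise extensions to polynomials. A prime $p$ is usable for $f$ with respect to $(I,\sigma)$ if $p$ does not divide $\mathrm{den}(f)\cdot\mathrm{den}_\sigma(I)$. For such $p$, the $(p,\sigma)$-reduction of $I$ is the ideal $I_{(p,\sigma)}=\langle\pi_p(G)\rangle$ of $\mathbb{F}_p[x_1,\dots,x_n]$, which is zero-dimensional; moreover $\mu_{f,I}(z)$ has all its coefficients in $\mathbb{Z}_\delta$ with $\delta=\mathrm{den}(f)\cdot\mathrm{den}_\sigma(I)$, so $\pi_p(\mu_{f,I}(z))$ is defined. A usable prime $p$ is good for $f$ if $\mu_{\pi_p(f),I_{(p,\sigma)}}(z)=\pi_p(\mu_{f,I}(z))$; a usable prime which is not good is called bad. *)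

theory Defs
  imports
    "HOL-Library.Function_Algebras"
    "HOL-Algebra.UnivPoly"
    "HOL-Algebra.QuotRing"
    "HOL-Algebra.Embedded_Algebras"
    "HOL-Algebra.Divisibility"
    "HOL-Number_Theory.Residues"
begin

section \<open>Multivariate polynomial rings\<close>

text \<open>
  A power-product in the indeterminates indexed by the finite type 'n is its exponent vector.
  The product of power-products is pointwise addition, the power-product 1 is the zero vector,
  and divisibility is the pointwise order.
\<close>

type_synonym 'n pp = "'n \<Rightarrow> nat"

text \<open>
  Polynomials are coefficient functions of finite support, in analogy to \<^const>\<open>UP\<close>.
  The coefficient ring is a record because it ranges over the rationals and over
  \<^term>\<open>residue_ring (int p)\<close> for all primes p within one statement.
\<close>

definition pp_support :: "('a, 'm) ring_scheme \<Rightarrow> ('n pp \<Rightarrow> 'a) \<Rightarrow> 'n pp set" where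
  "pp_support K f = {t. f t \<noteq> \<zero>\<^bsub>K\<^esub>}"

definition mpoly_ring :: "('a, 'm) ring_scheme \<Rightarrow> ('n::finite pp \<Rightarrow> 'a) ring" where
  "mpoly_ring K =
    \<lparr>carrier = {f. range f \<subseteq> carrier K \<and> finite (pp_support K f)},
     monoid.mult = \<lambda>f g t. \<Oplus>\<^bsub>K\<^esub>s\<in>{..t}. f s \<otimes>\<^bsub>K\<^esub> g (t - s),
     one = \<lambda>t. if t = 0 then \<one>\<^bsub>K\<^esub> else \<zero>\<^bsub>K\<^esub>,
     zero = \<lambda>t. \<zero>\<^bsub>K\<^esub>,
     add = \<lambda>f g t. f t \<oplus>\<^bsub>K\<^esub> g t\<rparr>"

definition mpoly_const :: "('a, 'm) ring_scheme \<Rightarrow> 'a \<Rightarrow> ('n::finite pp \<Rightarrow> 'a)" where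
  "mpoly_const K c = (\<lambda>t. if t = 0 then c else \<zero>\<^bsub>K\<^esub>)"

definition pp_mpoly :: "('a, 'm) ring_scheme \<Rightarrow> 'n::finite pp \<Rightarrow> ('n pp \<Rightarrow> 'a)" where
  "pp_mpoly K s = (\<lambda>t. if t = s then \<one>\<^bsub>K\<^esub> else \<zero>\<^bsub>K\<^esub>)"

section \<open>Zero-dimensional ideals and minimal polynomials\<close>

definition zero_dimensional :: "('a, 'm) ring_scheme \<Rightarrow> ('n::finite pp \<Rightarrow> 'a) set \<Rightarrow> bool" where
  "zero_dimensional K J \<longleftrightarrow>
     ideal J (mpoly_ring K) \<and>
     carrier (mpoly_ring K Quot J) \<noteq> {\<zero>\<^bsub>mpoly_ring K Quot J\<^esub>} \<and>
     ring.finite_dimension (mpoly_ring K Quot J)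
       ((\<lambda>c. J +>\<^bsub>mpoly_ring K\<^esub> mpoly_const K c) ` carrier K)
       (carrier (mpoly_ring K Quot J))"

definition subst_hom ::
  "('a, 'm) ring_scheme \<Rightarrow> ('n::finite pp \<Rightarrow> 'a) \<Rightarrow> ('n pp \<Rightarrow> 'a) set
     \<Rightarrow> (nat \<Rightarrow> 'a) \<Rightarrow> ('n pp \<Rightarrow> 'a) set" where
  "subst_hom K g J =
     UnivPoly.eval K (mpoly_ring K Quot J)
       (\<lambda>c. J +>\<^bsub>mpoly_ring K\<^esub> mpoly_const K c) (J +>\<^bsub>mpoly_ring K\<^esub> g)"

definition min_poly ::
  "('a, 'm) ring_scheme \<Rightarrow> ('n::finite pp \<Rightarrow> 'a) \<Rightarrow> ('n pp \<Rightarrow> 'a) set \<Rightarrow> (nat \<Rightarrow> 'a)" where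
  "min_poly K g J =
     (THE \<mu>. \<mu> \<in> carrier (UP K) \<and> coeff (UP K) \<mu> (deg K \<mu>) = \<one>\<^bsub>K\<^esub> \<and>
          a_kernel (UP K) (mpoly_ring K Quot J) (subst_hom K g J) = PIdl\<^bsub>UP K\<^esub> \<mu>)"

section \<open>Term orderings and reduced Groebner bases\<close>

definition term_ordering :: "'n::finite pp rel \<Rightarrow> bool" where
  "term_ordering \<sigma> \<longleftrightarrow>
     linear_order \<sigma> \<and> (\<forall>t. (0, t) \<in> \<sigma>) \<and>
     (\<forall>s t u. (s, t) \<in> \<sigma> \<longrightarrow> (s + u, t + u) \<in> \<sigma>)"

definition lead_pp ::
  "('a, 'm) ring_scheme \<Rightarrow> 'n::finite pp rel \<Rightarrow> ('n pp \<Rightarrow> 'a) \<Rightarrow> 'n pp" where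
  "lead_pp K \<sigma> f = (THE t. t \<in> pp_support K f \<and> (\<forall>s\<in>pp_support K f. (s, t) \<in> \<sigma>))"

definition lead_ideal ::
  "('a, 'm) ring_scheme \<Rightarrow> 'n::finite pp rel \<Rightarrow> ('n pp \<Rightarrow> 'a) set \<Rightarrow> ('n pp \<Rightarrow> 'a) set" where
  "lead_ideal K \<sigma> F =
     Idl\<^bsub>mpoly_ring K\<^esub> ((\<lambda>f. pp_mpoly K (lead_pp K \<sigma> f)) ` (F - {\<zero>\<^bsub>mpoly_ring K\<^esub>}))"

definition groebner_basis ::
  "('a, 'm) ring_scheme \<Rightarrow> 'n::finite pp rel \<Rightarrow> ('n pp \<Rightarrow> 'a) set \<Rightarrow> ('n pp \<Rightarrow> 'a) set \<Rightarrow> bool"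
  where
  "groebner_basis K \<sigma> J G \<longleftrightarrow>
     finite G \<and> G \<subseteq> J - {\<zero>\<^bsub>mpoly_ring K\<^esub>} \<and> lead_ideal K \<sigma> G = lead_ideal K \<sigma> J"

definition is_reduced_gb ::
  "('a, 'm) ring_scheme \<Rightarrow> 'n::finite pp rel \<Rightarrow> ('n pp \<Rightarrow> 'a) set \<Rightarrow> ('n pp \<Rightarrow> 'a) set \<Rightarrow> bool"
  where
  "is_reduced_gb K \<sigma> J G \<longleftrightarrow>
     groebner_basis K \<sigma> J G \<and>
     (\<forall>g\<in>G. g (lead_pp K \<sigma> g) = \<one>\<^bsub>K\<^esub>) \<and>
     (\<forall>g\<in>G. \<forall>h\<in>G - {g}. \<forall>t\<in>pp_support K g. \<not> lead_pp K \<sigma> h \<le> t)"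

definition reduced_gb ::
  "('a, 'm) ring_scheme \<Rightarrow> 'n::finite pp rel \<Rightarrow> ('n pp \<Rightarrow> 'a) set \<Rightarrow> ('n pp \<Rightarrow> 'a) set" where
  "reduced_gb K \<sigma> J = (THE G. is_reduced_gb K \<sigma> J G)"

section \<open>Denominators and reduction modulo a prime\<close>

definition rat_ring :: "rat ring" where
  "rat_ring = \<lparr>carrier = UNIV, monoid.mult = (*), one = 1, zero = 0, add = (+)\<rparr>"

text \<open>For the zero polynomial this is the empty least common multiple, which is 1.\<close>

definition den :: "('n::finite pp \<Rightarrow> rat) \<Rightarrow> int" where
  "den f = Lcm ((\<lambda>t. snd (quotient_of (f t))) ` pp_support rat_ring f)"

definition den_gb :: "'n::finite pp rel \<Rightarrow> ('n pp \<Rightarrow> rat) set \<Rightarrow> int" where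
  "den_gb \<sigma> I = Lcm (den ` reduced_gb rat_ring \<sigma> I)"

text \<open>
  The canonical homomorphism into the field with p elements sends a/b to the quotient of the
  residue classes of a and b. This does not depend on \<open>\<delta>\<close>, so \<open>\<pi>\<close> takes no such argument; it is
  meaningful on those rationals whose reduced denominator is prime to p, and hence on every
  ring of fractions \<open>int_frac \<delta>\<close> with \<open>\<delta>\<close> prime to p (lemma \<open>\<pi>_ring_hom\<close>).
\<close>

definition int_frac :: "int \<Rightarrow> rat set" where
  "int_frac \<delta> = {of_int a / of_int \<delta> ^ k | a k. True}"

definition \<pi> :: "nat \<Rightarrow> rat \<Rightarrow> int" where
  "\<pi> p q = (case quotient_of q of (a, b) \<Rightarrow>
     (a mod int p) \<otimes>\<^bsub>residue_ring (int p)\<^esub> inv\<^bsub>residue_ring (int p)\<^esub> (b mod int p))"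

text \<open>
  Coefficientwise extension, for polynomials in \<open>x\<^sub>1, \<dots>, x\<^sub>n\<close> (\<open>'i = 'n pp\<close>) as well as
  in z (\<open>'i = nat\<close>).
\<close>

definition \<pi>_poly :: "nat \<Rightarrow> ('i \<Rightarrow> rat) \<Rightarrow> ('i \<Rightarrow> int)" where
  "\<pi>_poly p f = (\<lambda>i. \<pi> p (f i))"

definition usable_prime ::
  "'n::finite pp rel \<Rightarrow> ('n pp \<Rightarrow> rat) set \<Rightarrow> ('n pp \<Rightarrow> rat) \<Rightarrow> nat \<Rightarrow> bool" where
  "usable_prime \<sigma> I f p \<longleftrightarrow> prime p \<and> \<not> int p dvd den f * den_gb \<sigma> I"

definition p_reduction ::
  "nat \<Rightarrow> 'n::finite pp rel \<Rightarrow> ('n pp \<Rightarrow> rat) set \<Rightarrow> ('n pp \<Rightarrow> int) set" where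
  "p_reduction p \<sigma> I =
     Idl\<^bsub>mpoly_ring (residue_ring (int p))\<^esub> (\<pi>_poly p ` reduced_gb rat_ring \<sigma> I)"

definition good_prime ::
  "'n::finite pp rel \<Rightarrow> ('n pp \<Rightarrow> rat) set \<Rightarrow> ('n pp \<Rightarrow> rat) \<Rightarrow> nat \<Rightarrow> bool" where
  "good_prime \<sigma> I f p \<longleftrightarrow>
     usable_prime \<sigma> I f p \<and>
     min_poly (residue_ring (int p)) (\<pi>_poly p f) (p_reduction p \<sigma> I)
       = \<pi>_poly p (min_poly rat_ring f I)"

definition bad_prime ::
  "'n::finite pp rel \<Rightarrow> ('n pp \<Rightarrow> rat) set \<Rightarrow> ('n pp \<Rightarrow> rat) \<Rightarrow> nat \<Rightarrow> bool" where
  "bad_prime \<sigma> I f p \<longleftrightarrow> usable_prime \<sigma> I f p \<and> \<not> good_prime \<sigma> I f p"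

lemma \<pi>_eqI:
  assumes p: "prime p" and q: "q * of_int b = of_int a" and b: "\<not> int p dvd b"
    and c: "c \<in> {0..int p - 1}" "[c * b = a] (mod int p)"
  shows "\<pi> p q = c"
proof -
  interpret R: residues_prime p "residue_ring (int p)"
    using p by unfold_locales simp_all
  obtain a' b' where ab: "quotient_of q = (a', b')" by force
  then have b'0: "b' > 0" and cop: "coprime a' b'"
    by (auto simp: quotient_of_denom_pos quotient_of_coprime)
  have q': "q = of_int a' / of_int b'" using ab by (rule quotient_of_div)
  have "(of_int (a' * b) :: rat) = of_int (a * b')"
    using q q' b'0 by (simp add: field_simps)
  then have eq: "a' * b = a * b'" by (simp only: of_int_eq_iff)
  then have "b' dvd a' * b" by simp
  then have "b' dvd b" using cop by (simp add: coprime_commute coprime_dvd_mult_right_iff)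
  then have b': "\<not> int p dvd b'" using b by (meson dvd_trans)
  let ?i = "inv\<^bsub>residue_ring (int p)\<^esub> (b' mod int p)"
  have u: "b' mod int p \<in> Units (residue_ring (int p))"
  proof -
    have "int p > 0" using p by (simp add: prime_gt_0_nat)
    then have "b' mod int p < int p" "b' mod int p \<ge> 0" by simp_all
    moreover have "b' mod int p \<noteq> 0" using b' by (simp add: dvd_eq_mod_eq_0)
    ultimately show ?thesis by (simp add: R.res_prime_units_eq of_nat_diff)
  qed
  have "b' mod int p \<otimes>\<^bsub>residue_ring (int p)\<^esub> ?i = \<one>\<^bsub>residue_ring (int p)\<^esub>"
    using u by (rule R.Units_r_inv)
  then have "(b' mod int p * ?i) mod int p = 1"
    by (simp add: residue_ring_def)
  then have i: "[b' * ?i = 1] (mod int p)"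
    using p by (simp add: cong_def mod_mult_left_eq prime_gt_Suc_0_nat)
  have r: "\<pi> p q = (a' * ?i) mod int p"
    by (simp add: \<pi>_def ab residue_ring_def mod_mult_left_eq)
  have "[a' * ?i * (b * b') = a' * b * (b' * ?i)] (mod int p)"
    by (simp add: algebra_simps)
  also have "[a' * b * (b' * ?i) = a' * b * 1] (mod int p)"
    using i by (rule cong_scalar_left)
  also have "a' * b * 1 = a * b'" using eq by simp
  also have "[a * b' = c * b * b'] (mod int p)"
    using c(2) by (intro cong_scalar_right) (rule cong_sym)
  finally have "[a' * ?i * (b * b') = c * (b * b')] (mod int p)"
    by (simp add: algebra_simps)
  moreover have "coprime (b * b') (int p)"
    using p b b' by (metis coprime_commute prime_imp_coprime prime_nat_int_transfer prime_dvd_mult_iff)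
  ultimately have "[a' * ?i = c] (mod int p)"
    using cong_mult_rcancel by blast
  then show ?thesis using r c(1) p by (simp add: cong_def)
qed

lemma \<pi>_ring_hom:
  assumes p: "prime p" and \<delta>: "\<not> int p dvd \<delta>"
  shows "\<pi> p \<in> ring_hom (rat_ring\<lparr>carrier := int_frac \<delta>\<rparr>) (residue_ring (int p))"
proof -
  have p0: "int p > 0" "int p > 1" using p by (auto simp: prime_gt_0_nat prime_gt_Suc_0_nat)
  have d0: "\<delta> \<noteq> 0" using \<delta> by auto
  have dk: "\<not> int p dvd \<delta> ^ k" for k
    using p \<delta> prime_dvd_power[of "int p" \<delta> k] by auto
  have ex: "\<exists>c. c \<in> {0..int p - 1} \<and> [c * \<delta> ^ k = a] (mod int p)" for a k
  proof -
    have "coprime (\<delta> ^ k) (int p)"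
      using p dk[of k] by (metis coprime_commute prime_imp_coprime prime_nat_int_transfer)
    then obtain x where "[\<delta> ^ k * x = 1] (mod int p)"
      using cong_solve_coprime_int by blast
    then have "[a * (\<delta> ^ k * x) = a * 1] (mod int p)" by (rule cong_scalar_left)
    then have "[((x * a) mod int p) * \<delta> ^ k = a] (mod int p)"
      by (simp add: cong_def mod_mult_left_eq mod_mult_right_eq algebra_simps)
    then show ?thesis using p0 by (intro exI[of _ "(x * a) mod int p"]) simp
  qed
  have key: "\<exists>a k. q = of_int a / of_int \<delta> ^ k \<and> \<pi> p q \<in> {0..int p - 1}
      \<and> [\<pi> p q * \<delta> ^ k = a] (mod int p)" if q0: "q \<in> int_frac \<delta>" for q
  proof -
    obtain a k where q: "q = of_int a / of_int \<delta> ^ k"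
      using q0 unfolding int_frac_def by blast
    obtain c where c: "c \<in> {0..int p - 1}" "[c * \<delta> ^ k = a] (mod int p)"
      using ex by blast
    have "\<pi> p q = c"
      by (rule \<pi>_eqI[OF p _ dk[of k] c]) (use q d0 in simp)
    then show ?thesis using q c by blast
  qed
  have cm: "[u mod int p * d = u * d] (mod int p)" for u d
    by (simp add: cong_def mod_mult_left_eq)
  have mult: "\<pi> p (x * y) = (\<pi> p x * \<pi> p y) mod int p"
    if "x \<in> int_frac \<delta>" "y \<in> int_frac \<delta>" for x y
  proof -
    obtain a k where x: "x = of_int a / of_int \<delta> ^ k" "[\<pi> p x * \<delta> ^ k = a] (mod int p)"
      using key \<open>x \<in> int_frac \<delta>\<close> by blast
    obtain b l where y: "y = of_int b / of_int \<delta> ^ l" "[\<pi> p y * \<delta> ^ l = b] (mod int p)"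
      using key \<open>y \<in> int_frac \<delta>\<close> by blast
    show ?thesis
    proof (rule \<pi>_eqI[OF p _ dk[of "k + l"]])
      show "x * y * of_int (\<delta> ^ (k + l)) = of_int (a * b)"
        using x y d0 by (simp add: power_add)
      have "[\<pi> p x * \<delta> ^ k * (\<pi> p y * \<delta> ^ l) = a * b] (mod int p)"
        using x y by (intro cong_mult)
      then show "[(\<pi> p x * \<pi> p y) mod int p * \<delta> ^ (k + l) = a * b] (mod int p)"
        by (intro cong_trans[OF cm]) (simp add: power_add algebra_simps)
    qed (use p0 in simp)
  qed
  have add: "\<pi> p (x + y) = (\<pi> p x + \<pi> p y) mod int p"
    if "x \<in> int_frac \<delta>" "y \<in> int_frac \<delta>" for x y
  proof -
    obtain a k where x: "x = of_int a / of_int \<delta> ^ k" "[\<pi> p x * \<delta> ^ k = a] (mod int p)"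
      using key \<open>x \<in> int_frac \<delta>\<close> by blast
    obtain b l where y: "y = of_int b / of_int \<delta> ^ l" "[\<pi> p y * \<delta> ^ l = b] (mod int p)"
      using key \<open>y \<in> int_frac \<delta>\<close> by blast
    show ?thesis
    proof (rule \<pi>_eqI[OF p _ dk[of "k + l"]])
      show "(x + y) * of_int (\<delta> ^ (k + l)) = of_int (a * \<delta> ^ l + b * \<delta> ^ k)"
        unfolding x(1) y(1) using d0 by (simp add: power_add field_simps)
      have "[\<pi> p x * \<delta> ^ k * \<delta> ^ l + \<pi> p y * \<delta> ^ l * \<delta> ^ k = a * \<delta> ^ l + b * \<delta> ^ k] (mod int p)"
        using x y by (intro cong_add cong_scalar_right)
      then show "[(\<pi> p x + \<pi> p y) mod int p * \<delta> ^ (k + l) = a * \<delta> ^ l + b * \<delta> ^ k] (mod int p)"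
        by (intro cong_trans[OF cm]) (simp add: power_add algebra_simps)
    qed (use p0 in simp)
  qed
  have one: "\<pi> p 1 = 1"
    by (rule \<pi>_eqI[OF p, of _ 1 1]) (use p0 in auto)
  have carr: "\<pi> p x \<in> {0..int p - 1}" if "x \<in> int_frac \<delta>" for x
    using key[OF that] by blast
  show ?thesis
    by (rule ring_hom_memI) (use carr mult add one in \<open>auto simp: residue_ring_def rat_ring_def\<close>)
qed

end

theory Submission
  imports Defs
begin

text \<open>
  Let G be the reduced Groebner basis of I, let p be a usable prime, and call a polynomial integral if
  no denominator of a coefficient is divisible by p, that is, if its coefficients lie in the local
  ring of the integers at p (\<open>zloc p\<close>). The elements of G are monic and integral. Hence division by G
  never divides by anything, and this has two consequences.

  \<^item> The normal form modulo I of an integral polynomial is integral (\<open>nf_zloc\<close>).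

  \<^item> The reduction of I modulo p, which is generated by the reduction of G, is the image of the
    set of all integral elements of I (\<open>p_reduction_eq\<close>): such an element has remainder 0, so it is
    an integral combination of G.

  Let \<open>\<mu>\<close> be the minimal polynomial of f modulo I and d its degree. The powers \<open>1, f, \<dots>, f\<^sup>d\<^sup>-\<^sup>1\<close> are
  linearly independent modulo I, and every polynomial in f has coordinates with respect to them. The
  coordinates are computed from the normal form by a finite matrix of rational numbers, which depends
  on I, \<open>\<sigma>\<close> and f but not on p (\<open>ex_coordinate_matrix\<close>).

  The polynomial \<open>\<mu>\<close> is integral (\<open>\<mu>_zloc\<close>). The normal forms of all powers of f are integral, so the
  denominators of their coordinates are bounded, and by the pigeonhole principle two powers have
  coordinates with an integral difference. This makes f a root, modulo I, of a monic integral
  polynomial. It is a multiple of \<open>\<mu>\<close>, and \<open>\<mu>\<close> is integral by Gauss's lemma.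

  Part (a) follows: \<open>\<mu>(f)\<close> is an integral element of I, so its reduction lies in the reduced ideal.
  Part (c) follows from (a), because both polynomials are monic and reduction preserves the degree
  of \<open>\<mu>\<close> (\<open>\<mu>p_eq_iff\<close>).

  For part (b), a prime is good if it is usable and divides no denominator of the coordinate matrix
  (\<open>deg_\<mu>p_of_integral_coordinates\<close>). Indeed, if a combination h of the powers of f below d, with
  integer coefficients, reduces into the reduced ideal, then \<open>h = h\<^sub>0 + p y\<close> with \<open>h\<^sub>0\<close> in I and both
  \<open>h\<^sub>0\<close> and y integral. The coordinates of h, which are its coefficients, are p times those of y, hence
  vanish modulo p. So the reduced minimal polynomial has degree d.
\<close>

section \<open>The polynomial ring as a commutative ring\<close>

lemma finite_atMost_pp [simp]: "finite {..t :: 'n::finite pp}"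
proof -
  have "{..t} = PiE UNIV (\<lambda>i. {..t i})"
    by (auto simp: le_fun_def PiE_def Pi_def)
  then show ?thesis
    by (simp add: finite_PiE)
qed

lemma pp_diff_add_cancel: "s \<le> t \<Longrightarrow> t - s + s = (t :: 'n pp)"
  by (simp add: fun_eq_iff le_fun_def)

lemma (in abelian_monoid) finsum_Sigma:
  assumes "finite A" "\<And>a. a \<in> A \<Longrightarrow> finite (B a)"
    and "\<And>a b. a \<in> A \<Longrightarrow> b \<in> B a \<Longrightarrow> g a b \<in> carrier G"
  shows "(\<Oplus>a\<in>A. \<Oplus>b\<in>B a. g a b) = (\<Oplus>q\<in>Sigma A B. case_prod g q)"
  using assms
proof (induction A rule: finite_induct)
  case empty
  then show ?case by simp
next
  case (insert x F)
  have split: "Sigma (insert x F) B = (\<lambda>b. (x, b)) ` B x \<union> Sigma F B"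
    by auto
  have "(\<Oplus>q\<in>(\<lambda>b. (x, b)) ` B x. case_prod g q) = (\<Oplus>b\<in>B x. g x b)"
    using insert.prems by (subst add.finprod_reindex) (auto simp: inj_on_def)
  moreover have "(\<Oplus>q\<in>Sigma (insert x F) B. case_prod g q)
      = (\<Oplus>q\<in>(\<lambda>b. (x, b)) ` B x. case_prod g q) \<oplus> (\<Oplus>q\<in>Sigma F B. case_prod g q)"
    unfolding split using insert by (subst finsum_Un_disjoint) auto
  ultimately show ?case
    using insert by (subst finsum_insert) (auto intro!: finsum_closed)
qed

locale mpoly_cring = R?: cring K for K :: "('a, 'm) ring_scheme" (structure)
begin

abbreviation P :: "('n::finite pp \<Rightarrow> 'a) ring" where
  "P \<equiv> mpoly_ring K"

lemma mpoly_closed [simp]: "f \<in> carrier P \<Longrightarrow> f t \<in> carrier K"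
  by (auto simp: mpoly_ring_def)

lemma mpoly_finite: "f \<in> carrier P \<Longrightarrow> finite {t. f t \<noteq> \<zero>}"
  by (auto simp: mpoly_ring_def pp_support_def)

lemma mpolyI: "(\<And>t. f t \<in> carrier K) \<Longrightarrow> finite {t. f t \<noteq> \<zero>} \<Longrightarrow> f \<in> carrier P"
  by (auto simp: mpoly_ring_def pp_support_def)

lemma mpoly_zero: "\<zero>\<^bsub>P\<^esub> = (\<lambda>t. \<zero>)"
  and mpoly_one: "\<one>\<^bsub>P\<^esub> = (\<lambda>t. if t = 0 then \<one> else \<zero>)"
  and mpoly_add: "f \<oplus>\<^bsub>P\<^esub> g = (\<lambda>t. f t \<oplus> g t)"
  and mpoly_mult: "f \<otimes>\<^bsub>P\<^esub> g = (\<lambda>t. \<Oplus>s\<in>{..t}. f s \<otimes> g (t - s))"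
  by (simp_all add: mpoly_ring_def)

lemma mpoly_add_closed:
  assumes "f \<in> carrier P" "g \<in> carrier P"
  shows "(\<lambda>t. f t \<oplus> g t) \<in> carrier P"
proof (rule mpolyI)
  show "finite {t. f t \<oplus> g t \<noteq> \<zero>}"
    by (rule finite_subset[of _ "{t. f t \<noteq> \<zero>} \<union> {t. g t \<noteq> \<zero>}"]) (auto simp: assms mpoly_finite)
qed (simp add: assms)

lemma mpoly_mult_closed:
  assumes "f \<in> carrier P" "g \<in> carrier P"
  shows "(\<lambda>t. \<Oplus>s\<in>{..t}. f s \<otimes> g (t - s)) \<in> carrier P"
proof (rule mpolyI)
  let ?S = "(\<lambda>(s, u). s + u) ` ({t. f t \<noteq> \<zero>} \<times> {t. g t \<noteq> \<zero>})"
  have "(\<Oplus>s\<in>{..t}. f s \<otimes> g (t - s)) = \<zero>" if t: "t \<notin> ?S" for t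
  proof (rule add.finprod_one_eqI)
    fix s assume s: "s \<in> {..t}"
    then have "f s = \<zero> \<or> g (t - s) = \<zero>"
      using t pp_diff_add_cancel[of s t] by (force simp: add.commute image_iff)
    then show "f s \<otimes> g (t - s) = \<zero>"
      using assms by auto
  qed
  then have "{t. (\<Oplus>s\<in>{..t}. f s \<otimes> g (t - s)) \<noteq> \<zero>} \<subseteq> ?S"
    by blast
  then show "finite {t. (\<Oplus>s\<in>{..t}. f s \<otimes> g (t - s)) \<noteq> \<zero>}"
    by (rule finite_subset) (simp add: assms mpoly_finite)
qed (auto intro!: finsum_closed simp: assms)

lemma mpoly_mult_commute:
  fixes f :: "'n::finite pp \<Rightarrow> 'a"
  assumes "f \<in> carrier P" "g \<in> carrier P"
  shows "f \<otimes>\<^bsub>P\<^esub> g = g \<otimes>\<^bsub>P\<^esub> f"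
proof
  fix t
  have inv: "t - (t - s) = s" if "s \<le> t" for s :: "'n \<Rightarrow> nat"
    using that by (simp add: fun_eq_iff le_fun_def)
  have le: "t - s \<le> t" for s :: "'n \<Rightarrow> nat"
    by (simp add: le_fun_def)
  have "s \<in> (\<lambda>s. t - s) ` {..t}" if "s \<le> t" for s
    by (rule image_eqI[of _ _ "t - s"]) (use that inv le in auto)
  then have img: "{..t} = (\<lambda>s. t - s) ` {..t}"
    using le by auto
  have inj: "inj_on (\<lambda>s. t - s) {..t}"
    by (rule inj_on_inverseI[where g = "\<lambda>s. t - s"]) (simp add: inv)
  have "(g \<otimes>\<^bsub>P\<^esub> f) t = (\<Oplus>s\<in>(\<lambda>s. t - s) ` {..t}. g s \<otimes> f (t - s))"
    using img by (simp add: mpoly_mult)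
  also have "\<dots> = (\<Oplus>s\<in>{..t}. g (t - s) \<otimes> f (t - (t - s)))"
    using inj by (subst add.finprod_reindex) (auto simp: assms)
  also have "\<dots> = (\<Oplus>s\<in>{..t}. f s \<otimes> g (t - s))"
    by (rule finsum_cong') (auto simp: assms inv m_comm)
  finally show "(f \<otimes>\<^bsub>P\<^esub> g) t = (g \<otimes>\<^bsub>P\<^esub> f) t"
    by (simp add: mpoly_mult)
qed

text \<open>
  Both sides are sums over the decompositions of t into three power-products: the left side lists
  them by (s, r) with r \<le> s \<le> t, the right side by (r, u) with r \<le> t and u \<le> t - r, where s = r + u.
\<close>

lemma mpoly_mult_assoc:
  fixes f :: "'n::finite pp \<Rightarrow> 'a"
  assumes "f \<in> carrier P" "g \<in> carrier P" "h \<in> carrier P"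
  shows "f \<otimes>\<^bsub>P\<^esub> g \<otimes>\<^bsub>P\<^esub> h = f \<otimes>\<^bsub>P\<^esub> (g \<otimes>\<^bsub>P\<^esub> h)"
proof
  fix t :: "'n pp"
  let ?r = "\<lambda>(s, r). (r, s - r)"
  have bij: "bij_betw ?r (Sigma {..t} (\<lambda>s. {..s})) (Sigma {..t} (\<lambda>r. {..t - r}))"
  proof (rule bij_betw_byWitness[where f' = "\<lambda>(r, u). (r + u, r)"])
    show "?r ` Sigma {..t} (\<lambda>s. {..s}) \<subseteq> Sigma {..t} (\<lambda>r. {..t - r})"
    proof (clarsimp simp: le_fun_def, intro conjI allI)
      fix a b :: "'n \<Rightarrow> nat" and x
      assume "\<forall>x. a x \<le> t x" "\<forall>x. b x \<le> a x"
      then have "a x \<le> t x" "b x \<le> a x" by auto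
      then show "b x \<le> t x" "a x - b x \<le> t x - b x" by linarith+
    qed
    show "(\<lambda>(r, u). (r + u, r)) ` Sigma {..t} (\<lambda>r. {..t - r}) \<subseteq> Sigma {..t} (\<lambda>s. {..s})"
    proof (clarsimp simp: le_fun_def)
      fix a b :: "'n \<Rightarrow> nat" and x
      assume "\<forall>x. a x \<le> t x" "\<forall>x. b x \<le> t x - a x"
      then have "a x \<le> t x" "b x \<le> t x - a x" by auto
      then show "a x + b x \<le> t x" by linarith
    qed
  qed (auto simp: fun_eq_iff le_fun_def)
  have tt: "t - s = t - r - (s - r)" if "r \<le> s" for r s :: "'n pp"
    using that by (simp add: fun_eq_iff le_fun_def)
  have "(f \<otimes>\<^bsub>P\<^esub> g \<otimes>\<^bsub>P\<^esub> h) t = (\<Oplus>s\<in>{..t}. (\<Oplus>r\<in>{..s}. f r \<otimes> g (s - r)) \<otimes> h (t - s))"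
    by (simp add: mpoly_mult)
  also have "\<dots> = (\<Oplus>s\<in>{..t}. \<Oplus>r\<in>{..s}. f r \<otimes> g (s - r) \<otimes> h (t - s))"
    by (rule finsum_cong') (auto simp: assms finsum_ldistr intro!: finsum_closed)
  also have "\<dots> = (\<Oplus>q\<in>Sigma {..t} (\<lambda>s. {..s}). (\<lambda>(s, r). f r \<otimes> g (s - r) \<otimes> h (t - s)) q)"
    by (rule finsum_Sigma) (auto simp: assms)
  also have "\<dots> = (\<Oplus>q\<in>Sigma {..t} (\<lambda>s. {..s}).
      (\<lambda>(r, u). f r \<otimes> g u \<otimes> h (t - r - u)) (?r q))"
    by (rule finsum_cong') (auto simp: assms tt split: prod.splits)
  also have "\<dots> = (\<Oplus>q\<in>?r ` Sigma {..t} (\<lambda>s. {..s}). (\<lambda>(r, u). f r \<otimes> g u \<otimes> h (t - r - u)) q)"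
    using bij by (subst add.finprod_reindex) (auto simp: assms bij_betw_def)
  also have "\<dots> = (\<Oplus>q\<in>Sigma {..t} (\<lambda>r. {..t - r}). (\<lambda>(r, u). f r \<otimes> g u \<otimes> h (t - r - u)) q)"
    using bij by (simp add: bij_betw_def)
  also have "\<dots> = (\<Oplus>r\<in>{..t}. \<Oplus>u\<in>{..t - r}. f r \<otimes> g u \<otimes> h (t - r - u))"
    by (rule finsum_Sigma[symmetric]) (auto simp: assms)
  also have "\<dots> = (\<Oplus>r\<in>{..t}. f r \<otimes> (\<Oplus>u\<in>{..t - r}. g u \<otimes> h (t - r - u)))"
    by (rule finsum_cong') (auto simp: assms finsum_rdistr m_assoc intro!: finsum_closed)
  also have "\<dots> = (f \<otimes>\<^bsub>P\<^esub> (g \<otimes>\<^bsub>P\<^esub> h)) t"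
    by (simp add: mpoly_mult)
  finally show "(f \<otimes>\<^bsub>P\<^esub> g \<otimes>\<^bsub>P\<^esub> h) t = (f \<otimes>\<^bsub>P\<^esub> (g \<otimes>\<^bsub>P\<^esub> h)) t" .
qed

text \<open>
  The products by which the division algorithm moves a leading power-product to a given multiple.
\<close>

lemma mpoly_monom_mult:
  assumes c: "c \<in> carrier K" and f: "f \<in> carrier P"
  shows "(\<lambda>t. if t = u then c else \<zero>) \<otimes>\<^bsub>P\<^esub> f = (\<lambda>t. if u \<le> t then c \<otimes> f (t - u) else \<zero>)"
proof
  fix t
  have "((\<lambda>t. if t = u then c else \<zero>) \<otimes>\<^bsub>P\<^esub> f) t
      = (\<Oplus>s\<in>{..t}. if s = u then c \<otimes> f (t - s) else \<zero>)"
    unfolding mpoly_mult by (rule finsum_cong') (auto simp: c f)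
  also have "\<dots> = (if u \<le> t then c \<otimes> f (t - u) else \<zero>)"
  proof (cases "u \<le> t")
    case True
    then have "(\<Oplus>s\<in>{..t}. if u = s then c \<otimes> f (t - s) else \<zero>) = c \<otimes> f (t - u)"
      by (intro finsum_singleton) (auto simp: c f)
    then show ?thesis using True by (simp add: eq_commute)
  next
    case False
    then show ?thesis by (auto intro!: add.finprod_one_eqI)
  qed
  finally show "((\<lambda>t. if t = u then c else \<zero>) \<otimes>\<^bsub>P\<^esub> f) t
      = (if u \<le> t then c \<otimes> f (t - u) else \<zero>)" .
qed

lemma mpoly_const_mult:
  "c \<in> carrier K \<Longrightarrow> f \<in> carrier P \<Longrightarrow> mpoly_const K c \<otimes>\<^bsub>P\<^esub> f = (\<lambda>t. c \<otimes> f t)"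
  unfolding mpoly_const_def by (subst mpoly_monom_mult) (auto simp: le_fun_def fun_eq_iff)

lemma mpoly_const_closed [simp]: "c \<in> carrier K \<Longrightarrow> mpoly_const K c \<in> carrier P"
  by (rule mpolyI) (auto simp: mpoly_const_def)

theorem mpoly_cring: "cring (P :: ('n::finite pp \<Rightarrow> 'a) ring)"
proof (rule cringI)
  show "abelian_group (P :: ('n pp \<Rightarrow> 'a) ring)"
  proof (rule abelian_groupI)
    fix f :: "'n pp \<Rightarrow> 'a" assume f: "f \<in> carrier P"
    have "(\<lambda>t. \<ominus> f t) \<in> carrier P"
    proof (rule mpolyI)
      show "finite {t. \<ominus> f t \<noteq> \<zero>}"
        by (rule finite_subset[OF _ mpoly_finite[OF f]]) auto
    qed (simp add: f)
    moreover have "(\<lambda>t. \<ominus> f t) \<oplus>\<^bsub>P\<^esub> f = \<zero>\<^bsub>P\<^esub>"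
      by (simp add: mpoly_add mpoly_zero f l_neg)
    ultimately show "\<exists>g\<in>carrier P. g \<oplus>\<^bsub>P\<^esub> f = \<zero>\<^bsub>P\<^esub>"
      by blast
  qed (auto simp: mpoly_add mpoly_zero mpoly_add_closed a_ac intro!: mpolyI)
  show "comm_monoid (P :: ('n pp \<Rightarrow> 'a) ring)"
  proof (rule comm_monoidI)
    show "\<one>\<^bsub>P\<^esub> \<in> carrier P"
      by (rule mpolyI) (auto simp: mpoly_one)
    show "\<one>\<^bsub>P\<^esub> \<otimes>\<^bsub>P\<^esub> f = f" if "f \<in> carrier P" for f :: "'n pp \<Rightarrow> 'a"
      using mpoly_const_mult[OF one_closed that] that by (simp add: mpoly_one mpoly_const_def)
  qed (auto simp: mpoly_mult_assoc mpoly_mult_commute, simp add: mpoly_mult mpoly_mult_closed)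
  fix f g h :: "'n pp \<Rightarrow> 'a"
  assume fgh: "f \<in> carrier P" "g \<in> carrier P" "h \<in> carrier P"
  show "(f \<oplus>\<^bsub>P\<^esub> g) \<otimes>\<^bsub>P\<^esub> h = f \<otimes>\<^bsub>P\<^esub> h \<oplus>\<^bsub>P\<^esub> g \<otimes>\<^bsub>P\<^esub> h"
  proof
    fix t
    have "((f \<oplus>\<^bsub>P\<^esub> g) \<otimes>\<^bsub>P\<^esub> h) t = (\<Oplus>s\<in>{..t}. f s \<otimes> h (t - s) \<oplus> g s \<otimes> h (t - s))"
      unfolding mpoly_mult mpoly_add by (rule finsum_cong') (auto simp: fgh l_distr)
    then show "((f \<oplus>\<^bsub>P\<^esub> g) \<otimes>\<^bsub>P\<^esub> h) t = (f \<otimes>\<^bsub>P\<^esub> h \<oplus>\<^bsub>P\<^esub> g \<otimes>\<^bsub>P\<^esub> h) t"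
      by (simp add: mpoly_mult mpoly_add finsum_addf fgh)
  qed
qed

end

sublocale mpoly_cring \<subseteq> P: cring P
  by (rule mpoly_cring)

section \<open>Evaluation at a polynomial and minimal polynomials\<close>

lemma coeff_UP: "q \<in> carrier (UP K) \<Longrightarrow> coeff (UP K) q = q"
  by (simp add: UP_def)

text \<open>
  Translates the lists in which linear independence is phrased into the sums in which evaluation of a
  polynomial is phrased.
\<close>

lemma (in ring) combine_map_eq_finsum:
  assumes "\<And>i. i < n \<Longrightarrow> a i \<in> carrier R" "\<And>i. i < n \<Longrightarrow> u i \<in> carrier R"
  shows "combine (map a [0..<n]) (map u [0..<n]) = (\<Oplus>i\<in>{..<n}. a i \<otimes> u i)"
  using assms
proof (induction n)
  case (Suc n)
  have "combine (map a [0..<Suc n]) (map u [0..<Suc n])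
      = combine (map a [0..<n]) (map u [0..<n]) \<oplus> combine [a n] [u n]"
    using Suc.prems by (subst combine_append) auto
  also have "\<dots> = (\<Oplus>i\<in>{..<Suc n}. a i \<otimes> u i)"
    using Suc by (simp add: lessThan_Suc finsum_insert a_comm Pi_def)
  finally show ?case .
qed simp

lemma (in UP_pre_univ_prop) eval_eq_finsum_le:
  assumes s: "s \<in> carrier S" and q: "q \<in> carrier P" and n: "deg R q \<le> n"
  shows "UnivPoly.eval R S h s q = (\<Oplus>\<^bsub>S\<^esub>i\<in>{..n}. h (coeff P q i) \<otimes>\<^bsub>S\<^esub> s [^]\<^bsub>S\<^esub> i)"
  unfolding eval_on_carrier[OF q]
proof (rule S.add.finprod_mono_neutral_cong_left)
  show "h (coeff P q i) \<otimes>\<^bsub>S\<^esub> s [^]\<^bsub>S\<^esub> i = \<zero>\<^bsub>S\<^esub>" if "i \<in> {..n} - {..deg R q}" for i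
    using that s q by (simp add: deg_aboveD)
qed (use s q n in auto)

text \<open>
  The substitution q \<mapsto> q(g) inside the polynomial ring. The homomorphism \<^const>\<open>subst_hom\<close> is this
  map followed by the projection to the quotient, so that its kernel can be described by membership
  of q(g) in the ideal, without cosets.
\<close>

definition poly_at ::
  "('a, 'm) ring_scheme \<Rightarrow> ('n::finite pp \<Rightarrow> 'a) \<Rightarrow> (nat \<Rightarrow> 'a) \<Rightarrow> ('n pp \<Rightarrow> 'a)" where
  "poly_at K = UnivPoly.eval K (mpoly_ring K) (mpoly_const K)"

context mpoly_cring
begin

lemma mpoly_const_hom: "mpoly_const K \<in> ring_hom K (P :: ('n::finite pp \<Rightarrow> 'a) ring)"
proof (rule ring_hom_memI)
  fix x y assume xy: "x \<in> carrier K" "y \<in> carrier K"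
  show "mpoly_const K (x \<otimes> y) = (mpoly_const K x \<otimes>\<^bsub>P\<^esub> mpoly_const K y :: 'n pp \<Rightarrow> 'a)"
    using xy by (simp add: mpoly_const_mult) (auto simp: mpoly_const_def)
  show "mpoly_const K (x \<oplus> y) = (mpoly_const K x \<oplus>\<^bsub>P\<^esub> mpoly_const K y :: 'n pp \<Rightarrow> 'a)"
    using xy by (auto simp: mpoly_add mpoly_const_def)
qed (simp, simp add: mpoly_const_def mpoly_one)

lemma mpoly_UP_pre_univ_prop:
  "UP_pre_univ_prop K (P :: ('n::finite pp \<Rightarrow> 'a) ring) (mpoly_const K)"
  by (rule UP_pre_univ_propI[OF R.cring_axioms P.cring_axioms mpoly_const_hom])

lemma finsum_mpoly:
  fixes F :: "'i \<Rightarrow> 'n::finite pp \<Rightarrow> 'a"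
  assumes "finite A" "F \<in> A \<rightarrow> carrier P"
  shows "(\<Oplus>\<^bsub>P\<^esub>i\<in>A. F i) t = (\<Oplus>i\<in>A. F i t)"
  using assms
proof (induction A rule: finite_induct)
  case empty
  then show ?case by (simp add: mpoly_zero)
next
  case (insert x A)
  then have "(\<Oplus>\<^bsub>P\<^esub>i\<in>insert x A. F i) = F x \<oplus>\<^bsub>P\<^esub> (\<Oplus>\<^bsub>P\<^esub>i\<in>A. F i)"
    by (intro P.finsum_insert) auto
  moreover have "(\<Oplus>i\<in>insert x A. F i t) = F x t \<oplus> (\<Oplus>i\<in>A. F i t)"
    using insert by (intro finsum_insert) (auto simp: Pi_def)
  ultimately show ?case
    using insert by (simp add: mpoly_add)
qed

lemma poly_at_coeff:
  fixes g :: "'n::finite pp \<Rightarrow> 'a"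
  assumes g: "g \<in> carrier P" and q: "q \<in> carrier (UP K)" and n: "deg K q \<le> n"
  shows "poly_at K g q t = (\<Oplus>i\<in>{..n}. q i \<otimes> (g [^]\<^bsub>P\<^esub> i) t)"
proof -
  interpret ev: UP_pre_univ_prop K "P :: ('n pp \<Rightarrow> 'a) ring" "mpoly_const K" "UP K"
    by (rule mpoly_UP_pre_univ_prop)
  have qi: "q i \<in> carrier K" for i
    using ev.coeff_closed[OF q] by (simp add: coeff_UP[OF q])
  have "poly_at K g q t = (\<Oplus>\<^bsub>P\<^esub>i\<in>{..n}. mpoly_const K (q i) \<otimes>\<^bsub>P\<^esub> g [^]\<^bsub>P\<^esub> i) t"
    using ev.eval_eq_finsum_le[OF g q n] by (simp add: poly_at_def coeff_UP[OF q])
  also have "\<dots> = (\<Oplus>i\<in>{..n}. (mpoly_const K (q i) \<otimes>\<^bsub>P\<^esub> g [^]\<^bsub>P\<^esub> i) t)"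
    by (rule finsum_mpoly) (auto simp: qi g)
  also have "\<dots> = (\<Oplus>i\<in>{..n}. q i \<otimes> (g [^]\<^bsub>P\<^esub> i) t)"
    by (rule finsum_cong') (auto simp: qi g mpoly_const_mult)
  finally show ?thesis .
qed

lemma poly_at_hom:
  "g \<in> carrier P \<Longrightarrow> poly_at K g \<in> ring_hom (UP K) (P :: ('n::finite pp \<Rightarrow> 'a) ring)"
  unfolding poly_at_def by (rule UP_pre_univ_prop.eval_ring_hom[OF mpoly_UP_pre_univ_prop])

lemma quot_UP_pre_univ_prop:
  assumes J: "ideal J (P :: ('n::finite pp \<Rightarrow> 'a) ring)"
  shows "UP_pre_univ_prop K (P Quot J) (\<lambda>c. J +>\<^bsub>P\<^esub> mpoly_const K c)"
proof -
  interpret J: ideal J P by (rule J)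
  show ?thesis
  proof (rule UP_pre_univ_propI[OF R.cring_axioms])
    show "cring (P Quot J)"
      by (rule J.quotient_is_cring) (rule P.cring_axioms)
    show "(\<lambda>c. J +>\<^bsub>P\<^esub> mpoly_const K c) \<in> ring_hom K (P Quot J)"
      using ring_hom_trans[OF mpoly_const_hom J.rcos_ring_hom] by (simp add: comp_def)
  qed
qed

lemma subst_hom_eq:
  fixes g :: "'n::finite pp \<Rightarrow> 'a"
  assumes J: "ideal J P" and g: "g \<in> carrier P" and q: "q \<in> carrier (UP K)"
  shows "subst_hom K g J q = J +>\<^bsub>P\<^esub> poly_at K g q"
proof -
  interpret J: ideal J "P :: ('n pp \<Rightarrow> 'a) ring" by (rule J)
  interpret ev: UP_pre_univ_prop K "P :: ('n pp \<Rightarrow> 'a) ring" "mpoly_const K" "UP K"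
    by (rule mpoly_UP_pre_univ_prop)
  interpret Q: UP_pre_univ_prop K "P Quot J" "\<lambda>c. J +>\<^bsub>P\<^esub> mpoly_const K c" "UP K"
    by (rule quot_UP_pre_univ_prop[OF J])
  interpret c: ring_hom_cring P "P Quot J" "(+>\<^bsub>P\<^esub>) J"
    by (rule J.rcos_ring_hom_cring) (rule P.cring_axioms)
  have "J +>\<^bsub>P\<^esub> poly_at K g q
      = (\<Oplus>\<^bsub>P Quot J\<^esub>i\<in>{..deg K q}. J +>\<^bsub>P\<^esub> (mpoly_const K (coeff (UP K) q i) \<otimes>\<^bsub>P\<^esub> g [^]\<^bsub>P\<^esub> i))"
    using g q unfolding poly_at_def ev.eval_on_carrier[OF q]
    by (subst c.hom_finsum) (auto simp: comp_def)
  also have "\<dots> = subst_hom K g J q"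
    unfolding subst_hom_def ev.eval_on_carrier[OF q]
  proof (rule Q.S.finsum_cong')
    fix i
    have 1: "mpoly_const K (coeff (UP K) q i) \<in> carrier (P :: ('n pp \<Rightarrow> 'a) ring)"
      using q by simp
    have 2: "g [^]\<^bsub>P\<^esub> i \<in> carrier P"
      using g by simp
    show "J +>\<^bsub>P\<^esub> (mpoly_const K (coeff (UP K) q i) \<otimes>\<^bsub>P\<^esub> g [^]\<^bsub>P\<^esub> i) =
      (J +>\<^bsub>P\<^esub> mpoly_const K (coeff (UP K) q i)) \<otimes>\<^bsub>P Quot J\<^esub> (J +>\<^bsub>P\<^esub> g) [^]\<^bsub>P Quot J\<^esub> i"
      unfolding ring_hom_mult[OF J.rcos_ring_hom 1 2]
      by (simp only: ring_hom_ring.hom_nat_pow[OF J.rcos_ring_hom_ring g])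
  next
    have "J +>\<^bsub>P\<^esub> g \<in> carrier (P Quot J)"
      using J.rcos_ring_hom g by (rule ring_hom_closed)
    then show "(\<lambda>i. (J +>\<^bsub>P\<^esub> mpoly_const K (coeff (UP K) q i)) \<otimes>\<^bsub>P Quot J\<^esub>
        (J +>\<^bsub>P\<^esub> g) [^]\<^bsub>P Quot J\<^esub> i) \<in> {..deg K q} \<rightarrow> carrier (P Quot J)"
      using q by (intro Pi_I Q.S.m_closed Q.S.nat_pow_closed Q.hom_closed UP.coeff_closed) simp_all
  qed simp
  finally show ?thesis ..
qed

lemma mem_kernel_iff:
  fixes g :: "'n::finite pp \<Rightarrow> 'a"
  assumes J: "ideal J P" and g: "g \<in> carrier P"
  shows "q \<in> a_kernel (UP K) (P Quot J) (subst_hom K g J) \<longleftrightarrow>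
    q \<in> carrier (UP K) \<and> poly_at K g q \<in> J"
proof -
  interpret J: ideal J "P :: ('n pp \<Rightarrow> 'a) ring" by (rule J)
  have z: "\<zero>\<^bsub>P Quot J\<^esub> = J"
    by (simp add: FactRing_def)
  have "subst_hom K g J q = J \<longleftrightarrow> poly_at K g q \<in> J" if q: "q \<in> carrier (UP K)"
    using subst_hom_eq[OF J g q] ring_hom_closed[OF poly_at_hom[OF g] q]
      J.rcos_const_imp_mem[of "poly_at K g q"] P.a_rcos_zero[OF J, of "poly_at K g q"] by metis
  then show ?thesis
    unfolding a_kernel_def' z by blast
qed

end

locale mpoly_field = R?: field K for K :: "('a, 'm) ring_scheme" (structure)

sublocale mpoly_field \<subseteq> mpoly_cring K ..

sublocale mpoly_field \<subseteq> UP: UP_domain K "UP K"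
  by unfold_locales simp

context mpoly_field
begin

text \<open>
  An element of least degree among the nonzero elements generates: the remainder of any other element
  on division by it lies in the ideal and has smaller degree, hence vanishes.
\<close>

lemma ideal_UP_monic_generator:
  assumes I: "ideal I (UP K)" and ne: "I \<noteq> {\<zero>\<^bsub>UP K\<^esub>}"
  obtains m where "m \<in> carrier (UP K)" "coeff (UP K) m (deg K m) = \<one>" "I = PIdl\<^bsub>UP K\<^esub> m"
proof -
  interpret I: ideal I "UP K" by (rule I)
  obtain b where b: "b \<in> I" "b \<noteq> \<zero>\<^bsub>UP K\<^esub>"
    and least: "\<And>q. q \<in> I \<Longrightarrow> q \<noteq> \<zero>\<^bsub>UP K\<^esub> \<Longrightarrow> deg K b \<le> deg K q"
  proof -
    obtain b0 where "b0 \<in> I \<and> b0 \<noteq> \<zero>\<^bsub>UP K\<^esub>"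
      using ne I.zero_closed by blast
    then show ?thesis
      using that arg_min_nat_lemma[of "\<lambda>q. q \<in> I \<and> q \<noteq> \<zero>\<^bsub>UP K\<^esub>" b0 "deg K"] by blast
  qed
  have bc: "b \<in> carrier (UP K)" using b by simp
  define c where "c = inv (coeff (UP K) b (deg K b))"
  have lb: "coeff (UP K) b (deg K b) \<in> Units K"
    using UP.lcoeff_nonzero[OF b(2) bc] bc by (simp add: R.field_Units)
  then have c: "c \<in> carrier K" "c \<noteq> \<zero>" "c \<otimes> coeff (UP K) b (deg K b) = \<one>"
    unfolding c_def using R.Units_inv_Units[OF lb] by (auto simp: R.field_Units)
  define m where "m = c \<odot>\<^bsub>UP K\<^esub> b"
  have m: "m \<in> carrier (UP K)" "deg K m = deg K b"
    using bc c by (simp_all add: m_def)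
  have lm: "coeff (UP K) m (deg K m) = \<one>"
    using bc c by (simp add: m_def)
  have mI: "m \<in> I"
    using I.I_l_closed[OF b(1), of "monom (UP K) c 0"] bc c
    by (simp add: m_def UP.monom_mult_is_smult)
  have m0: "m \<noteq> \<zero>\<^bsub>UP K\<^esub>"
    using lm by auto
  have "q \<in> PIdl\<^bsub>UP K\<^esub> m" if q: "q \<in> I" for q
  proof -
    have qc: "q \<in> carrier (UP K)" using q by simp
    obtain s r k where sr: "s \<in> carrier (UP K)" "r \<in> carrier (UP K)"
      "coeff (UP K) m (deg K m) [^] (k::nat) \<odot>\<^bsub>UP K\<^esub> q = m \<otimes>\<^bsub>UP K\<^esub> s \<oplus>\<^bsub>UP K\<^esub> r"
      "r = \<zero>\<^bsub>UP K\<^esub> \<or> deg K r < deg K m"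
      using UP.long_div_theorem[OF m(1) qc m0] by blast
    then have e: "q = m \<otimes>\<^bsub>UP K\<^esub> s \<oplus>\<^bsub>UP K\<^esub> r"
      using qc by (simp add: lm)
    have "r = q \<ominus>\<^bsub>UP K\<^esub> m \<otimes>\<^bsub>UP K\<^esub> s"
      using e m sr by (simp add: UP.P.minus_eq UP.P.add.m_ac UP.P.r_neg UP.P.r_neg1 UP.P.r_neg2)
    moreover have "m \<otimes>\<^bsub>UP K\<^esub> s \<in> I"
      using mI sr(1) by (rule I.I_r_closed)
    ultimately have "r \<in> I"
      using q by (simp add: UP.P.minus_eq I.a_closed I.a_inv_closed)
    then have "r = \<zero>\<^bsub>UP K\<^esub>"
      using sr(4) least[of r] m(2) by fastforce
    then have "q = s \<otimes>\<^bsub>UP K\<^esub> m"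
      using e m sr by (simp add: UP.P.m_comm)
    then show ?thesis
      using sr(1) by (auto simp: cgenideal_def)
  qed
  moreover have "PIdl\<^bsub>UP K\<^esub> m \<subseteq> I"
    using mI I.I_l_closed by (auto simp: cgenideal_def)
  ultimately show ?thesis
    using that[OF m(1) lm] by blast
qed

lemma monic_generator_unique:
  assumes m: "m \<in> carrier (UP K)" "coeff (UP K) m (deg K m) = \<one>"
    and n: "n \<in> carrier (UP K)" "coeff (UP K) n (deg K n) = \<one>"
    and dvd: "m divides\<^bsub>UP K\<^esub> n" and deg: "deg K n \<le> deg K m"
  shows "n = m"
proof -
  obtain x where x: "x \<in> carrier (UP K)" "n = m \<otimes>\<^bsub>UP K\<^esub> x"
    using dvd by (auto simp: factor_def)
  have n0: "n \<noteq> \<zero>\<^bsub>UP K\<^esub>" "m \<noteq> \<zero>\<^bsub>UP K\<^esub>"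
    using m n by auto
  then have x0: "x \<noteq> \<zero>\<^bsub>UP K\<^esub>"
    using x m by auto
  have "deg K n = deg K m + deg K x"
    using n0 x0 x m by (simp add: UP.deg_mult)
  then have dx: "deg K x = 0" "deg K n = deg K m" using deg by auto
  define c where "c = coeff (UP K) x 0"
  have c: "c \<in> carrier K" using x by (simp add: c_def)
  have "x = monom (UP K) c 0"
    unfolding c_def using UP.deg_zero_impl_monom[OF x(1) dx(1)] .
  then have "n = c \<odot>\<^bsub>UP K\<^esub> m"
    using x m c UP.P.m_comm[OF m(1) x(1)] by (simp add: UP.monom_mult_is_smult)
  moreover have "c = \<one>"
    using n(2) m c dx(2) \<open>n = c \<odot>\<^bsub>UP K\<^esub> m\<close> by simp
  ultimately show ?thesis
    using m by simp
qed

text \<open>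
  As soon as one nonzero polynomial kills g modulo J, the kernel of the substitution has exactly one
  monic generator, so the description in the definition of \<^const>\<open>min_poly\<close> is meaningful. Over the
  rationals such a polynomial comes from the finite dimension of the quotient, modulo p from reducing the
  rational minimal polynomial.
\<close>

lemma min_poly_characterization:
  fixes g :: "'n::finite pp \<Rightarrow> 'a"
  assumes J: "ideal J P" and g: "g \<in> carrier P"
    and q0: "q0 \<in> carrier (UP K)" "q0 \<noteq> \<zero>\<^bsub>UP K\<^esub>" "poly_at K g q0 \<in> J"
  shows "min_poly K g J \<in> carrier (UP K)"
    and "min_poly K g J (deg K (min_poly K g J)) = \<one>"
    and "q \<in> carrier (UP K) \<Longrightarrow> poly_at K g q \<in> J \<longleftrightarrow> min_poly K g J divides\<^bsub>UP K\<^esub> q"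
proof -
  interpret J: ideal J "P :: ('n pp \<Rightarrow> 'a) ring" by (rule J)
  let ?ker = "a_kernel (UP K) (P Quot J) (subst_hom K g J)"
  let ?mono = "\<lambda>m. m \<in> carrier (UP K) \<and> coeff (UP K) m (deg K m) = \<one> \<and> ?ker = PIdl\<^bsub>UP K\<^esub> m"
  interpret ev: ring_hom_ring "UP K" "P :: ('n pp \<Rightarrow> 'a) ring" "poly_at K g"
    by (rule ring_hom_ringI2) (auto simp: UP.P.ring_axioms P.ring_axioms poly_at_hom[OF g])
  have "?ker = {q \<in> carrier (UP K). poly_at K g q \<in> J}"
    using mem_kernel_iff[OF J g] by blast
  then have "ideal ?ker (UP K)"
    using ev.ideal_vimage[OF J] by simp
  moreover have "q0 \<in> ?ker"
    using q0 mem_kernel_iff[OF J g] by blast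
  ultimately obtain m where m: "?mono m"
    using q0(2) by (metis ideal_UP_monic_generator singletonD)
  have self: "n \<in> PIdl\<^bsub>UP K\<^esub> n" if "n \<in> carrier (UP K)" for n
    using that by (rule UP.P.cgenideal_self)
  have dvd: "x \<in> PIdl\<^bsub>UP K\<^esub> n \<longleftrightarrow> n divides\<^bsub>UP K\<^esub> x" if "n \<in> carrier (UP K)" for n x
    using that UP.P.m_comm by (fastforce simp: cgenideal_def factor_def)
  have "n = m" if n: "?mono n" for n
  proof (cases "deg K n \<le> deg K m")
    case True
    have "m divides\<^bsub>UP K\<^esub> n" using m n self dvd by blast
    then show ?thesis
      using monic_generator_unique[of m n] m n True by blast
  next
    case False
    have "n divides\<^bsub>UP K\<^esub> m" using m n self dvd by blast
    then show ?thesis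
      using monic_generator_unique[of n m] m n False by simp
  qed
  then have "min_poly K g J = m"
    unfolding min_poly_def using m by (intro the_equality) blast+
  then show "min_poly K g J \<in> carrier (UP K)"
    "min_poly K g J (deg K (min_poly K g J)) = \<one>"
    "q \<in> carrier (UP K) \<Longrightarrow> poly_at K g q \<in> J \<longleftrightarrow> min_poly K g J divides\<^bsub>UP K\<^esub> q"
    using m dvd mem_kernel_iff[OF J g] coeff_UP[of m K] by auto
qed

text \<open>
  In dimension n the n + 1 powers \<open>1, g, \<dots>, g\<^sup>n\<close> have a nontrivial linear relation.
\<close>

lemma zero_dimensional_imp_algebraic:
  fixes g :: "'n::finite pp \<Rightarrow> 'a"
  assumes zd: "zero_dimensional K J" and g: "g \<in> carrier P"
  obtains q where "q \<in> carrier (UP K)" "q \<noteq> \<zero>\<^bsub>UP K\<^esub>" "poly_at K g q \<in> J"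
proof -
  have J: "ideal J P" using zd by (simp add: zero_dimensional_def)
  interpret J: ideal J "P :: ('n pp \<Rightarrow> 'a) ring" by (rule J)
  let ?Q = "P Quot J" and ?h = "\<lambda>c. J +>\<^bsub>P\<^esub> mpoly_const K c"
  interpret Q: UP_pre_univ_prop K ?Q ?h "UP K"
    by (rule quot_UP_pre_univ_prop[OF J])
  have h: "ring_hom_ring K ?Q ?h"
    by (rule ring_hom_ringI2) (auto simp: R.ring_axioms Q.S.ring_axioms Q.homh)
  have sub: "subfield (?h ` carrier K) ?Q"
  proof (rule ring_hom_ring.img_is_subfield[OF h])
    show "subfield (carrier K) K" by (rule R.carrier_is_subfield)
    show "\<one>\<^bsub>?Q\<^esub> \<noteq> \<zero>\<^bsub>?Q\<^esub>"
      using zd Q.S.carrier_one_zero by (auto simp: zero_dimensional_def)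
  qed
  obtain n where n: "Q.S.dimension n (?h ` carrier K) (carrier ?Q)"
    using zd by (auto simp: zero_dimensional_def Q.S.finite_dimension_def)
  define u where "u = J +>\<^bsub>P\<^esub> g"
  have u: "u \<in> carrier ?Q"
    using ring_hom_closed[OF J.rcos_ring_hom g] by (simp add: u_def)
  define Us where "Us = map (\<lambda>i::nat. u [^]\<^bsub>?Q\<^esub> i) [0..<Suc n]"
  have Us: "set Us \<subseteq> carrier ?Q"
    using u by (auto simp: Us_def)
  have "\<not> Q.S.independent (?h ` carrier K) Us"
    using Q.S.independent_length_le_dimension[OF sub n _ Us] by (auto simp: Us_def)
  then obtain Ks where Ks: "length Ks = length Us" "Q.S.combine Ks Us = \<zero>\<^bsub>?Q\<^esub>"
    "set Ks \<subseteq> ?h ` carrier K" "set Ks \<noteq> {\<zero>\<^bsub>?Q\<^esub>}"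
    using Q.S.dependent_imp_non_trivial_combine[OF sub Us] by blast
  have len: "length Ks = Suc n" using Ks(1) by (simp add: Us_def)
  have "\<exists>c. c \<in> carrier K \<and> ?h c = Ks ! i" if "i \<le> n" for i
  proof -
    have "Ks ! i \<in> set Ks"
      using len that by simp
    with Ks(3) have "Ks ! i \<in> ?h ` carrier K"
      by (rule subsetD)
    then show ?thesis by blast
  qed
  then obtain c where c: "\<And>i. i \<le> n \<Longrightarrow> c i \<in> carrier K" "\<And>i. i \<le> n \<Longrightarrow> ?h (c i) = Ks ! i"
    by metis
  define q where "q = (\<lambda>i. if i \<le> n then c i else \<zero>)"
  have q: "q \<in> carrier (UP K)"
    unfolding UP_def by (auto simp: q_def c intro!: exI[of _ n] mem_upI)
  have dq: "deg K q \<le> n"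
    by (rule UP.deg_aboveI[OF _ q], unfold coeff_UP[OF q]) (simp add: q_def)
  have Kq: "Ks = map (\<lambda>i. ?h (q i)) [0..<Suc n]"
    by (rule nth_equalityI) (auto simp: len q_def c simp del: upt_Suc)
  have "subst_hom K g J q = (\<Oplus>\<^bsub>?Q\<^esub>i\<in>{..n}. ?h (q i) \<otimes>\<^bsub>?Q\<^esub> u [^]\<^bsub>?Q\<^esub> i)"
    unfolding subst_hom_def u_def[symmetric]
    using Q.eval_eq_finsum_le[OF u q dq] by (simp add: coeff_UP[OF q])
  also have "\<dots> = Q.S.combine Ks Us"
    unfolding Kq Us_def
  proof (subst Q.S.combine_map_eq_finsum)
    have "q i \<in> carrier K" for i
      by (simp add: q_def c)
    then show "?h (q i) \<in> carrier ?Q" for i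
      by (rule Q.hom_closed)
  qed (use u in \<open>auto simp: lessThan_Suc_atMost\<close>)
  finally have "q \<in> a_kernel (UP K) ?Q (subst_hom K g J)"
    using q Ks(2) by (simp add: a_kernel_def')
  then have 1: "poly_at K g q \<in> J"
    using mem_kernel_iff[OF J g] by blast
  have "q \<noteq> \<zero>\<^bsub>UP K\<^esub>"
  proof
    assume "q = \<zero>\<^bsub>UP K\<^esub>"
    then have "q = (\<lambda>i. \<zero>)" by (simp add: UP_def)
    then have "Ks = map (\<lambda>i. \<zero>\<^bsub>?Q\<^esub>) [0..<Suc n]"
      using Kq by (simp del: upt_Suc)
    then have "set Ks = {\<zero>\<^bsub>?Q\<^esub>}"
      by (auto simp del: upt_Suc)
    then show False using Ks(4) by blast
  qed
  then show ?thesis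
    using that q 1 by blast
qed

end

section \<open>Dickson's lemma and term orderings\<close>

lemma ex_incseq_subseq_nat:
  fixes X :: "nat \<Rightarrow> nat"
  obtains r :: "nat \<Rightarrow> nat" where "strict_mono r" "incseq (X \<circ> r)"
proof -
  obtain r :: "nat \<Rightarrow> nat" where r: "strict_mono r" "monoseq (\<lambda>k. X (r k))"
    using seq_monosub[of X] by blast
  show thesis
  proof (cases "incseq (X \<circ> r)")
    case True
    then show thesis using that r(1) by blast
  next
    case False
    then have dec: "X (r n) \<le> X (r m)" if "m \<le> n" for m n
      using r(2) that by (auto simp: monoseq_def incseq_def)
    obtain k where k: "\<And>n. X (r k) \<le> X (r n)"
      using ex_has_least_nat[of "\<lambda>_. True" 0 "\<lambda>k. X (r k)"] by blast
    have const: "X (r (n + k)) = X (r k)" for n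
      by (rule antisym) (simp_all add: dec k)
    have "strict_mono (\<lambda>n. r (n + k))"
      using r(1) by (simp add: strict_mono_def)
    moreover have "incseq (X \<circ> (\<lambda>n. r (n + k)))"
      by (simp add: incseq_def const)
    ultimately show thesis using that by blast
  qed
qed

text \<open>
  Pass to subsequences on which one coordinate after another is increasing; as there are finitely many
  coordinates, the result increases in every one of them.
\<close>

theorem dickson:
  fixes s :: "nat \<Rightarrow> 'n::finite pp"
  obtains i j where "i < j" "s i \<le> s j"
proof -
  have "\<exists>r::nat \<Rightarrow> nat. strict_mono r \<and> (\<forall>x\<in>A. incseq (\<lambda>k. s (r k) x))" if "finite A" for A
    using that
  proof induction
    case empty
    show ?case by (rule exI[of _ id]) (simp add: strict_mono_def)
  next
    case (insert x A)
    then obtain r where r: "strict_mono r" "\<forall>y\<in>A. incseq (\<lambda>k. s (r k) y)" by blast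
    obtain q :: "nat \<Rightarrow> nat" where q: "strict_mono q" "incseq ((\<lambda>k. s (r k) x) \<circ> q)"
      by (rule ex_incseq_subseq_nat)
    have "incseq (\<lambda>k. s (r (q k)) y)" if "y \<in> insert x A" for y
    proof (cases "y = x")
      case True
      then show ?thesis using q(2) by (simp add: comp_def)
    next
      case False
      then have "incseq (\<lambda>k. s (r k) y)" using that r(2) by blast
      then show ?thesis
        using strict_mono_mono[OF q(1)] by (auto simp: incseq_def mono_def)
    qed
    moreover have "strict_mono (\<lambda>k. r (q k))"
      using strict_mono_o[OF r(1) q(1)] by (simp add: comp_def)
    ultimately show ?case
      by blast
  qed
  from this[OF finite_UNIV] obtain r where r: "strict_mono r" "\<And>x. incseq (\<lambda>k. s (r k) x)"
    by auto
  have "r 0 < r 1" using r(1) by (simp add: strict_mono_def)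
  moreover have "s (r 0) \<le> s (r 1)"
    using r(2) by (auto simp: le_fun_def incseq_def)
  ultimately show thesis by (rule that)
qed

lemma finite_antichain_pp:
  fixes M :: "'n::finite pp set"
  assumes "\<And>s t. s \<in> M \<Longrightarrow> t \<in> M \<Longrightarrow> s \<le> t \<Longrightarrow> s = t"
  shows "finite M"
proof (rule ccontr)
  assume "infinite M"
  then obtain s :: "nat \<Rightarrow> 'n pp" where s: "inj s" "range s \<subseteq> M"
    using infinite_countable_subset by blast
  obtain i j where "i < j" "s i \<le> s j" by (rule dickson)
  with assms[of "s i" "s j"] s show False
    by (auto dest: injD)
qed

locale term_order =
  fixes \<sigma> :: "'n::finite pp rel"
  assumes term_ordering: "term_ordering \<sigma>"
begin

lemma ord_refl [simp]: "(t, t) \<in> \<sigma>"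
  and ord_antisym: "(s, t) \<in> \<sigma> \<Longrightarrow> (t, s) \<in> \<sigma> \<Longrightarrow> s = t"
  and ord_trans: "(s, t) \<in> \<sigma> \<Longrightarrow> (t, u) \<in> \<sigma> \<Longrightarrow> (s, u) \<in> \<sigma>"
  and ord_linear: "(s, t) \<in> \<sigma> \<or> (t, s) \<in> \<sigma>"
  and ord_zero: "(0, t) \<in> \<sigma>"
  and ord_add: "(s, t) \<in> \<sigma> \<Longrightarrow> (s + u, t + u) \<in> \<sigma>"
proof -
  have lin: "linear_order \<sigma>" using term_ordering by (simp add: term_ordering_def)
  then have "refl \<sigma>" "trans \<sigma>" "antisym \<sigma>" "total \<sigma>"
    by (simp_all add: linear_order_on_def partial_order_on_def preorder_on_def)
  then show refl: "(t, t) \<in> \<sigma>"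
    "(s, t) \<in> \<sigma> \<Longrightarrow> (t, s) \<in> \<sigma> \<Longrightarrow> s = t"
    "(s, t) \<in> \<sigma> \<Longrightarrow> (t, u) \<in> \<sigma> \<Longrightarrow> (s, u) \<in> \<sigma>" for s t u
    by (auto simp: refl_on_def dest: antisymD transD)
  show "(s, t) \<in> \<sigma> \<or> (t, s) \<in> \<sigma>"
    using \<open>total \<sigma>\<close> refl(1) by (cases "s = t") (auto simp: total_on_def)
qed (use term_ordering in \<open>auto simp: term_ordering_def\<close>)

lemma ord_of_le: "s \<le> t \<Longrightarrow> (s, t) \<in> \<sigma>"
  using ord_add[OF ord_zero, of s "t - s"] by (simp add: pp_diff_add_cancel)

text \<open>
  In an infinite descending sequence some later member would be divisible by an earlier one, and
  divisibility implies the term ordering.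
\<close>

theorem wf_ord: "wf {(s, t). (s, t) \<in> \<sigma> \<and> s \<noteq> t}"
  unfolding wf_iff_no_infinite_down_chain
proof
  assume "\<exists>f. \<forall>i. (f (Suc i), f i) \<in> {(s, t). (s, t) \<in> \<sigma> \<and> s \<noteq> t}"
  then obtain f where f: "\<And>i. (f (Suc i), f i) \<in> \<sigma>" "\<And>i. f (Suc i) \<noteq> f i"
    by auto
  have desc: "(f (i + k), f i) \<in> \<sigma>" for i k
    by (induction k) (auto intro: ord_trans f)
  obtain i j where ij: "i < j" "f i \<le> f j" by (rule dickson)
  then have 1: "(f i, f j) \<in> \<sigma>" by (simp add: ord_of_le)
  have "(f j, f (Suc i)) \<in> \<sigma>"
    using desc[of "Suc i" "j - Suc i"] ij(1) by simp
  then have "(f i, f (Suc i)) \<in> \<sigma>"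
    using 1 ord_trans by blast
  then show False using f ord_antisym by metis
qed

lemma ex_ord_max:
  assumes "finite S" "S \<noteq> {}"
  shows "\<exists>t\<in>S. \<forall>s\<in>S. (s, t) \<in> \<sigma>"
  using assms
proof (induction rule: finite_ne_induct)
  case (insert x F)
  then obtain t where t: "t \<in> F" "\<forall>s\<in>F. (s, t) \<in> \<sigma>" by blast
  show ?case
  proof (cases "(t, x) \<in> \<sigma>")
    case True
    then show ?thesis using t by (auto intro: ord_trans)
  next
    case False
    then show ?thesis using t ord_linear by blast
  qed
qed simp

end

section \<open>Rational polynomials and monomial ideals\<close>

lemma field_rat_ring: "field rat_ring"
proof -
  have "\<exists>y. y + x = 0" for x :: rat
    by (rule exI[of _ "- x"]) simp
  then have ag: "abelian_group rat_ring"
    by (intro abelian_groupI) (simp_all add: rat_ring_def)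
  have "comm_monoid rat_ring"
    by (rule comm_monoidI) (simp_all add: rat_ring_def)
  with ag have "cring rat_ring"
    by (rule cringI) (simp add: rat_ring_def distrib_right)
  then show ?thesis
  proof (rule cring.cring_fieldI2)
    show "\<exists>y\<in>carrier rat_ring. x \<otimes>\<^bsub>rat_ring\<^esub> y = \<one>\<^bsub>rat_ring\<^esub>"
      if "x \<in> carrier rat_ring" "x \<noteq> \<zero>\<^bsub>rat_ring\<^esub>" for x
      by (rule bexI[of _ "1 / x"]) (use that in \<open>simp_all add: rat_ring_def\<close>)
  qed (simp add: rat_ring_def)
qed

lemma mpoly_field_rat_ring: "mpoly_field rat_ring"
  by (rule mpoly_field.intro) (rule field_rat_ring)

interpretation rat: mpoly_cring rat_ring
  by (rule mpoly_cring.intro) (rule fieldE(1)[OF field_rat_ring])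

lemma rat_ring_simps [simp]:
  "carrier rat_ring = UNIV" "x \<otimes>\<^bsub>rat_ring\<^esub> y = x * y" "x \<oplus>\<^bsub>rat_ring\<^esub> y = x + y"
  "\<one>\<^bsub>rat_ring\<^esub> = 1" "\<zero>\<^bsub>rat_ring\<^esub> = 0"
  by (simp_all add: rat_ring_def)

lemma rat_ring_minus [simp]: "\<ominus>\<^bsub>rat_ring\<^esub> x = - x"
  by (rule rat.R.minus_equality) simp_all

lemma rat_ring_finsum [simp]: "finsum rat_ring f A = sum f A"
  by (induction A rule: infinite_finite_induct) (simp_all add: rat.R.finsum_infinite rat.R.finsum_insert)

abbreviation rat_mpoly :: "('n::finite pp \<Rightarrow> rat) ring" where
  "rat_mpoly \<equiv> mpoly_ring rat_ring"

lemma rat_mpoly_carrier: "f \<in> carrier rat_mpoly \<longleftrightarrow> finite {t. f t \<noteq> 0}"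
  using rat.mpoly_finite[of f] rat.mpolyI[of f] by auto

lemma rat_mpoly_add: "f \<oplus>\<^bsub>rat_mpoly\<^esub> g = f + g"
  and rat_mpoly_mult: "(f \<otimes>\<^bsub>rat_mpoly\<^esub> g) t = (\<Sum>s\<le>t. f s * g (t - s))"
  by (auto simp: rat.mpoly_add rat.mpoly_zero rat.mpoly_mult fun_eq_iff)

lemma rat_mpoly_closed [intro]:
  fixes f g :: "'n::finite pp \<Rightarrow> rat"
  shows "f \<in> carrier rat_mpoly \<Longrightarrow> g \<in> carrier rat_mpoly \<Longrightarrow> f + g \<in> carrier rat_mpoly"
    and "f \<in> carrier rat_mpoly \<Longrightarrow> g \<in> carrier rat_mpoly \<Longrightarrow> f - g \<in> carrier rat_mpoly"
    and "f \<in> carrier rat_mpoly \<Longrightarrow> (\<lambda>t. a * f t) \<in> carrier rat_mpoly"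
    and "(\<lambda>t. 0) \<in> carrier rat_mpoly"
proof -
  have "finite {t. f t + g t \<noteq> 0} \<and> finite {t. f t - g t \<noteq> 0}" if "finite {t. f t \<noteq> 0}" "finite {t. g t \<noteq> 0}"
    by (intro conjI; rule finite_subset[of _ "{t. f t \<noteq> 0} \<union> {t. g t \<noteq> 0}"]) (use that in auto)
  then show "f \<in> carrier rat_mpoly \<Longrightarrow> g \<in> carrier rat_mpoly \<Longrightarrow> f + g \<in> carrier rat_mpoly"
    "f \<in> carrier rat_mpoly \<Longrightarrow> g \<in> carrier rat_mpoly \<Longrightarrow> f - g \<in> carrier rat_mpoly"
    by (simp_all add: rat_mpoly_carrier)
qed (auto simp: rat_mpoly_carrier)

lemma rat_ideal:
  assumes J: "ideal J (rat_mpoly :: ('n::finite pp \<Rightarrow> rat) ring)"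
  shows rat_ideal_finite: "f \<in> J \<Longrightarrow> f \<in> carrier rat_mpoly"
    and rat_ideal_add: "f \<in> J \<Longrightarrow> g \<in> J \<Longrightarrow> f + g \<in> J"
    and rat_ideal_scale: "f \<in> J \<Longrightarrow> (\<lambda>t. a * f t) \<in> J"
    and rat_ideal_diff: "f \<in> J \<Longrightarrow> g \<in> J \<Longrightarrow> f - g \<in> J"
    and rat_ideal_zero: "(\<lambda>t. 0) \<in> J"
    and rat_ideal_shift: "f \<in> J \<Longrightarrow> (\<lambda>t. if u \<le> t then f (t - u) else 0) \<in> J"
proof -
  interpret J: ideal J rat_mpoly by (rule J)
  show c: "f \<in> carrier rat_mpoly" if "f \<in> J" for f using that by simp
  show add: "f + g \<in> J" if "f \<in> J" "g \<in> J" for f g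
    using J.a_closed[OF that] by (simp add: rat_mpoly_add)
  have mult: "(\<lambda>t. if u \<le> t then a * f (t - u) else 0) \<in> J" if f: "f \<in> J" for f u a
    using J.I_l_closed[OF f, of "\<lambda>t. if t = u then a else 0"] rat.mpoly_monom_mult[OF _ c[OF f], of a u]
    by (simp add: rat_mpoly_carrier if_distrib[of "\<lambda>x. x \<noteq> 0"] cong: if_cong)
  show scale: "(\<lambda>t. a * f t) \<in> J" if "f \<in> J" for f a
    using mult[OF that, of 0 a] by (simp add: le_fun_def)
  show "f - g \<in> J" if "f \<in> J" "g \<in> J" for f g
    using add[OF that(1) scale[OF that(2), of "- 1"]] by (simp add: fun_diff_def plus_fun_def)
  show "(\<lambda>t. 0) \<in> J"
    using J.zero_closed by (simp add: rat.mpoly_zero)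
  show "(\<lambda>t. if u \<le> t then f (t - u) else 0) \<in> J" if "f \<in> J" for f
    using mult[OF that, of u 1] by (simp cong: if_cong)
qed

lemma (in mpoly_cring) pp_mpoly_closed [simp]: "pp_mpoly K t \<in> carrier P"
  by (rule mpolyI) (auto simp: pp_mpoly_def)

text \<open>
  The polynomials all of whose power-products are divisible by a member of S form an ideal, and it
  contains the generators.
\<close>

lemma (in mpoly_field) pp_mem_monomial_ideal_iff:
  fixes S :: "'n::finite pp set"
  shows "pp_mpoly K t \<in> Idl\<^bsub>P\<^esub> (pp_mpoly K ` S) \<longleftrightarrow> (\<exists>s\<in>S. s \<le> t)"
proof
  have pp: "pp_mpoly K u \<in> carrier P" for u :: "'n pp"
    by (rule mpolyI) (auto simp: pp_mpoly_def)
  have sub: "pp_mpoly K ` S \<subseteq> carrier P" using pp by blast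
  interpret I: ideal "Idl\<^bsub>P\<^esub> (pp_mpoly K ` S)" "P :: ('n pp \<Rightarrow> 'a) ring"
    using sub by (rule P.genideal_ideal)
  show "pp_mpoly K t \<in> Idl\<^bsub>P\<^esub> (pp_mpoly K ` S)" if ex: "\<exists>s\<in>S. s \<le> t"
  proof -
    obtain s where s: "s \<in> S" "s \<le> t" using ex by blast
    have 1: "pp_mpoly K s \<in> Idl\<^bsub>P\<^esub> (pp_mpoly K ` S)"
      using P.genideal_self[OF sub] s by blast
    have "pp_mpoly K (t - s) \<otimes>\<^bsub>P\<^esub> pp_mpoly K s = pp_mpoly K t"
      unfolding pp_mpoly_def[of K "t - s"]
    proof (subst mpoly_monom_mult)
      have "t - s \<le> u \<and> u - (t - s) = s \<longleftrightarrow> u = t" for u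
      proof
        assume u: "t - s \<le> u \<and> u - (t - s) = s"
        then show "u = t"
          using pp_diff_add_cancel[of "t - s" u] pp_diff_add_cancel[OF s(2)]
          by (simp add: add.commute)
      qed (use s(2) in \<open>auto simp: le_fun_def fun_eq_iff\<close>)
      then show "(\<lambda>u. if t - s \<le> u then \<one> \<otimes> pp_mpoly K s (u - (t - s)) else \<zero>) = pp_mpoly K t"
        by (intro ext) (auto simp: pp_mpoly_def)
    qed (auto simp: pp)
    then show ?thesis
      using I.I_l_closed[OF 1 pp, of "t - s"] by simp
  qed
  define M where "M = {f \<in> carrier (P :: ('n pp \<Rightarrow> 'a) ring). \<forall>t. f t \<noteq> \<zero> \<longrightarrow> (\<exists>s\<in>S. s \<le> t)}"
  have mult: "g \<otimes>\<^bsub>P\<^esub> f \<in> M" if "f \<in> M" "g \<in> carrier P" for f g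
  proof -
    have "\<exists>s\<in>S. s \<le> t" if "(g \<otimes>\<^bsub>P\<^esub> f) t \<noteq> \<zero>" for t
    proof (rule ccontr)
      assume no: "\<not> (\<exists>s\<in>S. s \<le> t)"
      have "f (t - s) = \<zero>" for s
        using no \<open>f \<in> M\<close> order_trans[of _ "t - s" t] by (fastforce simp: M_def le_fun_def)
      then have "(g \<otimes>\<^bsub>P\<^esub> f) t = \<zero>"
        unfolding mpoly_mult using \<open>g \<in> carrier P\<close> by (intro add.finprod_one_eqI) simp
      then show False using that by simp
    qed
    then show ?thesis
      using that by (simp add: M_def)
  qed
  have neg: "(\<ominus>\<^bsub>P\<^esub> f) = (\<lambda>t. \<ominus> f t)" if "f \<in> carrier P" for f :: "'n pp \<Rightarrow> 'a"
  proof
    fix t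
    have "\<ominus>\<^bsub>P\<^esub> f \<in> carrier P" using that by simp
    moreover have "(\<ominus>\<^bsub>P\<^esub> f) t \<oplus> f t = \<zero>"
      using P.l_neg[OF that] by (simp add: mpoly_add mpoly_zero fun_eq_iff)
    ultimately show "(\<ominus>\<^bsub>P\<^esub> f) t = \<ominus> f t"
      using that by (metis mpoly_closed minus_equality)
  qed
  have "ideal M P"
  proof (rule idealI)
    show "subgroup M (add_monoid P)"
    proof (rule P.add.subgroupI)
      show "M \<noteq> {}" by (auto simp: M_def mpoly_zero intro!: exI[of _ "\<zero>\<^bsub>P\<^esub>"])
      show "\<ominus>\<^bsub>P\<^esub> f \<in> M" if "f \<in> M" for f
      proof -
        have "f \<in> carrier P" using that by (simp add: M_def)
        then show ?thesis
          using that P.a_inv_closed[of f] by (auto simp: M_def neg[symmetric]) (simp add: neg)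
      qed
      show "f \<oplus>\<^bsub>P\<^esub> g \<in> M" if "f \<in> M" "g \<in> M" for f g
        using that by (auto simp: M_def mpoly_add mpoly_add_closed) (metis r_zero zero_closed)
    qed (auto simp: M_def)
    show "f \<otimes>\<^bsub>P\<^esub> g \<in> M" if "f \<in> M" "g \<in> carrier P" for f g
      using mult[OF that] P.m_comm[of f g] that by (simp add: M_def)
  qed (auto simp: mult P.ring_axioms)
  moreover have "pp_mpoly K ` S \<subseteq> M"
    using pp by (auto simp: M_def pp_mpoly_def split: if_splits)
  ultimately have "Idl\<^bsub>P\<^esub> (pp_mpoly K ` S) \<subseteq> M"
    by (rule P.genideal_minimal)
  then show "\<exists>s\<in>S. s \<le> t" if "pp_mpoly K t \<in> Idl\<^bsub>P\<^esub> (pp_mpoly K ` S)"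
    using that by (auto simp: M_def pp_mpoly_def)
qed

section \<open>Normal forms and the reduced Groebner basis\<close>

context term_order
begin

abbreviation lpp :: "('n pp \<Rightarrow> rat) \<Rightarrow> 'n pp" where
  "lpp \<equiv> lead_pp rat_ring \<sigma>"

lemma lead_pp_eqI:
  assumes "f t \<noteq> 0" "\<And>s. f s \<noteq> 0 \<Longrightarrow> (s, t) \<in> \<sigma>"
  shows "lpp f = t"
  unfolding lead_pp_def
  by (rule the_equality) (use assms in \<open>auto simp: pp_support_def intro: ord_antisym\<close>)

lemma lead_pp_nonzero:
  assumes "f \<in> carrier rat_mpoly" "f \<noteq> (\<lambda>t. 0)"
  shows "f (lpp f) \<noteq> 0" "f s \<noteq> 0 \<Longrightarrow> (s, lpp f) \<in> \<sigma>"
proof -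
  obtain t where t: "f t \<noteq> 0" "\<And>s. f s \<noteq> 0 \<Longrightarrow> (s, t) \<in> \<sigma>"
    using ex_ord_max[of "{t. f t \<noteq> 0}"] assms by (auto simp: rat_mpoly_carrier fun_eq_iff)
  then have "lpp f = t" by (rule lead_pp_eqI)
  then show "f (lpp f) \<noteq> 0" "f s \<noteq> 0 \<Longrightarrow> (s, lpp f) \<in> \<sigma>"
    using t by auto
qed

lemma pp_mem_lead_ideal_iff:
  "pp_mpoly rat_ring t \<in> lead_ideal rat_ring \<sigma> F \<longleftrightarrow> (\<exists>f\<in>F - {\<lambda>t. 0}. lpp f \<le> t)"
  using mpoly_field.pp_mem_monomial_ideal_iff[OF mpoly_field_rat_ring, of t "lpp ` (F - {\<lambda>t. 0})"]
  by (simp add: lead_ideal_def image_image rat.mpoly_zero)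

definition lead_pps :: "('n pp \<Rightarrow> rat) set \<Rightarrow> 'n pp set" where
  "lead_pps J = lpp ` (J - {\<lambda>t. 0})"

lemma shift_lead:
  fixes g :: "'n pp \<Rightarrow> rat"
  assumes g: "\<And>s. g s \<noteq> 0 \<Longrightarrow> (s, t) \<in> \<sigma>" and le: "t \<le> u"
  defines "h \<equiv> \<lambda>s. if u - t \<le> s then g (s - (u - t)) else 0"
  shows "h u = g t" and "h s \<noteq> 0 \<Longrightarrow> (s, u) \<in> \<sigma>"
proof -
  have "u - t \<le> u" "u - (u - t) = t"
    using le by (auto simp: le_fun_def fun_eq_iff)
  then show "h u = g t" by (simp add: h_def)
  assume "h s \<noteq> 0"
  then have s: "u - t \<le> s" "g (s - (u - t)) \<noteq> 0"
    by (auto simp: h_def split: if_splits)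
  from ord_add[OF g[OF s(2)], of "u - t"] show "(s, u) \<in> \<sigma>"
    using s(1) le by (simp add: pp_diff_add_cancel add.commute[of t])
qed

lemma lead_pps_upward:
  assumes J: "ideal J rat_mpoly" and t: "t \<in> lead_pps J" and le: "t \<le> u"
  obtains f where "f \<in> J" "f u = 1" "\<And>s. f s \<noteq> 0 \<Longrightarrow> (s, u) \<in> \<sigma>" "u \<in> lead_pps J"
proof -
  obtain g where g: "g \<in> J" "g \<noteq> (\<lambda>t. 0)" "t = lpp g"
    using t by (auto simp: lead_pps_def)
  note lg = lead_pp_nonzero[OF rat_ideal_finite[OF J g(1)] g(2), folded g(3)]
  define h where "h = (\<lambda>s. if u - t \<le> s then g (s - (u - t)) else 0)"
  note sh = shift_lead[of g t u, OF lg(2) le]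
  define f where "f = (\<lambda>s. inverse (g t) * h s)"
  have fJ: "f \<in> J"
    unfolding f_def h_def by (intro rat_ideal_scale[OF J] rat_ideal_shift[OF J] g)
  have fu: "f u = 1"
    using lg(1) sh(1) unfolding f_def h_def by simp
  have below: "(s, u) \<in> \<sigma>" if "f s \<noteq> 0" for s
    using sh(2)[of s] that unfolding f_def h_def by auto
  have "lpp f = u" using fu below by (intro lead_pp_eqI) auto
  then have "u \<in> lead_pps J"
    using fJ fu by (force simp: lead_pps_def)
  with that fJ fu below show thesis by blast
qed

lemma groebner_basis_divides_lead:
  assumes G: "groebner_basis rat_ring \<sigma> J G" and t: "t \<in> lead_pps J"
  obtains g where "g \<in> G" "lpp g \<le> t"
proof -
  have "pp_mpoly rat_ring t \<in> lead_ideal rat_ring \<sigma> J"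
    using t by (auto simp: pp_mem_lead_ideal_iff lead_pps_def)
  then have "pp_mpoly rat_ring t \<in> lead_ideal rat_ring \<sigma> G"
    using G by (simp add: groebner_basis_def)
  then show thesis
    using that by (auto simp: pp_mem_lead_ideal_iff)
qed

text \<open>
  The division algorithm, with two parameters that make it serve several purposes. The coefficients
  stay in a subring A of the rationals, because every element used for the reduction has leading
  coefficient 1. The difference between a polynomial and its normal form stays in D, which may be an
  ideal, or the part of an ideal on which additional information has been collected.
  
  By linearity it is enough to reduce power-products, and these are handled by induction along the term
  ordering: subtracting from t a monic element with leading power-product t leaves smaller ones.
\<close>

lemma ex_normal_form:
  fixes A :: "rat set"
  assumes A: "0 \<in> A" "1 \<in> A" "\<And>x y. x \<in> A \<Longrightarrow> y \<in> A \<Longrightarrow> x - y \<in> A"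
    and D0: "(\<lambda>t. 0) \<in> D"
    and D_add: "\<And>d e. d \<in> D \<Longrightarrow> e \<in> D \<Longrightarrow> d + e \<in> D"
    and D_scale: "\<And>a d. a \<in> A \<Longrightarrow> d \<in> D \<Longrightarrow> (\<lambda>t. a * d t) \<in> D"
    and A_mult: "\<And>x y. x \<in> A \<Longrightarrow> y \<in> A \<Longrightarrow> x * y \<in> A"
    and red: "\<And>t. t \<in> L \<Longrightarrow> \<exists>d\<in>D. d \<in> carrier rat_mpoly \<and> range d \<subseteq> A \<and> d t = 1 \<and>
      (\<forall>s. d s \<noteq> 0 \<longrightarrow> (s, t) \<in> \<sigma>)"
    and f: "f \<in> carrier rat_mpoly" "range f \<subseteq> A"
  shows "\<exists>r. r \<in> carrier rat_mpoly \<and> range r \<subseteq> A \<and> (\<forall>t\<in>L. r t = 0) \<and> f - r \<in> D"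
proof -
  define N where "N = {f. \<exists>r. r \<in> carrier rat_mpoly \<and> range r \<subseteq> A \<and> (\<forall>t\<in>L. r t = 0) \<and> f - r \<in> D}"
  have A_add: "x + y \<in> A" if "x \<in> A" "y \<in> A" for x y
    using A(3)[OF that(1) A(3)[OF A(1) that(2)]] by simp
  have N0: "(\<lambda>t. 0) \<in> N"
    unfolding N_def
    by (rule CollectI, rule exI[of _ "\<lambda>t. 0"]) (use A D0 rat_mpoly_closed(4) in \<open>auto simp: zero_fun_def\<close>)
  have N_add: "f + g \<in> N" if fg: "f \<in> N" "g \<in> N" for f g
  proof -
    obtain r q where r: "r \<in> carrier rat_mpoly" "range r \<subseteq> A" "\<forall>t\<in>L. r t = 0" "f - r \<in> D"
      and q: "q \<in> carrier rat_mpoly" "range q \<subseteq> A" "\<forall>t\<in>L. q t = 0" "g - q \<in> D"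
      using fg by (auto simp: N_def)
    have "f + g - (r + q) \<in> D"
      using D_add[OF r(4) q(4)] by (simp add: algebra_simps)
    then show ?thesis
      unfolding N_def
      by (intro CollectI exI[of _ "r + q"]) (use r q in \<open>auto intro!: A_add simp: image_subset_iff\<close>)
  qed
  have N_scale: "(\<lambda>t. a * f t) \<in> N" if fa: "f \<in> N" "a \<in> A" for f a
  proof -
    obtain r where r: "r \<in> carrier rat_mpoly" "range r \<subseteq> A" "\<forall>t\<in>L. r t = 0" "f - r \<in> D"
      using fa by (auto simp: N_def)
    have "(\<lambda>t. a * f t) - (\<lambda>t. a * r t) = (\<lambda>t. a * (f - r) t)"
      by (simp add: fun_eq_iff algebra_simps)
    then have "(\<lambda>t. a * f t) - (\<lambda>t. a * r t) \<in> D"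
      using D_scale[OF fa(2) r(4)] by simp
    then show ?thesis
      unfolding N_def
      by (intro CollectI exI[of _ "\<lambda>t. a * r t"])
        (use r fa in \<open>auto intro: A_mult simp: rat_mpoly_closed\<close>)
  qed
  have D_N: "D \<subseteq> N"
    unfolding N_def
    by (intro subsetI CollectI, rule exI[of _ "\<lambda>t. 0"])
      (use A rat_mpoly_closed(4) in \<open>auto simp: fun_diff_def\<close>)
  have comb: "f \<in> N"
    if f_supp: "f \<in> carrier rat_mpoly" "range f \<subseteq> A" "\<And>t. f t \<noteq> 0 \<Longrightarrow> pp_mpoly rat_ring t \<in> N" for f
  proof -
    have "(\<lambda>t. if t \<in> S then f t else 0) \<in> N" if "finite S" "S \<subseteq> {t. f t \<noteq> 0}" for S
      using that
    proof (induction S rule: finite_induct)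
      case (insert x S)
      have "(\<lambda>t. f x * pp_mpoly rat_ring x t) \<in> N"
        using insert.prems \<open>range f \<subseteq> A\<close> by (intro N_scale f_supp(3)) auto
      with insert have "(\<lambda>t. if t \<in> S then f t else 0) + (\<lambda>t. f x * pp_mpoly rat_ring x t) \<in> N"
        by (intro N_add) auto
      also have "(\<lambda>t. if t \<in> S then f t else 0) + (\<lambda>t. f x * pp_mpoly rat_ring x t)
          = (\<lambda>t. if t \<in> insert x S then f t else 0)"
        using insert.hyps by (intro ext) (auto simp: pp_mpoly_def)
      finally show ?case .
    qed (simp add: N0)
    from this[of "{t. f t \<noteq> 0}"] f_supp(1) have "(\<lambda>t. if f t \<noteq> 0 then f t else 0) \<in> N"
      by (simp add: rat_mpoly_carrier)
    moreover have "(\<lambda>t. if f t \<noteq> 0 then f t else 0) = f" by auto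
    ultimately show ?thesis by simp
  qed
  have pp: "pp_mpoly rat_ring t \<in> N" for t
  proof (induction t rule: wf_induct_rule[OF wf_ord])
    case (1 t)
    show ?case
    proof (cases "t \<in> L")
      case False
      then show ?thesis
        unfolding N_def
        by (intro CollectI exI[of _ "pp_mpoly rat_ring t"])
          (use A D0 False in \<open>auto simp: pp_mpoly_def rat_mpoly_carrier zero_fun_def if_distrib[of "\<lambda>x. x \<noteq> 0"] cong: if_cong\<close>)
    next
      case True
      then obtain d where d: "d \<in> D" "d \<in> carrier rat_mpoly" "range d \<subseteq> A" "d t = 1"
        "\<And>s. d s \<noteq> 0 \<Longrightarrow> (s, t) \<in> \<sigma>"
        using red by blast
      have pc: "pp_mpoly rat_ring t \<in> carrier rat_mpoly"
        by simp
      have "pp_mpoly rat_ring t - d \<in> N"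
      proof (rule comb)
        show "pp_mpoly rat_ring s \<in> N" if "(pp_mpoly rat_ring t - d) s \<noteq> 0" for s
          using that d by (intro "1.IH") (auto simp: pp_mpoly_def split: if_splits)
        show "range (pp_mpoly rat_ring t - d) \<subseteq> A"
          using d(3) A by (auto simp: pp_mpoly_def)
      qed (use pc d in blast)
      from N_add[OF this subsetD[OF D_N d(1)]] show ?thesis by simp
    qed
  qed
  have "f \<in> N" using f pp by (rule comb)
  then show ?thesis by (simp add: N_def)
qed

lemma reduced_zero:
  assumes J: "ideal J rat_mpoly" and "r \<in> J" "\<forall>t\<in>lead_pps J. r t = 0"
  shows "r = (\<lambda>t. 0)"
proof (rule ccontr)
  assume r0: "r \<noteq> (\<lambda>t. 0)"
  then have "lpp r \<in> lead_pps J"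
    using assms(2) by (auto simp: lead_pps_def)
  moreover have "r (lpp r) \<noteq> 0"
    using lead_pp_nonzero(1)[OF rat_ideal_finite[OF J assms(2)] r0] .
  ultimately show False using assms(3) by blast
qed

text \<open>
  The remainder modulo J, which depends on J and the term ordering only and not on a choice of
  generators or of reduction steps.
\<close>

definition nf :: "('n pp \<Rightarrow> rat) set \<Rightarrow> ('n pp \<Rightarrow> rat) \<Rightarrow> ('n pp \<Rightarrow> rat)" where
  "nf J f = (THE r. r \<in> carrier rat_mpoly \<and> (\<forall>t\<in>lead_pps J. r t = 0) \<and> f - r \<in> J)"

lemma nf_eqI:
  assumes J: "ideal J rat_mpoly"
    and r: "r \<in> carrier rat_mpoly" "\<forall>t\<in>lead_pps J. r t = 0" "f - r \<in> J"
  shows "nf J f = r"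
  unfolding nf_def
proof (rule the_equality)
  fix q assume q: "q \<in> carrier rat_mpoly \<and> (\<forall>t\<in>lead_pps J. q t = 0) \<and> f - q \<in> J"
  then have "(f - r) - (f - q) \<in> J"
    using rat_ideal_diff[OF J r(3)] q by blast
  then have "q - r \<in> J" by simp
  then have "q - r = (\<lambda>t. 0)"
    by (rule reduced_zero[OF J]) (use r q in auto)
  then show "q = r" by (simp add: fun_eq_iff)
qed (use r in auto)

lemma nf_props:
  assumes J: "ideal J rat_mpoly" and f: "f \<in> carrier rat_mpoly"
  shows nf_closed: "nf J f \<in> carrier rat_mpoly"
    and nf_reduced: "t \<in> lead_pps J \<Longrightarrow> nf J f t = 0"
    and nf_cong: "f - nf J f \<in> J"
proof -
  have "\<exists>r. r \<in> carrier rat_mpoly \<and> range r \<subseteq> UNIV \<and> (\<forall>t\<in>lead_pps J. r t = 0) \<and> f - r \<in> J"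
  proof (rule ex_normal_form)
    fix t assume "t \<in> lead_pps J"
    then obtain d where "d \<in> J" "d t = 1" "\<And>s. d s \<noteq> 0 \<Longrightarrow> (s, t) \<in> \<sigma>"
      using lead_pps_upward[OF J] by blast
    then show "\<exists>d\<in>J. d \<in> carrier rat_mpoly \<and> range d \<subseteq> UNIV \<and> d t = 1 \<and> (\<forall>s. d s \<noteq> 0 \<longrightarrow> (s, t) \<in> \<sigma>)"
      using rat_ideal_finite[OF J] by blast
  qed (use f rat_ideal_add[OF J] rat_ideal_scale[OF J] rat_ideal_zero[OF J] in auto)
  then obtain r where r: "r \<in> carrier rat_mpoly" "\<forall>t\<in>lead_pps J. r t = 0" "f - r \<in> J" by blast
  then show "nf J f \<in> carrier rat_mpoly" "t \<in> lead_pps J \<Longrightarrow> nf J f t = 0" "f - nf J f \<in> J"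
    using nf_eqI[OF J r] by auto
qed

lemma nf_of_mem: "ideal J rat_mpoly \<Longrightarrow> f \<in> J \<Longrightarrow> nf J f = (\<lambda>t. 0)"
  by (rule nf_eqI) (auto simp: fun_diff_def)

lemma nf_add:
  assumes J: "ideal J rat_mpoly" and f: "f \<in> carrier rat_mpoly" "g \<in> carrier rat_mpoly"
  shows "nf J (f + g) = nf J f + nf J g"
proof (rule nf_eqI[OF J])
  show "f + g - (nf J f + nf J g) \<in> J"
    using rat_ideal_add[OF J nf_cong[OF J f(1)] nf_cong[OF J f(2)]] by (simp add: algebra_simps)
qed (use nf_closed[OF J] nf_reduced[OF J] f in auto)

lemma nf_scale:
  assumes J: "ideal J rat_mpoly" and f: "f \<in> carrier rat_mpoly"
  shows "nf J (\<lambda>t. a * f t) = (\<lambda>t. a * nf J f t)"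
proof (rule nf_eqI[OF J])
  have "(\<lambda>t. a * f t) - (\<lambda>t. a * nf J f t) = (\<lambda>t. a * (f - nf J f) t)"
    by (simp add: fun_eq_iff algebra_simps)
  then show "(\<lambda>t. a * f t) - (\<lambda>t. a * nf J f t) \<in> J"
    using rat_ideal_scale[OF J nf_cong[OF J f]] by simp
qed (use nf_closed[OF J] nf_reduced[OF J] f in auto)

text \<open>
  The minimal generators of the monomial ideal of leading power-products.
\<close>

definition min_lead_pps :: "('n pp \<Rightarrow> rat) set \<Rightarrow> 'n pp set" where
  "min_lead_pps J = {t \<in> lead_pps J. \<forall>s\<in>lead_pps J. s \<le> t \<longrightarrow> s = t}"

lemma min_lead_pps_below:
  assumes t: "t \<in> lead_pps J"
  obtains m where "m \<in> min_lead_pps J" "m \<le> t"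
proof -
  obtain m where m: "m \<in> {s \<in> lead_pps J. s \<le> t}"
    and min: "\<And>s. (s, m) \<in> {(s, t). (s, t) \<in> \<sigma> \<and> s \<noteq> t} \<Longrightarrow> s \<notin> {s \<in> lead_pps J. s \<le> t}"
    using wfE_min[OF wf_ord, of t "{s \<in> lead_pps J. s \<le> t}"] t by auto
  have "s = m" if "s \<in> lead_pps J" "s \<le> m" for s
    using min[of s] that m ord_of_le[of s m] order_trans[of s m t] by auto
  then show thesis
    using m that by (auto simp: min_lead_pps_def)
qed

lemma finite_min_lead_pps: "finite (min_lead_pps J)"
  by (rule finite_antichain_pp) (auto simp: min_lead_pps_def)

text \<open>
  For t among the minimal leading power-products, the member of the reduced Groebner basis belonging to t.
\<close>

definition gb_elem :: "('n pp \<Rightarrow> rat) set \<Rightarrow> 'n pp \<Rightarrow> ('n pp \<Rightarrow> rat)" where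
  "gb_elem J t = pp_mpoly rat_ring t - nf J (pp_mpoly rat_ring t)"

lemma gb_elem:
  assumes J: "ideal J rat_mpoly" and t: "t \<in> lead_pps J"
  shows gb_elem_mem: "gb_elem J t \<in> J"
    and gb_elem_lead: "gb_elem J t t = 1"
    and gb_elem_support: "gb_elem J t s \<noteq> 0 \<Longrightarrow> s = t \<or> s \<notin> lead_pps J"
    and lead_pp_gb_elem: "lpp (gb_elem J t) = t"
proof -
  have pc: "pp_mpoly rat_ring t \<in> carrier rat_mpoly"
    by simp
  show mem: "gb_elem J t \<in> J"
    unfolding gb_elem_def by (rule nf_cong[OF J pc])
  show one: "gb_elem J t t = 1"
    using nf_reduced[OF J pc t] by (simp add: gb_elem_def pp_mpoly_def)
  show supp: "s = t \<or> s \<notin> lead_pps J" if "gb_elem J t s \<noteq> 0" for s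
    using that nf_reduced[OF J pc, of s] by (auto simp: gb_elem_def pp_mpoly_def)
  have ne: "gb_elem J t \<noteq> (\<lambda>t. 0)" using one by auto
  then have "lpp (gb_elem J t) \<in> lead_pps J"
    using mem by (auto simp: lead_pps_def)
  then show "lpp (gb_elem J t) = t"
    using supp lead_pp_nonzero(1)[OF rat_ideal_finite[OF J mem] ne] by blast
qed

lemma lead_ideal_eq_of_divides:
  assumes G: "G \<subseteq> J - {\<lambda>t. 0}" and dvd: "\<And>t. t \<in> lead_pps J \<Longrightarrow> \<exists>g\<in>G. lpp g \<le> t"
  shows "lead_ideal rat_ring \<sigma> G = lead_ideal rat_ring \<sigma> J"
proof
  let ?pp = "\<lambda>f. pp_mpoly rat_ring (lpp f)"
  have sub: "?pp ` (F - {\<zero>\<^bsub>rat_mpoly\<^esub>}) \<subseteq> carrier rat_mpoly" for F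
    by auto
  show "lead_ideal rat_ring \<sigma> G \<subseteq> lead_ideal rat_ring \<sigma> J"
    unfolding lead_ideal_def using G sub by (intro rat.P.subset_Idl_subset image_mono order_trans[OF _ rat.P.genideal_self[OF sub]]) auto
  have "?pp ` (J - {\<zero>\<^bsub>rat_mpoly\<^esub>}) \<subseteq> lead_ideal rat_ring \<sigma> G"
  proof
    fix h assume "h \<in> ?pp ` (J - {\<zero>\<^bsub>rat_mpoly\<^esub>})"
    then obtain t where t: "t \<in> lead_pps J" "h = pp_mpoly rat_ring t"
      by (auto simp: lead_pps_def rat.mpoly_zero)
    then show "h \<in> lead_ideal rat_ring \<sigma> G"
      using dvd[OF t(1)] G by (auto simp: pp_mem_lead_ideal_iff)
  qed
  then show "lead_ideal rat_ring \<sigma> J \<subseteq> lead_ideal rat_ring \<sigma> G"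
    unfolding lead_ideal_def[of _ _ J]
    by (intro rat.P.genideal_minimal) (auto simp: lead_ideal_def intro!: rat.P.genideal_ideal sub)
qed

text \<open>
  The leading power-products of a reduced Groebner basis have to be the minimal ones of the ideal. The
  remaining power-products of an element g are not leading power-products of the ideal at all, so the
  difference between g and its leading power-product is a normal form; since normal forms are unique,
  this leaves no choice for g.
\<close>

theorem is_reduced_gb_iff:
  assumes J: "ideal J rat_mpoly"
  shows "is_reduced_gb rat_ring \<sigma> J G \<longleftrightarrow> G = gb_elem J ` min_lead_pps J"
proof
  have min: "m \<in> lead_pps J" if "m \<in> min_lead_pps J" for m
    using that by (simp add: min_lead_pps_def)
  show "is_reduced_gb rat_ring \<sigma> J G" if G: "G = gb_elem J ` min_lead_pps J"
    unfolding is_reduced_gb_def groebner_basis_def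
  proof (intro conjI ballI)
    show "finite G" by (simp add: G finite_min_lead_pps)
    have nz: "gb_elem J m \<noteq> (\<lambda>t. 0)" if "m \<in> min_lead_pps J" for m
      using gb_elem_lead[OF J min[OF that]] by auto
    then have sub: "G \<subseteq> J - {\<lambda>t. 0}"
      using gb_elem_mem[OF J min] by (auto simp: G)
    then show "G \<subseteq> J - {\<zero>\<^bsub>rat_mpoly\<^esub>}" by (simp add: rat.mpoly_zero)
    show "lead_ideal rat_ring \<sigma> G = lead_ideal rat_ring \<sigma> J"
    proof (rule lead_ideal_eq_of_divides[OF sub])
      fix t assume "t \<in> lead_pps J"
      then obtain m where "m \<in> min_lead_pps J" "m \<le> t" by (rule min_lead_pps_below)
      then show "\<exists>g\<in>G. lpp g \<le> t"
        using lead_pp_gb_elem[OF J min] by (force simp: G)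
    qed
    show "g (lpp g) = \<one>\<^bsub>rat_ring\<^esub>" if "g \<in> G" for g
      using that gb_elem_lead[OF J min] lead_pp_gb_elem[OF J min] by (auto simp: G)
    show "\<not> lpp h \<le> t" if g: "g \<in> G" and h: "h \<in> G - {g}" and t: "t \<in> pp_support rat_ring g" for g h t
    proof
      assume le: "lpp h \<le> t"
      obtain m k where m: "m \<in> min_lead_pps J" "g = gb_elem J m"
        and k: "k \<in> min_lead_pps J" "h = gb_elem J k"
        using g h by (auto simp: G)
      have kt: "k \<le> t" using le lead_pp_gb_elem[OF J min[OF k(1)]] k(2) by simp
      have "t \<in> lead_pps J"
        using lead_pps_upward[OF J min[OF k(1)] kt] by blast
      then have "t = m"
        using t gb_elem_support[OF J min[OF m(1)]] m(2) by (auto simp: pp_support_def)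
      then have "k = m" using kt m(1) min[OF k(1)] by (auto simp: min_lead_pps_def)
      then show False using h m k by simp
    qed
  qed
  show "G = gb_elem J ` min_lead_pps J" if red: "is_reduced_gb rat_ring \<sigma> J G"
  proof -
    have gb: "groebner_basis rat_ring \<sigma> J G"
      and monic: "\<And>g. g \<in> G \<Longrightarrow> g (lpp g) = 1"
      and auto_red: "\<And>g h t. g \<in> G \<Longrightarrow> h \<in> G \<Longrightarrow> h \<noteq> g \<Longrightarrow> g t \<noteq> 0 \<Longrightarrow> \<not> lpp h \<le> t"
      using red by (auto simp: is_reduced_gb_def pp_support_def)
    have GJ: "g \<in> J" "g \<noteq> (\<lambda>t. 0)" if "g \<in> G" for g
      using gb that by (auto simp: groebner_basis_def rat.mpoly_zero)
    have lead: "lpp g \<in> lead_pps J" if "g \<in> G" for g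
      using GJ[OF that] by (auto simp: lead_pps_def)
    note divs = groebner_basis_divides_lead[OF gb]
    have eq: "g = gb_elem J (lpp g)" if g: "g \<in> G" for g
    proof -
      have gc: "g \<in> carrier rat_mpoly" by (rule rat_ideal_finite[OF J GJ(1)[OF g]])
      have other: "s \<notin> lead_pps J" if s: "g s \<noteq> 0" "s \<noteq> lpp g" for s
      proof
        assume "s \<in> lead_pps J"
        then obtain h where h: "h \<in> G" "lpp h \<le> s" by (rule divs)
        then have "h = g" using auto_red[OF g h(1) _ s(1)] by blast
        then have "(lpp g, s) \<in> \<sigma>" using h(2) by (simp add: ord_of_le)
        moreover have "(s, lpp g) \<in> \<sigma>"
          using lead_pp_nonzero(2)[OF gc GJ(2)[OF g] s(1)] .
        ultimately show False using s(2) ord_antisym by blast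
      qed
      have "nf J (pp_mpoly rat_ring (lpp g)) = pp_mpoly rat_ring (lpp g) - g"
      proof (rule nf_eqI[OF J])
        show "pp_mpoly rat_ring (lpp g) - g \<in> carrier rat_mpoly"
          using gc by (intro rat_mpoly_closed(2)) simp_all
        show "\<forall>t\<in>lead_pps J. (pp_mpoly rat_ring (lpp g) - g) t = 0"
          using other monic[OF g] by (auto simp: pp_mpoly_def)
        show "pp_mpoly rat_ring (lpp g) - (pp_mpoly rat_ring (lpp g) - g) \<in> J"
          using GJ(1)[OF g] by simp
      qed
      then show ?thesis by (simp add: gb_elem_def)
    qed
    have "lpp ` G = min_lead_pps J"
    proof (intro equalityI subsetI)
      fix t assume "t \<in> lpp ` G"
      then obtain g where g: "g \<in> G" "t = lpp g" by blast
      have "s = t" if s: "s \<in> lead_pps J" "s \<le> t" for s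
      proof -
        obtain h where h: "h \<in> G" "lpp h \<le> s" using s(1) by (rule divs)
        have "h = g"
          using auto_red[OF g(1) h(1), of t] monic[OF g(1)] g(2) h(2) s(2) order_trans by force
        then show ?thesis using h(2) s(2) g(2) by simp
      qed
      then show "t \<in> min_lead_pps J"
        using lead[OF g(1)] g(2) by (simp add: min_lead_pps_def)
    next
      fix m assume m: "m \<in> min_lead_pps J"
      then obtain g where g: "g \<in> G" "lpp g \<le> m" using min divs by blast
      then have "lpp g = m" using m lead[OF g(1)] by (simp add: min_lead_pps_def)
      then show "m \<in> lpp ` G" using g(1) by blast
    qed
    then have "gb_elem J ` min_lead_pps J = (\<lambda>g. gb_elem J (lpp g)) ` G"
      by (metis image_image)
    also have "\<dots> = G" using eq by (auto simp: image_iff) 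
    finally show ?thesis by simp
  qed
qed

corollary reduced_gb_is_reduced_gb:
  "ideal J rat_mpoly \<Longrightarrow> is_reduced_gb rat_ring \<sigma> J (reduced_gb rat_ring \<sigma> J)"
  unfolding reduced_gb_def by (rule theI') (simp add: is_reduced_gb_iff)

end

section \<open>The localization of the integers at a prime\<close>

text \<open>
  The local ring of the integers at p. It replaces the rings \<^term>\<open>int_frac \<delta>\<close>, one for each
  admissible \<open>\<delta>\<close>, by a single ring on which \<open>\<pi>\<close> is defined, and it has the advantage that the kernel
  of \<open>\<pi>\<close> consists of the multiples of p.
\<close>

definition zloc :: "nat \<Rightarrow> rat set" where
  "zloc p = {q. \<not> int p dvd snd (quotient_of q)}"

lemma zloc_iff:
  "q \<in> zloc p \<longleftrightarrow> (\<exists>a b. q * of_int b = of_int a \<and> \<not> int p dvd b)"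
proof
  obtain a' b' where ab: "quotient_of q = (a', b')" by force
  then have b'0: "b' > 0" and cop: "coprime a' b'" and q: "q = of_int a' / of_int b'"
    by (auto simp: quotient_of_denom_pos quotient_of_coprime quotient_of_div)
  show "\<exists>a b. q * of_int b = of_int a \<and> \<not> int p dvd b" if "q \<in> zloc p"
    using that ab b'0 q by (intro exI[of _ a'] exI[of _ b']) (auto simp: zloc_def)
  assume "\<exists>a b. q * of_int b = of_int a \<and> \<not> int p dvd b"
  then obtain a b where *: "q * of_int b = of_int a" "\<not> int p dvd b" by blast
  have "(of_int a' :: rat) = q * of_int b'"
    using q b'0 by simp
  then have "(of_int (a' * b) :: rat) = of_int (a * b')"
    by (simp add: *(1)[symmetric] algebra_simps)
  then have "a' * b = a * b'" by (simp only: of_int_eq_iff)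
  then have "b' dvd a' * b" by simp
  then have "b' dvd b" using cop by (simp add: coprime_commute coprime_dvd_mult_right_iff)
  then show "q \<in> zloc p"
    using *(2) ab dvd_trans by (auto simp: zloc_def)
qed

lemma zlocI: "q * of_int b = of_int a \<Longrightarrow> \<not> int p dvd b \<Longrightarrow> q \<in> zloc p"
  using zloc_iff by blast

lemma zlocE:
  assumes "q \<in> zloc p"
  obtains a b where "q = of_int a / of_int b" "\<not> int p dvd b" "b \<noteq> 0"
proof -
  obtain a b where *: "q * of_int b = of_int a" "\<not> int p dvd b"
    using assms by (auto simp: zloc_iff)
  then have "b \<noteq> 0" by auto
  with * that[of a b] show thesis by (simp add: field_simps)
qed

lemma residue_ring_simps [simp]:
  "carrier (residue_ring m) = {0..m - 1}"
  "x \<otimes>\<^bsub>residue_ring m\<^esub> y = (x * y) mod m" "x \<oplus>\<^bsub>residue_ring m\<^esub> y = (x + y) mod m"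
  "\<one>\<^bsub>residue_ring m\<^esub> = 1" "\<zero>\<^bsub>residue_ring m\<^esub> = 0"
  by (simp_all add: residue_ring_def)

lemma UP_rat_iff: "q \<in> carrier (UP rat_ring) \<longleftrightarrow> (\<exists>n. \<forall>i>n. q i = 0)"
  by (auto simp: UP_def up_def bound_def)

lemma UP_rat_mult_coeff:
  assumes "a \<in> carrier (UP rat_ring)" "b \<in> carrier (UP rat_ring)"
  shows "(a \<otimes>\<^bsub>UP rat_ring\<^esub> b) n = (\<Sum>i\<le>n. a i * b (n - i))"
  using assms by (simp add: UP_def)

locale prime_reduction =
  fixes p :: nat
  assumes prime_p: "prime p"
begin

abbreviation Fp :: "int ring" where
  "Fp \<equiv> residue_ring (int p)"

abbreviation Fp_mpoly :: "('n::finite pp \<Rightarrow> int) ring" where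
  "Fp_mpoly \<equiv> mpoly_ring Fp"

lemma p_gt [simp]: "int p > 0" "int p > 1" "p > 0" "p \<noteq> Suc 0" "1 mod int p = 1"
  using prime_gt_1_nat[OF prime_p] by auto

lemma mpoly_field_Fp: "mpoly_field Fp"
proof -
  interpret R: residues_prime p Fp
    using prime_p by unfold_locales simp_all
  show ?thesis
    by (rule mpoly_field.intro) (rule R.is_field)
qed

sublocale Fp: mpoly_cring Fp
  by (rule mpoly_cring.intro) (rule fieldE(1)[OF mpoly_field.axioms[OF mpoly_field_Fp]])

lemma finsum_Fp:
  assumes "finite A" "\<And>i. i \<in> A \<Longrightarrow> 0 \<le> f i \<and> f i < int p"
  shows "finsum Fp f A = (\<Sum>i\<in>A. f i) mod int p"
  using assms
proof (induction A rule: finite_induct)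
  case (insert x A)
  then have "finsum Fp f (insert x A) = f x \<oplus>\<^bsub>Fp\<^esub> finsum Fp f A"
    by (intro Fp.R.finsum_insert) auto
  then show ?case
    using insert by (simp add: mod_add_right_eq)
qed simp

lemma not_dvd_mult: "\<not> int p dvd a \<Longrightarrow> \<not> int p dvd b \<Longrightarrow> \<not> int p dvd a * b"
  using prime_p by (simp add: prime_dvd_mult_iff)

lemma zloc_of_int [simp, intro]: "of_int a \<in> zloc p"
  by (rule zlocI[of _ 1 a]) simp_all

lemma zloc_0 [simp, intro]: "0 \<in> zloc p" and zloc_1 [simp, intro]: "1 \<in> zloc p"
  using zloc_of_int[of 0] zloc_of_int[of 1] by simp_all

lemma zloc_mult [intro]: "x \<in> zloc p \<Longrightarrow> y \<in> zloc p \<Longrightarrow> x * y \<in> zloc p"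
proof (elim zlocE)
  fix a b c d assume *: "x = of_int a / of_int b" "y = of_int c / of_int d" "b \<noteq> 0" "d \<noteq> 0"
    "\<not> int p dvd b" "\<not> int p dvd d"
  then show ?thesis
    by (intro zlocI[of _ "b * d" "a * c"]) (auto simp: not_dvd_mult)
qed

lemma zloc_add [intro]: "x \<in> zloc p \<Longrightarrow> y \<in> zloc p \<Longrightarrow> x + y \<in> zloc p"
proof (elim zlocE)
  fix a b c d assume *: "x = of_int a / of_int b" "y = of_int c / of_int d" "b \<noteq> 0" "d \<noteq> 0"
    "\<not> int p dvd b" "\<not> int p dvd d"
  then show ?thesis
    by (intro zlocI[of _ "b * d" "a * d + c * b"]) (auto simp: not_dvd_mult field_simps)
qed

lemma zloc_diff [intro]: "x \<in> zloc p \<Longrightarrow> y \<in> zloc p \<Longrightarrow> x - y \<in> zloc p"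
  using zloc_add[of x "of_int (- 1) * y"] zloc_mult[OF zloc_of_int, of y "- 1"] by simp

lemma zloc_sum [intro]: "(\<And>i. i \<in> A \<Longrightarrow> f i \<in> zloc p) \<Longrightarrow> (\<Sum>i\<in>A. f i) \<in> zloc p"
  by (induction A rule: infinite_finite_induct) auto

text \<open>
  Two elements of the localization lie in a common ring of fractions \<^term>\<open>int_frac \<delta>\<close> with p not
  dividing \<open>\<delta>\<close>, for instance with the product of their denominators as \<open>\<delta>\<close>.
\<close>

lemma \<pi>_zloc:
  assumes "x \<in> zloc p" "y \<in> zloc p"
  shows \<pi>_range: "0 \<le> \<pi> p x" "\<pi> p x < int p"
    and \<pi>_add: "\<pi> p (x + y) = (\<pi> p x + \<pi> p y) mod int p"
    and \<pi>_mult: "\<pi> p (x * y) = (\<pi> p x * \<pi> p y) mod int p"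
proof -
  obtain a b where x: "x = of_int a / of_int b" "\<not> int p dvd b" "b \<noteq> 0"
    using assms(1) by (rule zlocE)
  obtain c d where y: "y = of_int c / of_int d" "\<not> int p dvd d" "d \<noteq> 0"
    using assms(2) by (rule zlocE)
  define \<delta> where "\<delta> = b * d"
  have \<delta>: "\<not> int p dvd \<delta>"
    using x y by (simp add: \<delta>_def not_dvd_mult)
  have mem: "x \<in> int_frac \<delta>" "y \<in> int_frac \<delta>"
  proof -
    have "x = of_int (a * d) / of_int \<delta> ^ 1" "y = of_int (c * b) / of_int \<delta> ^ 1"
      using x y by (simp_all add: \<delta>_def)
    then show "x \<in> int_frac \<delta>" "y \<in> int_frac \<delta>"
      unfolding int_frac_def by blast+
  qed
  note hom = \<pi>_ring_hom[OF prime_p \<delta>]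
  show "0 \<le> \<pi> p x" "\<pi> p x < int p"
    using ring_hom_closed[OF hom, of x] mem by simp_all
  show "\<pi> p (x + y) = (\<pi> p x + \<pi> p y) mod int p"
    using ring_hom_add[OF hom, of x y] mem by (simp add: rat_ring_def)
  show "\<pi> p (x * y) = (\<pi> p x * \<pi> p y) mod int p"
    using ring_hom_mult[OF hom, of x y] mem by (simp add: rat_ring_def)
qed

lemma \<pi>_of_int: "\<pi> p (of_int a) = a mod int p"
  by (rule \<pi>_eqI[OF prime_p, of _ 1 a]) (simp_all add: cong_def)

lemma \<pi>_0 [simp]: "\<pi> p 0 = 0" and \<pi>_1 [simp]: "\<pi> p 1 = 1"
  using \<pi>_of_int[of 0] \<pi>_of_int[of 1] by simp_all

lemma \<pi>_sum:
  assumes "\<And>i. i \<in> A \<Longrightarrow> f i \<in> zloc p"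
  shows "\<pi> p (\<Sum>i\<in>A. f i) = (\<Sum>i\<in>A. \<pi> p (f i)) mod int p"
  using assms
proof (induction A rule: infinite_finite_induct)
  case (insert x A)
  then show ?case
    by (simp add: \<pi>_add zloc_sum mod_add_right_eq)
qed simp_all

lemma \<pi>_eq_0_iff:
  assumes "x \<in> zloc p"
  shows "\<pi> p x = 0 \<longleftrightarrow> x / of_nat p \<in> zloc p"
proof
  obtain a b where x: "x = of_int a / of_int b" "\<not> int p dvd b" "b \<noteq> 0"
    using assms by (rule zlocE)
  show "x / of_nat p \<in> zloc p" if "\<pi> p x = 0"
  proof -
    have "of_int a = x * of_int b" using x by simp
    then have "a mod int p = (\<pi> p x * \<pi> p (of_int b)) mod int p"
      using \<pi>_mult[OF assms zloc_of_int, of b] \<pi>_of_int[of a] by simp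
    then have "int p dvd a" using that by (simp add: mod_eq_0_iff_dvd)
    then obtain c where "a = int p * c" by blast
    then show ?thesis
      using x by (intro zlocI[of _ b c]) simp_all
  qed
  assume "x / of_nat p \<in> zloc p"
  from \<pi>_mult[OF zloc_of_int[of "int p"] this] show "\<pi> p x = 0"
    using \<pi>_of_int[of "int p"] by simp
qed

lemma \<pi>_poly_mpoly_closed:
  assumes "h \<in> carrier rat_mpoly" "range h \<subseteq> zloc p"
  shows "\<pi>_poly p h \<in> carrier Fp_mpoly"
proof (rule Fp.mpolyI)
  show "\<pi>_poly p h t \<in> carrier Fp" for t
    using \<pi>_range[of "h t" 0] assms(2) by (simp add: \<pi>_poly_def image_subset_iff)
  show "finite {t. \<pi>_poly p h t \<noteq> \<zero>\<^bsub>Fp\<^esub>}"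
    by (rule finite_subset[of _ "{t. h t \<noteq> 0}"])
      (use assms(1) in \<open>auto simp: \<pi>_poly_def rat_mpoly_carrier\<close>)
qed

lemma \<pi>_poly_mpoly_add:
  assumes "range g \<subseteq> zloc p" "range h \<subseteq> zloc p"
  shows "\<pi>_poly p (g + h) = \<pi>_poly p g \<oplus>\<^bsub>Fp_mpoly\<^esub> \<pi>_poly p h"
  using assms by (simp add: \<pi>_poly_def Fp.mpoly_add fun_eq_iff \<pi>_add image_subset_iff)

lemma range_mpoly_mult:
  assumes "range g \<subseteq> zloc p" "range h \<subseteq> zloc p"
  shows "range (g \<otimes>\<^bsub>rat_mpoly\<^esub> h) \<subseteq> zloc p"
  using assms by (auto simp: rat_mpoly_mult image_subset_iff)

lemma \<pi>_poly_mpoly_mult: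
  assumes "range g \<subseteq> zloc p" "range h \<subseteq> zloc p"
  shows "\<pi>_poly p (g \<otimes>\<^bsub>rat_mpoly\<^esub> h) = \<pi>_poly p g \<otimes>\<^bsub>Fp_mpoly\<^esub> \<pi>_poly p h"
proof
  fix t
  have gh: "g s \<in> zloc p" "h s \<in> zloc p" for s
    using assms by auto
  have "\<pi>_poly p (g \<otimes>\<^bsub>rat_mpoly\<^esub> h) t = (\<Sum>s\<le>t. \<pi> p (g s * h (t - s))) mod int p"
    by (simp add: \<pi>_poly_def rat_mpoly_mult \<pi>_sum zloc_mult gh)
  also have "\<dots> = (\<Sum>s\<le>t. (\<pi> p (g s) * \<pi> p (h (t - s))) mod int p) mod int p"
    by (simp add: \<pi>_mult gh)
  also have "\<dots> = (\<pi>_poly p g \<otimes>\<^bsub>Fp_mpoly\<^esub> \<pi>_poly p h) t"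
    by (simp add: Fp.mpoly_mult \<pi>_poly_def finsum_Fp)
  finally show "\<pi>_poly p (g \<otimes>\<^bsub>rat_mpoly\<^esub> h) t = (\<pi>_poly p g \<otimes>\<^bsub>Fp_mpoly\<^esub> \<pi>_poly p h) t" .
qed

lemma \<pi>_poly_mpoly_pow:
  assumes f: "f \<in> carrier rat_mpoly" "range f \<subseteq> zloc p"
  shows "range (f [^]\<^bsub>rat_mpoly\<^esub> (i::nat)) \<subseteq> zloc p"
    and "\<pi>_poly p (f [^]\<^bsub>rat_mpoly\<^esub> i) = \<pi>_poly p f [^]\<^bsub>Fp_mpoly\<^esub> i"
proof -
  have "range (f [^]\<^bsub>rat_mpoly\<^esub> i) \<subseteq> zloc p \<and>
    \<pi>_poly p (f [^]\<^bsub>rat_mpoly\<^esub> i) = \<pi>_poly p f [^]\<^bsub>Fp_mpoly\<^esub> i"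
  proof (induction i)
    case 0
    show ?case
      by (auto simp: rat.mpoly_one Fp.mpoly_one \<pi>_poly_def)
  next
    case (Suc i)
    then show ?case
      using range_mpoly_mult[OF _ f(2)] \<pi>_poly_mpoly_mult[OF _ f(2)] by simp
  qed
  then show "range (f [^]\<^bsub>rat_mpoly\<^esub> i) \<subseteq> zloc p"
    "\<pi>_poly p (f [^]\<^bsub>rat_mpoly\<^esub> i) = \<pi>_poly p f [^]\<^bsub>Fp_mpoly\<^esub> i"
    by blast+
qed

lemma \<pi>_poly_mpoly_surj:
  assumes "k \<in> carrier Fp_mpoly"
  obtains h where "h \<in> carrier rat_mpoly" "range h \<subseteq> zloc p" "\<pi>_poly p h = k"
proof
  show "(\<lambda>t. of_int (k t)) \<in> carrier rat_mpoly"
    using Fp.mpoly_finite[OF assms] by (simp add: rat_mpoly_carrier)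
  show "\<pi>_poly p (\<lambda>t. of_int (k t)) = k"
    using Fp.mpoly_closed[OF assms] by (simp add: \<pi>_poly_def \<pi>_of_int fun_eq_iff)
qed auto

lemma UP_Fp_iff:
  "q \<in> carrier (UP Fp) \<longleftrightarrow> (\<forall>i. 0 \<le> q i \<and> q i < int p) \<and> (\<exists>n. \<forall>i>n. q i = 0)"
  by (auto simp: UP_def up_def bound_def Pi_def)

lemma \<pi>_poly_UP_closed:
  assumes "q \<in> carrier (UP rat_ring)" "range q \<subseteq> zloc p"
  shows "\<pi>_poly p q \<in> carrier (UP Fp)"
proof -
  obtain n where "\<forall>i>n. q i = 0" using assms(1) by (auto simp: UP_rat_iff)
  then have "\<forall>i>n. \<pi>_poly p q i = 0" by (simp add: \<pi>_poly_def)
  moreover have "0 \<le> \<pi>_poly p q i \<and> \<pi>_poly p q i < int p" for i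
    using \<pi>_range[of "q i" 0] assms(2) by (auto simp: \<pi>_poly_def)
  ultimately show ?thesis by (auto simp: UP_Fp_iff)
qed

lemma \<pi>_poly_UP_mult:
  assumes "a \<in> carrier (UP rat_ring)" "range a \<subseteq> zloc p" "b \<in> carrier (UP rat_ring)" "range b \<subseteq> zloc p"
  shows "\<pi>_poly p (a \<otimes>\<^bsub>UP rat_ring\<^esub> b) = \<pi>_poly p a \<otimes>\<^bsub>UP Fp\<^esub> \<pi>_poly p b"
proof
  fix n
  have ab: "a i \<in> zloc p" "b i \<in> zloc p" for i
    using assms by auto
  have up: "\<pi>_poly p a \<in> up Fp" "\<pi>_poly p b \<in> up Fp" "a \<in> up rat_ring" "b \<in> up rat_ring"
    using \<pi>_poly_UP_closed assms by (simp_all add: UP_def)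
  have "\<pi>_poly p (a \<otimes>\<^bsub>UP rat_ring\<^esub> b) n = \<pi> p (\<Sum>i\<le>n. a i * b (n - i))"
    using up by (simp add: \<pi>_poly_def UP_def)
  also have "\<dots> = (\<Sum>i\<le>n. (\<pi> p (a i) * \<pi> p (b (n - i))) mod int p) mod int p"
    by (simp add: \<pi>_sum zloc_mult ab \<pi>_mult)
  also have "\<dots> = (\<pi>_poly p a \<otimes>\<^bsub>UP Fp\<^esub> \<pi>_poly p b) n"
    using up by (simp add: UP_def finsum_Fp) (simp add: \<pi>_poly_def)
  finally show "\<pi>_poly p (a \<otimes>\<^bsub>UP rat_ring\<^esub> b) n = (\<pi>_poly p a \<otimes>\<^bsub>UP Fp\<^esub> \<pi>_poly p b) n" .
qed

lemma \<pi>_poly_poly_at: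
  assumes f: "f \<in> carrier rat_mpoly" "range f \<subseteq> zloc p"
    and q: "q \<in> carrier (UP rat_ring)" "range q \<subseteq> zloc p"
  shows "\<pi>_poly p (poly_at rat_ring f q) = poly_at Fp (\<pi>_poly p f) (\<pi>_poly p q)"
    and "range (poly_at rat_ring f q) \<subseteq> zloc p"
proof -
  interpret UPQ: UP_ring rat_ring "UP rat_ring" by unfold_locales simp
  interpret UPF: UP_ring Fp "UP Fp" by unfold_locales simp
  define n where "n = deg rat_ring q"
  have qz: "q i \<in> zloc p" for i using q(2) by auto
  have fz: "(f [^]\<^bsub>rat_mpoly\<^esub> (i::nat)) t \<in> zloc p" for i t
    using \<pi>_poly_mpoly_pow(1)[OF f] by auto
  have pc: "\<pi>_poly p q \<in> carrier (UP Fp)" using q by (rule \<pi>_poly_UP_closed)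
  have "deg Fp (\<pi>_poly p q) \<le> n"
  proof (rule UPF.deg_aboveI[OF _ pc])
    fix m assume "n < m"
    then have "q m = 0"
      using UPQ.deg_aboveD[OF _ q(1), of m] coeff_UP[OF q(1)] by (simp add: n_def)
    then show "coeff (UP Fp) (\<pi>_poly p q) m = \<zero>\<^bsub>Fp\<^esub>"
      unfolding coeff_UP[OF pc] by (simp add: \<pi>_poly_def)
  qed
  note R = Fp.poly_at_coeff[OF \<pi>_poly_mpoly_closed[OF f] pc this]
  note L = rat.poly_at_coeff[OF f(1) q(1), of n]
  show "range (poly_at rat_ring f q) \<subseteq> zloc p"
    using L by (auto simp: n_def intro!: zloc_sum zloc_mult qz fz)
  show "\<pi>_poly p (poly_at rat_ring f q) = poly_at Fp (\<pi>_poly p f) (\<pi>_poly p q)"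
  proof
    fix t
    have "\<pi>_poly p (poly_at rat_ring f q) t
        = (\<Sum>i\<le>n. (\<pi> p (q i) * \<pi> p ((f [^]\<^bsub>rat_mpoly\<^esub> i) t)) mod int p) mod int p"
      using L[of t] by (simp add: n_def \<pi>_poly_def \<pi>_sum zloc_mult \<pi>_mult qz fz)
    also have "\<dots> = poly_at Fp (\<pi>_poly p f) (\<pi>_poly p q) t"
      unfolding R
      by (simp add: finsum_Fp \<pi>_poly_mpoly_pow(2)[OF f, symmetric]) (simp add: \<pi>_poly_def)
    finally show "\<pi>_poly p (poly_at rat_ring f q) t
        = poly_at Fp (\<pi>_poly p f) (\<pi>_poly p q) t" .
  qed
qed

end

section \<open>The reduction of an ideal\<close>

locale usable_reduction = prime_reduction p + term_order \<sigma>
  for p :: nat and \<sigma> :: "'n::finite pp rel" +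
  fixes J :: "('n pp \<Rightarrow> rat) set"
  assumes ideal_J: "ideal J rat_mpoly"
    and usable: "\<not> int p dvd den_gb \<sigma> J"
begin

abbreviation G :: "('n pp \<Rightarrow> rat) set" where
  "G \<equiv> reduced_gb rat_ring \<sigma> J"

lemma range_subset_zloc_of_den:
  assumes "\<not> int p dvd den f"
  shows "range f \<subseteq> zloc p"
proof
  fix x assume "x \<in> range f"
  then obtain t where t: "x = f t" by blast
  show "x \<in> zloc p"
  proof (cases "f t = 0")
    case False
    then have "snd (quotient_of (f t)) dvd den f"
      by (auto simp: den_def pp_support_def)
    then show ?thesis
      using assms t dvd_trans by (auto simp: zloc_def)
  qed (simp add: t)
qed

lemma reduced_gb_properties:
  shows gb_zloc: "g \<in> G \<Longrightarrow> range g \<subseteq> zloc p"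
    and gb_mem: "g \<in> G \<Longrightarrow> g \<in> J"
    and gb_lead: "g \<in> G \<Longrightarrow> g (lpp g) = 1" "g \<in> G \<Longrightarrow> g s \<noteq> 0 \<Longrightarrow> (s, lpp g) \<in> \<sigma>"
    and gb_divides: "t \<in> lead_pps J \<Longrightarrow> \<exists>g\<in>G. lpp g \<le> t"
proof -
  have red: "is_reduced_gb rat_ring \<sigma> J G"
    by (rule reduced_gb_is_reduced_gb[OF ideal_J])
  then have gb: "groebner_basis rat_ring \<sigma> J G"
    by (simp add: is_reduced_gb_def)
  show "range g \<subseteq> zloc p" if "g \<in> G"
  proof (rule range_subset_zloc_of_den)
    have "den g dvd den_gb \<sigma> J"
      using that by (simp add: den_gb_def)
    then show "\<not> int p dvd den g" using usable dvd_trans by blast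
  qed
  have GJ: "g \<in> J" "g \<noteq> (\<lambda>t. 0)" if "g \<in> G" for g
    using gb that by (auto simp: groebner_basis_def rat.mpoly_zero)
  show "g \<in> J" if "g \<in> G" using that by (rule GJ)
  show "g (lpp g) = 1" if "g \<in> G"
    using red that by (simp add: is_reduced_gb_def)
  show "(s, lpp g) \<in> \<sigma>" if "g \<in> G" "g s \<noteq> 0"
    using lead_pp_nonzero(2)[OF rat_ideal_finite[OF ideal_J GJ(1)] GJ(2)] that by blast
  show "\<exists>g\<in>G. lpp g \<le> t" if "t \<in> lead_pps J"
    using groebner_basis_divides_lead[OF gb that] by blast
qed

text \<open>
  The elements of the reduced Groebner basis are monic, and for a usable prime their coefficients lie in
  the localization. Division by them therefore stays in the localization.
\<close>

lemma ex_integral_normal_form: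
  assumes "(\<lambda>t. 0) \<in> D" "\<And>d e. d \<in> D \<Longrightarrow> e \<in> D \<Longrightarrow> d + e \<in> D"
    and "\<And>a d. a \<in> zloc p \<Longrightarrow> d \<in> D \<Longrightarrow> (\<lambda>t. a * d t) \<in> D"
    and shift: "\<And>g u. g \<in> G \<Longrightarrow> (\<lambda>t. if u \<le> t then g (t - u) else 0) \<in> D"
    and h: "h \<in> carrier rat_mpoly" "range h \<subseteq> zloc p"
  shows "\<exists>r. r \<in> carrier rat_mpoly \<and> range r \<subseteq> zloc p \<and> (\<forall>t\<in>lead_pps J. r t = 0) \<and> h - r \<in> D"
proof (rule ex_normal_form)
  fix t assume "t \<in> lead_pps J"
  then obtain g where g: "g \<in> G" "lpp g \<le> t" using gb_divides by blast
  define d where "d = (\<lambda>s. if t - lpp g \<le> s then g (s - (t - lpp g)) else 0)"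
  have "d \<in> D" unfolding d_def by (rule shift[OF g(1)])
  moreover have "d \<in> carrier rat_mpoly"
    unfolding d_def
    by (rule rat_ideal_finite[OF ideal_J rat_ideal_shift[OF ideal_J gb_mem[OF g(1)]]])
  moreover have "range d \<subseteq> zloc p"
    using gb_zloc[OF g(1)] by (auto simp: d_def)
  moreover have "d t = 1" "\<forall>s. d s \<noteq> 0 \<longrightarrow> (s, t) \<in> \<sigma>"
    using shift_lead[of g "lpp g" t, OF gb_lead(2)[OF g(1)] g(2)] gb_lead(1)[OF g(1)]
    unfolding d_def by auto
  ultimately show "\<exists>d\<in>D. d \<in> carrier rat_mpoly \<and> range d \<subseteq> zloc p \<and> d t = 1 \<and>
      (\<forall>s. d s \<noteq> 0 \<longrightarrow> (s, t) \<in> \<sigma>)"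
    by blast
qed (use assms in auto)

lemma nf_zloc:
  assumes h: "h \<in> carrier rat_mpoly" "range h \<subseteq> zloc p"
  shows "nf J h t \<in> zloc p"
proof -
  have "\<exists>r. r \<in> carrier rat_mpoly \<and> range r \<subseteq> zloc p \<and> (\<forall>t\<in>lead_pps J. r t = 0) \<and> h - r \<in> J"
    by (rule ex_integral_normal_form)
      (use h gb_mem rat_ideal_add[OF ideal_J] rat_ideal_scale[OF ideal_J] rat_ideal_zero[OF ideal_J]
        rat_ideal_shift[OF ideal_J] in auto)
  then show ?thesis
    using nf_eqI[OF ideal_J] by (metis rangeI subsetD)
qed

lemma \<pi>_gb_closed: "\<pi>_poly p ` G \<subseteq> carrier Fp_mpoly"
  using \<pi>_poly_mpoly_closed[OF rat_ideal_finite[OF ideal_J gb_mem] gb_zloc] by blast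

lemma ideal_p_reduction: "ideal (p_reduction p \<sigma> J) Fp_mpoly"
  unfolding p_reduction_def by (rule Fp.P.genideal_ideal[OF \<pi>_gb_closed])

text \<open>
  Reducing the generators of the ideal gives the same as reducing all its elements with coefficients in
  the localization. The right side is an ideal containing the generators, which gives one inclusion.
  For the other, divide an element of the right side by the Groebner basis: the remainder is 0, and the
  division expresses the element through the Groebner basis with coefficients in the localization.
\<close>

theorem p_reduction_eq:
  "p_reduction p \<sigma> J = \<pi>_poly p ` {h \<in> J. range h \<subseteq> zloc p}"
proof
  let ?T = "\<pi>_poly p ` {h \<in> J. range h \<subseteq> zloc p}"
  interpret Jp: ideal "p_reduction p \<sigma> J" Fp_mpoly
    by (rule ideal_p_reduction)
  have Tc: "x \<in> carrier Fp_mpoly" if "x \<in> ?T" for x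
    using that \<pi>_poly_mpoly_closed rat_ideal_finite[OF ideal_J] by blast
  have T_add: "x \<oplus>\<^bsub>Fp_mpoly\<^esub> y \<in> ?T" if xy: "x \<in> ?T" "y \<in> ?T" for x y
  proof -
    obtain g h where "g \<in> J" "range g \<subseteq> zloc p" "x = \<pi>_poly p g"
      and "h \<in> J" "range h \<subseteq> zloc p" "y = \<pi>_poly p h" using xy by blast
    then show ?thesis
      by (intro image_eqI[of _ _ "g + h"])
        (auto simp: \<pi>_poly_mpoly_add rat_ideal_add[OF ideal_J])
  qed
  have T_mult: "k \<otimes>\<^bsub>Fp_mpoly\<^esub> x \<in> ?T" if x: "x \<in> ?T" and k: "k \<in> carrier Fp_mpoly" for x k
  proof -
    interpret J: ideal J rat_mpoly by (rule ideal_J)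
    obtain g where g: "g \<in> J" "range g \<subseteq> zloc p" "x = \<pi>_poly p g" using x by blast
    obtain h where h: "h \<in> carrier rat_mpoly" "range h \<subseteq> zloc p" "\<pi>_poly p h = k"
      using k by (rule \<pi>_poly_mpoly_surj)
    show ?thesis
      by (rule image_eqI[of _ _ "h \<otimes>\<^bsub>rat_mpoly\<^esub> g"])
        (use g h(3) \<pi>_poly_mpoly_mult[OF h(2) g(2)] range_mpoly_mult[OF h(2) g(2)]
          J.I_l_closed[OF g(1) h(1)] in auto)
  qed
  have "ideal ?T Fp_mpoly"
  proof (rule idealI)
    show "subgroup ?T (add_monoid Fp_mpoly)"
    proof (rule Fp.P.add.subgroupI)
      show "?T \<subseteq> carrier Fp_mpoly" using Tc by blast
      show "?T \<noteq> {}"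
        using rat_ideal_zero[OF ideal_J] by (auto intro!: exI[of _ "\<lambda>t. 0"])
      show "\<ominus>\<^bsub>Fp_mpoly\<^esub> x \<in> ?T" if "x \<in> ?T" for x
        using T_mult[OF that, of "\<ominus>\<^bsub>Fp_mpoly\<^esub> \<one>\<^bsub>Fp_mpoly\<^esub>"] Tc[OF that]
        by (simp add: Fp.P.l_minus)
    qed (rule T_add)
    show "x \<otimes>\<^bsub>Fp_mpoly\<^esub> k \<in> ?T" if "x \<in> ?T" "k \<in> carrier Fp_mpoly" for x k
      using T_mult[OF that] Fp.P.m_comm[OF Tc[OF that(1)] that(2)] by simp
  qed (use T_mult Fp.P.ring_axioms in auto)
  moreover have "\<pi>_poly p ` G \<subseteq> ?T"
    using gb_mem gb_zloc by blast
  ultimately show "p_reduction p \<sigma> J \<subseteq> ?T"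
    unfolding p_reduction_def by (rule Fp.P.genideal_minimal)
  show "?T \<subseteq> p_reduction p \<sigma> J"
  proof
    fix x assume "x \<in> ?T"
    then obtain h where h: "h \<in> J" "range h \<subseteq> zloc p" "x = \<pi>_poly p h" by blast
    \<comment> \<open>Elements of J known to reduce into the reduced ideal; division by G moves h to 0 inside this set.\<close>
    define D where "D = {d \<in> J. range d \<subseteq> zloc p \<and> \<pi>_poly p d \<in> p_reduction p \<sigma> J}"
    have mult: "k \<otimes>\<^bsub>rat_mpoly\<^esub> d \<in> D"
      if "d \<in> D" "k \<in> carrier rat_mpoly" "range k \<subseteq> zloc p" for d k
    proof -
      interpret J: ideal J rat_mpoly by (rule ideal_J)
      show ?thesis
        using that J.I_l_closed[of d k] range_mpoly_mult[of k d] \<pi>_poly_mpoly_mult[of k d]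
          Jp.I_l_closed[of "\<pi>_poly p d" "\<pi>_poly p k"] \<pi>_poly_mpoly_closed[of k]
        by (simp add: D_def)
    qed
    have monom: "(\<lambda>t. if u \<le> t then a * d (t - u) else 0) \<in> D" if "d \<in> D" "a \<in> zloc p" for d a u
    proof -
      have "(\<lambda>t. if t = u then a else 0) \<otimes>\<^bsub>rat_mpoly\<^esub> d \<in> D"
      proof (rule mult[OF that(1)])
        show "(\<lambda>t. if t = u then a else 0) \<in> carrier rat_mpoly"
          by (simp add: rat_mpoly_carrier if_distrib[of "\<lambda>x. x \<noteq> 0"] cong: if_cong)
      qed (use that(2) in auto)
      moreover have "d \<in> carrier rat_mpoly"
        using that(1) rat_ideal_finite[OF ideal_J] by (simp add: D_def)
      ultimately show ?thesis
        using rat.mpoly_monom_mult[of a d u] by (simp cong: if_cong)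
    qed
    have "\<exists>r. r \<in> carrier rat_mpoly \<and> range r \<subseteq> zloc p \<and> (\<forall>t\<in>lead_pps J. r t = 0) \<and> h - r \<in> D"
    proof (rule ex_integral_normal_form[OF _ _ _ _ rat_ideal_finite[OF ideal_J h(1)] h(2)])
      have "\<pi>_poly p (\<lambda>t. 0) = \<zero>\<^bsub>Fp_mpoly\<^esub>"
        by (simp add: \<pi>_poly_def Fp.mpoly_zero)
      then have "\<pi>_poly p (\<lambda>t. 0) \<in> p_reduction p \<sigma> J"
        using Jp.zero_closed by metis
      then show "(\<lambda>t. 0) \<in> D"
        by (auto simp: D_def rat_ideal_zero[OF ideal_J])
      show "d + e \<in> D" if "d \<in> D" "e \<in> D" for d e
        using that \<pi>_poly_mpoly_add[of d e] rat_ideal_add[OF ideal_J, of d e]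
        by (auto simp: D_def image_subset_iff)
      show "(\<lambda>t. a * d t) \<in> D" if "a \<in> zloc p" "d \<in> D" for a d
        using monom[OF that(2,1), of 0] by (simp add: le_fun_def)
      show "(\<lambda>t. if u \<le> t then g (t - u) else 0) \<in> D" if "g \<in> G" for g u
      proof -
        have "g \<in> D"
          using that gb_mem gb_zloc Fp.P.genideal_self[OF \<pi>_gb_closed] by (auto simp: D_def p_reduction_def)
        from monom[OF this zloc_1, of u] show ?thesis by (simp cong: if_cong)
      qed
    qed
    then obtain r where r: "\<forall>t\<in>lead_pps J. r t = 0" "h - r \<in> D" by blast
    then have "h - r \<in> J" by (simp add: D_def)
    from rat_ideal_diff[OF ideal_J h(1) this] have "r \<in> J" by simp
    then have "r = (\<lambda>t. 0)"
      using reduced_zero[OF ideal_J _ r(1)] by blast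
    then have "h - r = h" by (simp add: fun_diff_def)
    then show "x \<in> p_reduction p \<sigma> J"
      using r(2) h(3) by (simp add: D_def)
  qed
qed

end

section \<open>Dual functionals and bounded denominators\<close>

text \<open>
  Linearly independent functions can be separated by functionals that look at finitely many points
  only. In the induction step, subtract from the new function \<open>v\<^sub>d\<close> its part in the span of the previous
  ones; evaluation at a point t where the rest w does not vanish, corrected by the previous functionals
  and divided by w(t), is dual to \<open>v\<^sub>d\<close>, and the previous functionals are corrected in turn.
\<close>

lemma ex_dual_functionals:
  fixes v :: "nat \<Rightarrow> 'x \<Rightarrow> rat"
  assumes "\<And>c. (\<And>x. (\<Sum>i<d. c i * v i x) = 0) \<Longrightarrow> \<forall>i<d. c i = 0"
  shows "\<exists>l S. finite S \<and> (\<forall>j x. x \<notin> S \<longrightarrow> l j x = 0) \<and>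
    (\<forall>i<d. \<forall>j<d. (\<Sum>x\<in>S. l j x * v i x) = (if i = j then 1 else 0))"
  using assms
proof (induction d)
  case 0
  show ?case by (intro exI[of _ "\<lambda>_ _. 0"] exI[of _ "{}"]) simp
next
  case (Suc d)
  have "\<forall>i<d. c i = 0" if c: "\<And>x. (\<Sum>i<d. c i * v i x) = 0" for c
  proof -
    have "(\<Sum>i<d. (c(d := 0)) i * v i x) = (\<Sum>i<d. c i * v i x)" for x
      by (rule sum.cong) auto
    then have "(\<Sum>i<Suc d. (c(d := 0)) i * v i x) = 0" for x
      using c by simp
    from Suc.prems[OF this] show ?thesis
      by (metis fun_upd_other less_SucI nat_neq_iff)
  qed
  from Suc.IH[OF this] obtain l S where S: "finite S" "\<And>j x. x \<notin> S \<Longrightarrow> l j x = 0"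
    and dual: "\<And>i j. i < d \<Longrightarrow> j < d \<Longrightarrow> (\<Sum>x\<in>S. l j x * v i x) = (if i = j then 1 else 0)"
    by blast
  define L where "L j w = (\<Sum>x\<in>S. l j x * w x)" for j and w :: "'x \<Rightarrow> rat"
  define w where "w x = v d x - (\<Sum>j<d. L j (v d) * v j x)" for x
  obtain t where t: "w t \<noteq> 0"
  proof (rule ccontr)
    assume no: "\<not> thesis"
    \<comment> \<open>If w vanished, its definition would be a nontrivial relation.\<close>
    let ?c = "\<lambda>i. if i = d then 1 else - L i (v d)"
    have "(\<Sum>i<Suc d. ?c i * v i x) = 0" for x
    proof -
      have "(\<Sum>i<Suc d. ?c i * v i x) = w x"
        by (simp add: w_def sum_negf)
      moreover have "w x = 0" using no that by blast
      ultimately show ?thesis by simp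
    qed
    from Suc.prems[OF this] show False by auto
  qed
  define m where "m x = ((if x = t then 1 else 0) - (\<Sum>j<d. v j t * l j x)) / w t" for x
  define l' where "l' j x = (if j < d then l j x - L j (v d) * m x else if j = d then m x else 0)" for j x
  let ?S = "insert t S"
  have L_ins: "(\<Sum>x\<in>?S. l j x * y x) = L j y" for j y
    using S by (cases "t \<in> S") (simp_all add: L_def insert_absorb)
  have M: "(\<Sum>x\<in>?S. m x * y x) = (y t - (\<Sum>j<d. v j t * L j y)) / w t" for y
  proof -
    have "(\<Sum>x\<in>?S. m x * y x)
        = (\<Sum>x\<in>?S. (if x = t then y x else 0) - (\<Sum>j<d. v j t * (l j x * y x))) / w t"
      unfolding sum_divide_distrib
      by (rule sum.cong) (auto simp: m_def algebra_simps sum_distrib_left sum_distrib_right)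
    also have "(\<Sum>x\<in>?S. (if x = t then y x else 0) - (\<Sum>j<d. v j t * (l j x * y x)))
        = y t - (\<Sum>x\<in>?S. \<Sum>j<d. v j t * (l j x * y x))"
      using S(1) by (simp add: sum_subtractf sum.delta)
    also have "(\<Sum>x\<in>?S. \<Sum>j<d. v j t * (l j x * y x)) = (\<Sum>j<d. v j t * L j y)"
      by (subst sum.swap) (simp only: sum_distrib_left[symmetric] L_ins)
    finally show ?thesis .
  qed
  have Mv: "(\<Sum>x\<in>?S. m x * v i x) = (if i = d then 1 else 0)" if "i < Suc d" for i
  proof (cases "i = d")
    case True
    have "v d t - (\<Sum>j<d. v j t * L j (v d)) = w t"
      by (simp add: w_def mult.commute)
    then show ?thesis using True t by (simp only: M) simp
  next
    case False
    then have "i < d" using that by simp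
    then have "(\<Sum>j<d. v j t * L j (v i)) = (\<Sum>j<d. if j = i then v j t else 0)"
      by (intro sum.cong) (auto simp: L_def dual)
    then show ?thesis using False \<open>i < d\<close> by (simp only: M) simp
  qed
  have L': "(\<Sum>x\<in>?S. l' j x * v i x) = (if i = j then 1 else 0)" if ij: "i < Suc d" "j < Suc d" for i j
  proof (cases "j = d")
    case True
    then show ?thesis using Mv[OF ij(1)] by (simp add: l'_def)
  next
    case False
    then have j: "j < d" using ij by simp
    have "(\<Sum>x\<in>?S. l' j x * v i x) = (\<Sum>x\<in>?S. l j x * v i x - L j (v d) * (m x * v i x))"
      using j by (intro sum.cong) (auto simp: l'_def algebra_simps)
    also have "\<dots> = L j (v i) - L j (v d) * (if i = d then 1 else 0)"
      unfolding sum_subtractf sum_distrib_left[symmetric] L_ins Mv[OF ij(1)] ..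
    also have "\<dots> = (if i = j then 1 else 0)"
      using ij j by (cases "i = d") (auto simp: L_def dual)
    finally show ?thesis .
  qed
  have "l' j x = 0" if "x \<notin> ?S" for j x
    using S(2)[of x] that by (simp add: l'_def m_def)
  then show ?case
    using L' S(1) by (intro exI[of _ l'] exI[of _ ?S]) auto
qed

context prime_reduction
begin

lemma zloc_scale: "x \<in> zloc p \<Longrightarrow> of_nat p ^ k * x \<in> zloc p"
  using zloc_mult[OF zloc_of_int[of "int p ^ k"], of x] by simp

lemma ex_power_denominator: "\<exists>e. of_nat p ^ e * x \<in> zloc p"
proof -
  obtain a b where ab: "x = of_int a / of_int b" "b > 0"
    by (metis quotient_of_denom_pos quotient_of_div surj_pair)
  define e where "e = multiplicity (int p) b"
  have "\<not> is_unit (int p)" using p_gt by (simp add: zdvd1_eq)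
  then obtain c where c: "b = int p ^ e * c" "\<not> int p dvd c"
    using ab multiplicity_decompose'[of b "int p"] unfolding e_def by auto
  then have "of_nat p ^ e * x * of_int c = of_int a"
    using ab by (auto simp: field_simps)
  then show ?thesis
    using c(2) by (intro exI[of _ e]) (rule zlocI)
qed

lemma ex_common_power_denominator:
  assumes "finite X"
  shows "\<exists>e. \<forall>x\<in>X. of_nat p ^ e * x \<in> zloc p"
  using assms
proof (induction X rule: finite_induct)
  case (insert x X)
  then obtain e where e: "\<forall>x\<in>X. of_nat p ^ e * x \<in> zloc p" by blast
  obtain k where k: "of_nat p ^ k * x \<in> zloc p" using ex_power_denominator by blast
  have "of_nat p ^ (e + k) * y \<in> zloc p" if "y \<in> insert x X" for y
    using that zloc_scale[OF k, of e] e zloc_scale[of "of_nat p ^ e * y" k]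
    by (auto simp: power_add mult_ac)
  then show ?case by blast
qed simp

text \<open>
  The localization has finitely many residue classes modulo \<open>p\<^sup>e\<close>. The induction extracts the lowest
  p-adic digit.
\<close>

lemma ex_finite_residues:
  "\<exists>F. finite F \<and> (\<forall>x\<in>zloc p. \<exists>a\<in>F. (x - a) / of_nat p ^ e \<in> zloc p)"
proof (induction e)
  case 0
  show ?case
    by (rule exI[of _ "{0}"]) simp
next
  case (Suc e)
  then obtain F where F: "finite F" "\<And>x. x \<in> zloc p \<Longrightarrow> \<exists>a\<in>F. (x - a) / of_nat p ^ e \<in> zloc p"
    by blast
  let ?F = "(\<lambda>(i, a). of_nat i + of_nat p * a) ` ({..<p} \<times> F)"
  have "\<exists>a\<in>?F. (x - a) / of_nat p ^ Suc e \<in> zloc p" if x: "x \<in> zloc p" for x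
  proof -
    define i where "i = nat (\<pi> p x)"
    have i: "i < p" "int i = \<pi> p x"
      using \<pi>_range[OF x x] by (auto simp: i_def)
    define y where "y = (x - of_int (int i)) / of_nat p"
    have "\<pi> p (x + of_int (- int i)) = 0"
      using i by (simp only: \<pi>_add[OF x zloc_of_int] \<pi>_of_int) (simp add: mod_add_right_eq)
    then have "y \<in> zloc p"
      using \<pi>_eq_0_iff[OF zloc_diff[OF x zloc_of_int[of "int i"]]] by (simp add: y_def)
    then obtain a where a: "a \<in> F" "(y - a) / of_nat p ^ e \<in> zloc p" using F(2) by blast
    have "(x - (of_nat i + of_nat p * a)) / of_nat p ^ Suc e = (y - a) / of_nat p ^ e"
      by (simp add: y_def field_simps)
    then show ?thesis using a i(1)
      by (intro bexI[of _ "of_nat i + of_nat p * a"]) auto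
  qed
  then show ?case using F(1) by (intro exI[of _ ?F]) simp
qed

text \<open>
  Vectors with a common denominator \<open>p\<^sup>e\<close> fall into finitely many classes modulo vectors over the
  localization, so among infinitely many of them two are congruent.
\<close>

lemma ex_integral_difference:
  fixes a :: "nat \<Rightarrow> nat \<Rightarrow> rat"
  assumes "\<And>k j. j < d \<Longrightarrow> of_nat p ^ e * a k j \<in> zloc p"
  shows "\<exists>k l. d \<le> l \<and> l < k \<and> (\<forall>j<d. a k j - a l j \<in> zloc p)"
proof -
  obtain F where F: "finite F" "\<And>x. x \<in> zloc p \<Longrightarrow> \<exists>a\<in>F. (x - a) / of_nat p ^ e \<in> zloc p"
    using ex_finite_residues[of e] by blast
  define r where "r x = (SOME b. b \<in> F \<and> (x - b) / of_nat p ^ e \<in> zloc p)" for x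
  have r: "r x \<in> F" "(x - r x) / of_nat p ^ e \<in> zloc p" if "x \<in> zloc p" for x
    using someI_ex[of "\<lambda>b. b \<in> F \<and> (x - b) / of_nat p ^ e \<in> zloc p"] F(2)[OF that]
    unfolding r_def by blast+
  define R where "R k = (\<lambda>j\<in>{..<d}. r (of_nat p ^ e * a k j))" for k
  have "R k \<in> {..<d} \<rightarrow>\<^sub>E F" for k
    using r(1) assms by (simp add: R_def restrict_PiE_iff)
  then have "R ` {d..} \<subseteq> {..<d} \<rightarrow>\<^sub>E F" by blast
  then have "finite (R ` {d..})"
    by (rule finite_subset) (simp add: F(1) finite_PiE)
  then obtain k where "infinite {l \<in> {d..}. R l = R k}"
    using pigeonhole_infinite[of "{d..}" R] infinite_Ici by blast
  then obtain l where l: "d \<le> l" "R l = R k"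
    using not_finite_existsD by force
  from \<open>infinite {l \<in> {d..}. R l = R k}\<close> obtain k' where k': "l < k'" "R k' = R k"
    using infinite_nat_iff_unbounded[of "{l \<in> {d..}. R l = R k}"] by blast
  have "a k' j - a l j \<in> zloc p" if j: "j < d" for j
  proof -
    have "r (of_nat p ^ e * a k' j) = r (of_nat p ^ e * a l j)"
      using k'(2) l(2) j by (metis R_def lessThan_iff restrict_apply')
    then have "(of_nat p ^ e * a k' j - of_nat p ^ e * a l j) / of_nat p ^ e \<in> zloc p"
      using zloc_diff[OF r(2)[OF assms[OF j]] r(2)[OF assms[OF j]], of k' l]
      by (simp add: diff_divide_distrib)
    then show ?thesis
      by (simp add: diff_divide_distrib)
  qed
  then show ?thesis using l k' by blast
qed

text \<open>
  The least power of p that clears the denominators. If the exponent is 0, the coefficient 1 survives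
  reduction; otherwise some coefficient does, as one factor p less would not have been enough.
\<close>

lemma ex_primitive_multiple:
  fixes a :: "nat \<Rightarrow> rat"
  assumes a: "a \<in> carrier (UP rat_ring)" and one: "a n = 1"
  shows "\<exists>k i. range (\<lambda>i. of_nat p ^ k * a i) \<subseteq> zloc p \<and> \<pi> p (of_nat p ^ k * a i) \<noteq> 0"
proof -
  obtain b where b: "\<forall>i>b. a i = 0" using a by (auto simp: UP_rat_iff)
  have "a i \<in> insert 0 (a ` {..b})" for i
    using b by (cases "i \<le> b") auto
  then have "range a \<subseteq> insert 0 (a ` {..b})" by blast
  then have "finite (range a)" by (rule finite_subset) simp
  then have ex: "\<exists>k. \<forall>i. of_nat p ^ k * a i \<in> zloc p"
    using ex_common_power_denominator[of "range a"] by auto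
  define k where "k = (LEAST k. \<forall>i. of_nat p ^ k * a i \<in> zloc p)"
  have k: "\<forall>i. of_nat p ^ k * a i \<in> zloc p"
    unfolding k_def using ex by (rule LeastI_ex)
  have "\<exists>i. \<pi> p (of_nat p ^ k * a i) \<noteq> 0"
  proof (cases k)
    case 0
    then show ?thesis using one by (intro exI[of _ n]) simp
  next
    case (Suc k')
    then have "k' < (LEAST k. \<forall>i. of_nat p ^ k * a i \<in> zloc p)"
      unfolding k_def[symmetric] by simp
    then have "\<not> (\<forall>i. of_nat p ^ k' * a i \<in> zloc p)"
      by (rule not_less_Least)
    then obtain i where i: "of_nat p ^ k' * a i \<notin> zloc p" by blast
    moreover have "of_nat p ^ k * a i / of_nat p = of_nat p ^ k' * a i"
      using Suc prime_p by (auto simp: prime_gt_0_nat)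
    ultimately show ?thesis
      using \<pi>_eq_0_iff[of "of_nat p ^ k * a i"] k by (intro exI[of _ i]) simp
  qed
  then show ?thesis using k by blast
qed

text \<open>
  Gauss's lemma. Clear the denominators of both factors by the least possible powers of p. The reduced
  factors are nonzero, hence so is their product, as \<open>F\<^sub>p[z]\<close> is a domain. But the product has been
  multiplied by these powers of p, and would be 0 after reduction if one of them were not 1.
\<close>

theorem gauss_integral_factor:
  assumes a: "a \<in> carrier (UP rat_ring)" "a m = 1"
    and b: "b \<in> carrier (UP rat_ring)" "b n = 1"
    and ab: "range (a \<otimes>\<^bsub>UP rat_ring\<^esub> b) \<subseteq> zloc p"
  shows "range a \<subseteq> zloc p"
proof -
  interpret UF: UP_domain Fp "UP Fp"
    by (rule UP_domain.intro) (rule field.axioms(1)[OF mpoly_field.axioms[OF mpoly_field_Fp]], simp)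
  obtain k i where k: "range (\<lambda>i. of_nat p ^ k * a i) \<subseteq> zloc p" "\<pi> p (of_nat p ^ k * a i) \<noteq> 0"
    using ex_primitive_multiple[OF a] by blast
  obtain l j where l: "range (\<lambda>i. of_nat p ^ l * b i) \<subseteq> zloc p" "\<pi> p (of_nat p ^ l * b j) \<noteq> 0"
    using ex_primitive_multiple[OF b] by blast
  define a' where "a' i = of_nat p ^ k * a i" for i
  define b' where "b' i = of_nat p ^ l * b i" for i
  have a': "a' \<in> carrier (UP rat_ring)" "range a' \<subseteq> zloc p"
    and b': "b' \<in> carrier (UP rat_ring)" "range b' \<subseteq> zloc p"
    using a(1) b(1) k(1) l(1) by (auto simp: UP_rat_iff a'_def b'_def)
  have zero: "\<zero>\<^bsub>UP Fp\<^esub> = (\<lambda>i. 0)" by (simp add: UP_def)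
  have "\<pi>_poly p a' i \<noteq> 0" "\<pi>_poly p b' j \<noteq> 0"
    using k(2) l(2) by (simp_all add: \<pi>_poly_def a'_def b'_def)
  then have "\<pi>_poly p a' \<noteq> \<zero>\<^bsub>UP Fp\<^esub>" "\<pi>_poly p b' \<noteq> \<zero>\<^bsub>UP Fp\<^esub>"
    by (auto simp: zero)
  then have "\<pi>_poly p (a' \<otimes>\<^bsub>UP rat_ring\<^esub> b') \<noteq> \<zero>\<^bsub>UP Fp\<^esub>"
    using UF.UP_integral[of "\<pi>_poly p a'" "\<pi>_poly p b'"] \<pi>_poly_UP_closed a' b'
    by (auto simp: \<pi>_poly_UP_mult)
  then obtain h where h: "\<pi> p ((a' \<otimes>\<^bsub>UP rat_ring\<^esub> b') h) \<noteq> 0"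
    by (auto simp: zero \<pi>_poly_def fun_eq_iff)
  have "(a' \<otimes>\<^bsub>UP rat_ring\<^esub> b') h = of_nat p ^ (k + l) * (a \<otimes>\<^bsub>UP rat_ring\<^esub> b) h"
    by (simp add: UP_rat_mult_coeff a' b' a b a'_def b'_def power_add sum_distrib_left mult_ac)
  then have h': "\<pi> p (of_nat p ^ (k + l) * (a \<otimes>\<^bsub>UP rat_ring\<^esub> b) h) \<noteq> 0"
    using h by simp
  have "k = 0"
  proof (cases k)
    case (Suc k')
    have "(a \<otimes>\<^bsub>UP rat_ring\<^esub> b) h \<in> zloc p" using ab by blast
    then have z: "of_nat p ^ e * (a \<otimes>\<^bsub>UP rat_ring\<^esub> b) h \<in> zloc p" for e
      by (rule zloc_scale)
    have "of_nat p ^ (k + l) * (a \<otimes>\<^bsub>UP rat_ring\<^esub> b) h / of_nat p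
        = of_nat p ^ (k' + l) * (a \<otimes>\<^bsub>UP rat_ring\<^esub> b) h"
      using Suc prime_p by (auto simp: prime_gt_0_nat)
    then have "\<pi> p (of_nat p ^ (k + l) * (a \<otimes>\<^bsub>UP rat_ring\<^esub> b) h) = 0"
      using \<pi>_eq_0_iff[OF z, of "k + l"] z[of "k' + l"] by simp
    then show ?thesis using h' by blast
  qed
  then show ?thesis using k(1) by simp
qed

end

section \<open>Coordinates with respect to the powers of an element\<close>

locale algebraic_element = term_order \<sigma> for \<sigma> :: "'n::finite pp rel" +
  fixes J :: "('n pp \<Rightarrow> rat) set" and f :: "'n pp \<Rightarrow> rat"
  assumes zd: "zero_dimensional rat_ring J" and f: "f \<in> carrier rat_mpoly"
begin

lemma ideal_J: "ideal J rat_mpoly"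
  using zd by (simp add: zero_dimensional_def)

definition \<mu> :: "nat \<Rightarrow> rat" where
  "\<mu> = min_poly rat_ring f J"

definition d :: nat where
  "d = deg rat_ring \<mu>"

lemma \<mu>_closed: "\<mu> \<in> carrier (UP rat_ring)"
  and \<mu>_monic: "\<mu> d = 1"
  and \<mu>_divides_iff: "q \<in> carrier (UP rat_ring) \<Longrightarrow>
    poly_at rat_ring f q \<in> J \<longleftrightarrow> \<mu> divides\<^bsub>UP rat_ring\<^esub> q"
proof -
  obtain q0 where q0: "q0 \<in> carrier (UP rat_ring)" "q0 \<noteq> \<zero>\<^bsub>UP rat_ring\<^esub>" "poly_at rat_ring f q0 \<in> J"
    using mpoly_field.zero_dimensional_imp_algebraic[OF mpoly_field_rat_ring zd f] by blast
  note * = mpoly_field.min_poly_characterization[OF mpoly_field_rat_ring ideal_J f q0, folded \<mu>_def d_def]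
  show "\<mu> \<in> carrier (UP rat_ring)" "\<mu> d = 1"
    "q \<in> carrier (UP rat_ring) \<Longrightarrow> poly_at rat_ring f q \<in> J \<longleftrightarrow> \<mu> divides\<^bsub>UP rat_ring\<^esub> q"
    using * by simp_all
qed

lemma poly_at_eq_sum:
  assumes "\<And>i. i \<ge> n \<Longrightarrow> q i = 0"
  shows "poly_at rat_ring f q = (\<lambda>t. \<Sum>i<n. q i * (f [^]\<^bsub>rat_mpoly\<^esub> i) t)"
proof
  interpret UPQ: UP_ring rat_ring "UP rat_ring" by unfold_locales simp
  fix t
  have q: "q \<in> carrier (UP rat_ring)"
    using assms by (auto simp: UP_rat_iff intro!: exI[of _ n])
  have "deg rat_ring q \<le> n"
    by (rule UPQ.deg_aboveI[OF _ q], unfold coeff_UP[OF q]) (simp add: assms)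
  from rat.poly_at_coeff[OF f q this, of t]
  have "poly_at rat_ring f q t = (\<Sum>i\<le>n. q i * (f [^]\<^bsub>rat_mpoly\<^esub> i) t)" by simp
  also have "\<dots> = (\<Sum>i<n. q i * (f [^]\<^bsub>rat_mpoly\<^esub> i) t)"
    by (simp add: lessThan_Suc_atMost[symmetric] assms)
  finally show "poly_at rat_ring f q t = (\<Sum>i<n. q i * (f [^]\<^bsub>rat_mpoly\<^esub> i) t)" .
qed

lemma UP_domain_rat: "UP_domain rat_ring"
  by (rule UP_domain.intro) (rule field.axioms(1)[OF field_rat_ring])

lemma degree_le_of_divides:
  assumes "q \<in> carrier (UP rat_ring)" "\<mu> divides\<^bsub>UP rat_ring\<^esub> q" "q \<noteq> (\<lambda>i. 0)"
  shows "\<exists>i\<ge>d. q i \<noteq> 0"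
proof -
  interpret UQ: UP_domain rat_ring "UP rat_ring" by (rule UP_domain_rat) simp
  have zero: "\<zero>\<^bsub>UP rat_ring\<^esub> = (\<lambda>i. 0)" by (simp add: UP_def)
  obtain x where x: "x \<in> carrier (UP rat_ring)" "q = \<mu> \<otimes>\<^bsub>UP rat_ring\<^esub> x"
    using assms(2) by (auto simp: factor_def)
  have q0: "q \<noteq> \<zero>\<^bsub>UP rat_ring\<^esub>" using assms(3) zero by simp
  then have "x \<noteq> \<zero>\<^bsub>UP rat_ring\<^esub>" "\<mu> \<noteq> \<zero>\<^bsub>UP rat_ring\<^esub>"
    using x \<mu>_closed by auto
  then have "deg rat_ring q \<ge> d"
    unfolding x(2) d_def using UQ.deg_mult x(1) \<mu>_closed by simp
  moreover have "q (deg rat_ring q) \<noteq> 0"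
    using UQ.lcoeff_nonzero[OF q0 assms(1)] coeff_UP[OF assms(1)] by simp
  ultimately show ?thesis by blast
qed

text \<open>
  A relation between the first d powers is a polynomial of degree less than d that kills f.
\<close>

lemma powers_independent:
  assumes "(\<lambda>t. \<Sum>i<d. c i * (f [^]\<^bsub>rat_mpoly\<^esub> i) t) \<in> J"
  shows "\<forall>i<d. c i = 0"
proof -
  define q where "q i = (if i < d then c i else 0)" for i
  have q: "q \<in> carrier (UP rat_ring)"
    by (auto simp: UP_rat_iff q_def intro!: exI[of _ d])
  have "poly_at rat_ring f q = (\<lambda>t. \<Sum>i<d. c i * (f [^]\<^bsub>rat_mpoly\<^esub> i) t)"
    by (subst poly_at_eq_sum[of d]) (auto simp: q_def)
  then have "\<mu> divides\<^bsub>UP rat_ring\<^esub> q"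
    using assms \<mu>_divides_iff[OF q] by simp
  moreover have "\<not> (\<exists>i\<ge>d. q i \<noteq> 0)" by (simp add: q_def)
  ultimately have "q = (\<lambda>i. 0)"
    using degree_le_of_divides[OF q] by blast
  then have "q i = 0" for i by simp
  then show ?thesis unfolding q_def by metis
qed

text \<open>
  Divide \<open>z\<^sup>k\<close> by the minimal polynomial.
\<close>

lemma power_reduction:
  obtains a where "(\<lambda>t. (f [^]\<^bsub>rat_mpoly\<^esub> (k::nat)) t - (\<Sum>j<d. a j * (f [^]\<^bsub>rat_mpoly\<^esub> j) t)) \<in> J"
proof -
  interpret UQ: UP_domain rat_ring "UP rat_ring" by (rule UP_domain_rat) simp
  have zero: "\<zero>\<^bsub>UP rat_ring\<^esub> = (\<lambda>i. 0)" by (simp add: UP_def)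
  define m :: "nat \<Rightarrow> rat" where "m i = (if i = k then 1 else 0)" for i
  have m: "m \<in> carrier (UP rat_ring)"
    by (auto simp: UP_rat_iff m_def intro!: exI[of _ k])
  have \<mu>0: "\<mu> \<noteq> \<zero>\<^bsub>UP rat_ring\<^esub>"
    using \<mu>_monic by (auto simp: zero)
  obtain s r n where sr: "s \<in> carrier (UP rat_ring)" "r \<in> carrier (UP rat_ring)"
    "coeff (UP rat_ring) \<mu> (deg rat_ring \<mu>) [^]\<^bsub>rat_ring\<^esub> (n::nat) \<odot>\<^bsub>UP rat_ring\<^esub> m
      = \<mu> \<otimes>\<^bsub>UP rat_ring\<^esub> s \<oplus>\<^bsub>UP rat_ring\<^esub> r"
    "r = \<zero>\<^bsub>UP rat_ring\<^esub> \<or> deg rat_ring r < deg rat_ring \<mu>"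
    using UQ.long_div_theorem[OF \<mu>_closed m \<mu>0] by blast
  have "coeff (UP rat_ring) \<mu> (deg rat_ring \<mu>) = \<one>\<^bsub>rat_ring\<^esub>"
    using \<mu>_monic coeff_UP[OF \<mu>_closed] by (simp add: d_def)
  then have e: "m = \<mu> \<otimes>\<^bsub>UP rat_ring\<^esub> s \<oplus>\<^bsub>UP rat_ring\<^esub> r"
    using sr(3) UQ.UP_smult_one[OF m] rat.R.nat_pow_one[of n] by metis
  have r0: "r i = 0" if "i \<ge> d" for i
    using sr(4)
  proof
    assume "deg rat_ring r < deg rat_ring \<mu>"
    then show ?thesis
      using UQ.deg_aboveD[OF _ sr(2), of i] that coeff_UP[OF sr(2)] by (simp add: d_def)
  qed (simp add: zero)
  have \<mu>s: "\<mu> \<otimes>\<^bsub>UP rat_ring\<^esub> s \<in> carrier (UP rat_ring)"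
    using \<mu>_closed sr(1) by simp
  have "poly_at rat_ring f m = poly_at rat_ring f (\<mu> \<otimes>\<^bsub>UP rat_ring\<^esub> s) + poly_at rat_ring f r"
    using ring_hom_add[OF rat.poly_at_hom[OF f] \<mu>s sr(2)] by (simp add: e rat_mpoly_add)
  then have "poly_at rat_ring f m - poly_at rat_ring f r = poly_at rat_ring f (\<mu> \<otimes>\<^bsub>UP rat_ring\<^esub> s)"
    by simp
  also have "\<dots> \<in> J"
    using \<mu>_divides_iff[OF \<mu>s] sr(1) by (auto simp: factor_def)
  finally have mr: "poly_at rat_ring f m - poly_at rat_ring f r \<in> J" .
  have "poly_at rat_ring f m = (\<lambda>t. \<Sum>i<Suc k. m i * (f [^]\<^bsub>rat_mpoly\<^esub> i) t)"
    by (rule poly_at_eq_sum) (simp add: m_def)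
  then have "poly_at rat_ring f m = f [^]\<^bsub>rat_mpoly\<^esub> k"
    by (simp add: m_def)
  with mr show thesis
    using that[of r] poly_at_eq_sum[of d r, OF r0] by (simp add: fun_diff_def)
qed

lemma nf_sum:
  fixes n :: nat
  assumes "\<And>i. v i \<in> carrier rat_mpoly"
  shows "nf J (\<lambda>t. \<Sum>i<n. c i * v i t) = (\<lambda>t. \<Sum>i<n. c i * nf J (v i) t)"
    and "(\<lambda>t. \<Sum>i<n. c i * v i t) \<in> carrier rat_mpoly"
proof -
  have "nf J (\<lambda>t. \<Sum>i<n. c i * v i t) = (\<lambda>t. \<Sum>i<n. c i * nf J (v i) t) \<and>
    (\<lambda>t. \<Sum>i<n. c i * v i t) \<in> carrier rat_mpoly"
  proof (induction n)
    case 0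
    show ?case
      using nf_of_mem[OF ideal_J rat_ideal_zero[OF ideal_J]] rat_mpoly_closed(4) by simp
  next
    case (Suc n)
    let ?s = "\<lambda>t. \<Sum>i<n. c i * v i t" and ?c = "\<lambda>t. c n * v n t"
    have split: "(\<lambda>t. \<Sum>i<Suc n. c i * v i t) = ?s + ?c"
      by (simp add: fun_eq_iff)
    have c: "?c \<in> carrier rat_mpoly" using assms by (rule rat_mpoly_closed)
    show ?case
      unfolding split using Suc c nf_add[OF ideal_J _ c, of ?s] nf_scale[OF ideal_J assms, of "c n" n]
      by (auto simp: fun_eq_iff)
  qed
  then show "nf J (\<lambda>t. \<Sum>i<n. c i * v i t) = (\<lambda>t. \<Sum>i<n. c i * nf J (v i) t)"
    "(\<lambda>t. \<Sum>i<n. c i * v i t) \<in> carrier rat_mpoly" by blast+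
qed

text \<open>
  Modulo J every power of f is a unique combination of the powers with exponent less than d. The
  functional \<open>l\<^sub>j\<close>, applied to normal forms, reads off the coefficient of \<open>f\<^sup>j\<close>. What matters is that it is a
  single finite matrix of rational numbers, fixed before any prime is chosen: it bounds the denominators
  of the coordinates of all integral polynomials at once.
\<close>

definition is_coordinate_matrix :: "(nat \<Rightarrow> 'n pp \<Rightarrow> rat) \<Rightarrow> 'n pp set \<Rightarrow> bool" where
  "is_coordinate_matrix l S \<longleftrightarrow> finite S \<and>
    (\<forall>i<d. \<forall>j<d. (\<Sum>x\<in>S. l j x * nf J (f [^]\<^bsub>rat_mpoly\<^esub> i) x) = (if i = j then 1 else 0))"

lemma ex_coordinate_matrix: "\<exists>l S. is_coordinate_matrix l S"
proof -
  have "\<forall>i<d. c i = 0" if c: "\<And>x. (\<Sum>i<d. c i * nf J (f [^]\<^bsub>rat_mpoly\<^esub> i) x) = 0" for c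
  proof -
    let ?h = "\<lambda>t. \<Sum>i<d. c i * (f [^]\<^bsub>rat_mpoly\<^esub> i) t"
    have pc: "f [^]\<^bsub>rat_mpoly\<^esub> i \<in> carrier rat_mpoly" for i :: nat
      using f by simp
    have "nf J ?h = (\<lambda>t. 0)"
      using nf_sum(1)[of "\<lambda>i. f [^]\<^bsub>rat_mpoly\<^esub> i" c d, OF pc] c by simp
    then have "?h \<in> J"
      using nf_cong[OF ideal_J nf_sum(2)[of "\<lambda>i. f [^]\<^bsub>rat_mpoly\<^esub> i" c d, OF pc]]
      by (simp add: fun_diff_def)
    then show ?thesis by (rule powers_independent)
  qed
  from ex_dual_functionals[where d = d and v = "\<lambda>i. nf J (f [^]\<^bsub>rat_mpoly\<^esub> i)", OF this]
  show ?thesis unfolding is_coordinate_matrix_def by blast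
qed

definition coord :: "(nat \<Rightarrow> 'n pp \<Rightarrow> rat) \<Rightarrow> 'n pp set \<Rightarrow> ('n pp \<Rightarrow> rat) \<Rightarrow> nat \<Rightarrow> rat" where
  "coord l S h j = (\<Sum>x\<in>S. l j x * nf J h x)"

lemma coord_of_cong:
  assumes lS: "is_coordinate_matrix l S" and j: "j < d"
    and h: "h \<in> carrier rat_mpoly" "(\<lambda>t. h t - (\<Sum>i<d. a i * (f [^]\<^bsub>rat_mpoly\<^esub> i) t)) \<in> J"
  shows "coord l S h j = a j"
proof -
  have pc: "f [^]\<^bsub>rat_mpoly\<^esub> i \<in> carrier rat_mpoly" for i :: nat
    using f by simp
  let ?s = "\<lambda>t. \<Sum>i<d. a i * (f [^]\<^bsub>rat_mpoly\<^esub> i) t"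
  note s = nf_sum[of "\<lambda>i. f [^]\<^bsub>rat_mpoly\<^esub> i" a d, OF pc]
  have "h = ?s + (h - ?s)" by simp
  moreover have "h - ?s \<in> J" using h(2) by (simp add: fun_diff_def)
  ultimately have "nf J h = nf J ?s + (\<lambda>t. 0)"
    using nf_add[OF ideal_J s(2), of "h - ?s"] nf_of_mem[OF ideal_J, of "h - ?s"]
      rat_ideal_finite[OF ideal_J, of "h - ?s"] by metis
  then have "nf J h x = (\<Sum>i<d. a i * nf J (f [^]\<^bsub>rat_mpoly\<^esub> i) x)" for x
    using s(1) by simp
  then have "coord l S h j = (\<Sum>x\<in>S. \<Sum>i<d. a i * (l j x * nf J (f [^]\<^bsub>rat_mpoly\<^esub> i) x))"
    by (simp add: coord_def sum_distrib_left mult_ac)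
  also have "\<dots> = (\<Sum>i<d. a i * (\<Sum>x\<in>S. l j x * nf J (f [^]\<^bsub>rat_mpoly\<^esub> i) x))"
    by (subst sum.swap) (simp add: sum_distrib_left)
  also have "\<dots> = (\<Sum>i<d. if i = j then a i else 0)"
    using lS j by (intro sum.cong) (auto simp: is_coordinate_matrix_def)
  also have "\<dots> = a j" using j by simp
  finally show ?thesis .
qed

end

section \<open>Minimal polynomials under reduction\<close>

locale usable_algebraic = usable_reduction p \<sigma> J + algebraic_element \<sigma> J f
  for p :: nat and \<sigma> :: "'n::finite pp rel" and J :: "('n pp \<Rightarrow> rat) set" and f :: "'n pp \<Rightarrow> rat" +
  assumes f_zloc: "range f \<subseteq> zloc p"
begin

lemma pow_closed: "f [^]\<^bsub>rat_mpoly\<^esub> (i::nat) \<in> carrier rat_mpoly"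
  using f by simp

text \<open>
  By the coordinate matrix, the coordinates of all powers of f have a common denominator \<open>p\<^sup>e\<close>. Hence
  two powers \<open>f\<^sup>k\<close> and \<open>f\<^sup>m\<close>, with \<open>d \<le> m < k\<close>, have the same coordinates modulo the localization, and their
  difference is a combination of the powers below d over the localization. This is a monic equation for
  f over the localization. The minimal polynomial divides it, and Gauss's lemma applies.
\<close>

theorem \<mu>_zloc: "range \<mu> \<subseteq> zloc p"
proof -
  obtain l S where lS: "is_coordinate_matrix l S" using ex_coordinate_matrix by blast
  then have "finite ((\<lambda>(j, x). l j x) ` ({..<d} \<times> S))"
    by (simp add: is_coordinate_matrix_def)
  then obtain e where e: "\<And>j x. j < d \<Longrightarrow> x \<in> S \<Longrightarrow> of_nat p ^ e * l j x \<in> zloc p"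
    using ex_common_power_denominator by fastforce
  have "of_nat p ^ e * coord l S (f [^]\<^bsub>rat_mpoly\<^esub> k) j \<in> zloc p" if "j < d" for k :: nat and j
  proof -
    have "(of_nat p ^ e * l j x) * nf J (f [^]\<^bsub>rat_mpoly\<^esub> k) x \<in> zloc p" if "x \<in> S" for x
      using e[OF \<open>j < d\<close> that] nf_zloc[OF pow_closed \<pi>_poly_mpoly_pow(1)[OF f f_zloc]]
      by (rule zloc_mult)
    then show ?thesis
      by (auto simp: coord_def sum_distrib_left mult.assoc)
  qed
  then obtain k m where km: "d \<le> m" "m < k"
    "\<And>j. j < d \<Longrightarrow> coord l S (f [^]\<^bsub>rat_mpoly\<^esub> k) j - coord l S (f [^]\<^bsub>rat_mpoly\<^esub> m) j \<in> zloc p"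
    using ex_integral_difference[of d e "\<lambda>k. coord l S (f [^]\<^bsub>rat_mpoly\<^esub> k)"] by blast
  \<comment> \<open>The monic equation \<open>z\<^sup>k - z\<^sup>m - \<Sum>c\<^sub>j z\<^sup>j\<close>. As \<open>d \<le> m < k\<close>, the three parts do not overlap.\<close>
  define c where "c j = coord l S (f [^]\<^bsub>rat_mpoly\<^esub> k) j - coord l S (f [^]\<^bsub>rat_mpoly\<^esub> m) j" for j
  define \<chi> where "\<chi> i = (if i = k then 1 else if i = m then - 1 else if i < d then - c i else 0)" for i
  have \<chi>: "\<chi> \<in> carrier (UP rat_ring)"
    using km by (auto simp: UP_rat_iff \<chi>_def intro!: exI[of _ k])
  have \<chi>_zloc: "\<chi> i \<in> zloc p" for i
    using km(3) zloc_of_int[of "- 1"] zloc_diff[OF zloc_0, of "c i"] by (auto simp: \<chi>_def c_def)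
  have red: "(\<lambda>t. (f [^]\<^bsub>rat_mpoly\<^esub> n) t
      - (\<Sum>j<d. coord l S (f [^]\<^bsub>rat_mpoly\<^esub> n) j * (f [^]\<^bsub>rat_mpoly\<^esub> j) t)) \<in> J" for n :: nat
  proof -
    obtain a where a: "(\<lambda>t. (f [^]\<^bsub>rat_mpoly\<^esub> n) t - (\<Sum>j<d. a j * (f [^]\<^bsub>rat_mpoly\<^esub> j) t)) \<in> J"
      by (rule power_reduction)
    then show ?thesis
      using coord_of_cong[OF lS _ pow_closed a] by simp
  qed
  have "poly_at rat_ring f \<chi> = (\<lambda>t. \<Sum>i<Suc k. \<chi> i * (f [^]\<^bsub>rat_mpoly\<^esub> i) t)"
    by (rule poly_at_eq_sum) (use km in \<open>auto simp: \<chi>_def\<close>)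
  also have "\<dots> = (\<lambda>t. (f [^]\<^bsub>rat_mpoly\<^esub> k) t - (f [^]\<^bsub>rat_mpoly\<^esub> m) t
      - (\<Sum>j<d. c j * (f [^]\<^bsub>rat_mpoly\<^esub> j) t))"
  proof
    fix t
    let ?F = "\<lambda>i. (f [^]\<^bsub>rat_mpoly\<^esub> i) t"
    have "\<chi> i * ?F i = (if i = k then ?F i else 0) - (if i = m then ?F i else 0)
        - (if i \<in> {..<d} then c i * ?F i else 0)" for i
      using km by (auto simp: \<chi>_def)
    then have "(\<Sum>i<Suc k. \<chi> i * ?F i) = (\<Sum>i<Suc k. if i = k then ?F i else 0)
        - (\<Sum>i<Suc k. if i = m then ?F i else 0) - (\<Sum>i<Suc k. if i \<in> {..<d} then c i * ?F i else 0)"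
      by (simp only: sum_subtractf)
    also have "(\<Sum>i<Suc k. if i \<in> {..<d} then c i * ?F i else 0) = (\<Sum>i\<in>{..<Suc k} \<inter> {..<d}. c i * ?F i)"
      by (rule sum.inter_restrict[symmetric]) simp
    also have "{..<Suc k} \<inter> {..<d} = {..<d}" using km by auto
    finally show "(\<Sum>i<Suc k. \<chi> i * ?F i) = ?F k - ?F m - (\<Sum>j<d. c j * ?F j)"
      using km by (simp add: sum.delta del: sum.lessThan_Suc)
  qed
  also have "\<dots> \<in> J"
    using rat_ideal_diff[OF ideal_J red[of k] red[of m]]
    by (simp add: fun_diff_def c_def algebra_simps sum_subtractf)
  finally have "\<mu> divides\<^bsub>UP rat_ring\<^esub> \<chi>"
    using \<mu>_divides_iff[OF \<chi>] by simp
  then obtain b where b: "b \<in> carrier (UP rat_ring)" "\<chi> = \<mu> \<otimes>\<^bsub>UP rat_ring\<^esub> b"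
    by (auto simp: factor_def)
  \<comment> \<open>Gauss's lemma needs a coefficient 1 in the cofactor too: its leading one, as \<open>\<chi>\<close> and \<open>\<mu>\<close> are monic.\<close>
  interpret UQ: UP_domain rat_ring "UP rat_ring" by (rule UP_domain_rat) simp
  define n where "n = deg rat_ring b"
  have above: "\<mu> i = 0" if "i > d" for i
    using UQ.deg_aboveD[OF _ \<mu>_closed, of i] that coeff_UP[OF \<mu>_closed] by (simp add: d_def)
  have above_b: "b i = 0" if "i > n" for i
    using UQ.deg_aboveD[OF _ b(1), of i] that coeff_UP[OF b(1)] by (simp add: n_def)
  have "\<chi> (d + n) = (\<Sum>i\<le>d + n. \<mu> i * b (d + n - i))"
    using b \<mu>_closed by (simp add: UP_rat_mult_coeff)
  also have "\<dots> = (\<Sum>i\<le>d + n. if i = d then b n else 0)"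
  proof (rule sum.cong)
    fix i assume "i \<in> {..d + n}"
    show "\<mu> i * b (d + n - i) = (if i = d then b n else 0)"
      using above[of i] above_b[of "d + n - i"] \<mu>_monic by (cases i d rule: linorder_cases) auto
  qed simp
  finally have top: "\<chi> (d + n) = b n" by simp
  have zero: "\<zero>\<^bsub>UP rat_ring\<^esub> = (\<lambda>i. 0)" by (simp add: UP_def)
  have \<chi>k: "\<chi> k = 1" by (simp add: \<chi>_def)
  have "k \<le> d + n"
  proof (rule ccontr)
    assume "\<not> k \<le> d + n"
    then have "\<mu> i * b (k - i) = 0" for i
      using above[of i] above_b[of "k - i"] by (cases "i > d") auto
    then have "(\<Sum>i\<le>k. \<mu> i * b (k - i)) = 0"
      by (rule sum.neutral[rule_format])
    then have "\<chi> k = 0"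
      using b \<mu>_closed by (simp only: UP_rat_mult_coeff)
    then show False using \<chi>k by simp
  qed
  moreover have "d + n \<le> k"
  proof -
    have "b \<noteq> \<zero>\<^bsub>UP rat_ring\<^esub>"
      using \<chi>k b(2) UP_rat_mult_coeff[OF \<mu>_closed b(1), of k] by (auto simp: zero)
    then have "b n \<noteq> 0"
      using UQ.lcoeff_nonzero[OF _ b(1)] coeff_UP[OF b(1)] by (simp add: n_def)
    then show ?thesis
      using top km by (auto simp: \<chi>_def split: if_splits)
  qed
  ultimately have "b n = 1" using top \<chi>k by simp
  moreover have "range (\<mu> \<otimes>\<^bsub>UP rat_ring\<^esub> b) \<subseteq> zloc p"
    using b(2) \<chi>_zloc by auto
  ultimately show ?thesis
    using gauss_integral_factor[OF \<mu>_closed \<mu>_monic b(1)] by blast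
qed

abbreviation \<mu>\<^sub>p :: "nat \<Rightarrow> int" where
  "\<mu>\<^sub>p \<equiv> min_poly Fp (\<pi>_poly p f) (p_reduction p \<sigma> J)"

text \<open>
  The polynomial \<open>\<mu>(f)\<close> lies in the ideal and has coefficients in the localization, hence its reduction
  lies in the reduced ideal.
\<close>

lemma \<pi>_\<mu>_closed: "\<pi>_poly p \<mu> \<in> carrier (UP Fp)"
  and \<pi>_\<mu>_monic: "\<pi>_poly p \<mu> d = 1"
  and deg_\<pi>_\<mu>: "deg Fp (\<pi>_poly p \<mu>) = d"
  and \<pi>_\<mu>_kills: "poly_at Fp (\<pi>_poly p f) (\<pi>_poly p \<mu>) \<in> p_reduction p \<sigma> J"
proof -
  show c: "\<pi>_poly p \<mu> \<in> carrier (UP Fp)"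
    using \<mu>_closed \<mu>_zloc by (rule \<pi>_poly_UP_closed)
  show one: "\<pi>_poly p \<mu> d = 1"
    by (simp add: \<pi>_poly_def \<mu>_monic)
  interpret UQ: UP_domain rat_ring "UP rat_ring" by (rule UP_domain_rat) simp
  interpret UF: UP_ring Fp "UP Fp" by unfold_locales simp
  show "deg Fp (\<pi>_poly p \<mu>) = d"
  proof (rule antisym)
    show "deg Fp (\<pi>_poly p \<mu>) \<le> d"
    proof (rule UF.deg_aboveI[OF _ c])
      fix m assume "d < m"
      then have "\<mu> m = 0"
        using UQ.deg_aboveD[OF _ \<mu>_closed, of m] coeff_UP[OF \<mu>_closed] by (simp add: d_def)
      then show "coeff (UP Fp) (\<pi>_poly p \<mu>) m = \<zero>\<^bsub>Fp\<^esub>"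
        unfolding coeff_UP[OF c] by (simp add: \<pi>_poly_def)
    qed
    show "d \<le> deg Fp (\<pi>_poly p \<mu>)"
      by (rule UF.deg_belowI[OF _ c], unfold coeff_UP[OF c]) (simp add: one)
  qed
  have "poly_at rat_ring f \<mu> \<in> J"
    using \<mu>_divides_iff[OF \<mu>_closed] UQ.P.divides_refl[OF \<mu>_closed] by blast
  then show "poly_at Fp (\<pi>_poly p f) (\<pi>_poly p \<mu>) \<in> p_reduction p \<sigma> J"
    using \<pi>_poly_poly_at[OF f f_zloc \<mu>_closed \<mu>_zloc] unfolding p_reduction_eq
    by (intro image_eqI[of _ _ "poly_at rat_ring f \<mu>"]) simp_all
qed

lemma \<mu>p_closed: "\<mu>\<^sub>p \<in> carrier (UP Fp)"
  and \<mu>p_monic: "\<mu>\<^sub>p (deg Fp \<mu>\<^sub>p) = 1"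
  and \<mu>p_kills: "poly_at Fp (\<pi>_poly p f) \<mu>\<^sub>p \<in> p_reduction p \<sigma> J"
  and \<mu>p_divides: "\<mu>\<^sub>p divides\<^bsub>UP Fp\<^esub> \<pi>_poly p \<mu>"
proof -
  interpret UF: UP_cring Fp "UP Fp" by unfold_locales simp
  have "\<pi>_poly p \<mu> \<noteq> \<zero>\<^bsub>UP Fp\<^esub>"
    using \<pi>_\<mu>_monic by (auto simp: UP_def)
  note * = mpoly_field.min_poly_characterization[OF mpoly_field_Fp ideal_p_reduction
    \<pi>_poly_mpoly_closed[OF f f_zloc] \<pi>_\<mu>_closed this \<pi>_\<mu>_kills]
  show c: "\<mu>\<^sub>p \<in> carrier (UP Fp)" by (rule *)
  show "\<mu>\<^sub>p (deg Fp \<mu>\<^sub>p) = 1" using *(2) by simp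
  show "\<mu>\<^sub>p divides\<^bsub>UP Fp\<^esub> \<pi>_poly p \<mu>"
    using *(3)[OF \<pi>_\<mu>_closed] \<pi>_\<mu>_kills by blast
  show "poly_at Fp (\<pi>_poly p f) \<mu>\<^sub>p \<in> p_reduction p \<sigma> J"
    using *(3)[OF c] UF.P.divides_refl[OF c] by blast
qed

lemma deg_\<mu>p_le: "deg Fp \<mu>\<^sub>p \<le> d"
proof -
  interpret UF: UP_domain Fp "UP Fp"
    by (rule UP_domain.intro) (rule field.axioms(1)[OF mpoly_field.axioms[OF mpoly_field_Fp]], simp)
  obtain x where x: "x \<in> carrier (UP Fp)" "\<pi>_poly p \<mu> = \<mu>\<^sub>p \<otimes>\<^bsub>UP Fp\<^esub> x"
    using \<mu>p_divides by (auto simp: factor_def)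
  have n0: "\<pi>_poly p \<mu> \<noteq> \<zero>\<^bsub>UP Fp\<^esub>"
    using \<pi>_\<mu>_monic by (auto simp: UP_def)
  then have "x \<noteq> \<zero>\<^bsub>UP Fp\<^esub>" "\<mu>\<^sub>p \<noteq> \<zero>\<^bsub>UP Fp\<^esub>"
    using x \<mu>p_closed by auto
  then have "deg Fp (\<pi>_poly p \<mu>) = deg Fp \<mu>\<^sub>p + deg Fp x"
    unfolding x(2) using x(1) \<mu>p_closed by (simp add: UF.deg_mult)
  then show ?thesis by (simp add: deg_\<pi>_\<mu>)
qed

theorem \<mu>p_eq_iff: "\<mu>\<^sub>p = \<pi>_poly p \<mu> \<longleftrightarrow> deg Fp \<mu>\<^sub>p = d"
proof
  show "deg Fp \<mu>\<^sub>p = d" if "\<mu>\<^sub>p = \<pi>_poly p \<mu>"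
    using that deg_\<pi>_\<mu> by simp
  assume d: "deg Fp \<mu>\<^sub>p = d"
  have "\<pi>_poly p \<mu> = \<mu>\<^sub>p"
  proof (rule mpoly_field.monic_generator_unique[OF mpoly_field_Fp \<mu>p_closed _ \<pi>_\<mu>_closed _ \<mu>p_divides])
    show "coeff (UP Fp) \<mu>\<^sub>p (deg Fp \<mu>\<^sub>p) = \<one>\<^bsub>Fp\<^esub>"
      unfolding coeff_UP[OF \<mu>p_closed] by (simp add: \<mu>p_monic)
    show "coeff (UP Fp) (\<pi>_poly p \<mu>) (deg Fp (\<pi>_poly p \<mu>)) = \<one>\<^bsub>Fp\<^esub>"
      unfolding coeff_UP[OF \<pi>_\<mu>_closed] deg_\<pi>_\<mu> by (simp add: \<pi>_\<mu>_monic)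
    show "deg Fp (\<pi>_poly p \<mu>) \<le> deg Fp \<mu>\<^sub>p"
      by (simp add: d deg_\<pi>_\<mu>)
  qed
  then show "\<mu>\<^sub>p = \<pi>_poly p \<mu>" ..
qed

text \<open>
  A polynomial of degree less than d that kills the reduction of f lifts to a combination h of the
  powers of f below d. As the reduction of h lies in the reduced ideal, h differs from an element of the
  ideal by a multiple p y, with y over the localization. The coordinates of h are therefore p times those
  of y, which lie in the localization by assumption. So all coefficients of the polynomial vanish
  modulo p, although it is monic.
\<close>

theorem deg_\<mu>p_of_integral_coordinates:
  assumes lS: "is_coordinate_matrix l S" and int: "\<And>j x. j < d \<Longrightarrow> x \<in> S \<Longrightarrow> l j x \<in> zloc p"
  shows "deg Fp \<mu>\<^sub>p = d"
proof (rule ccontr)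
  assume "deg Fp \<mu>\<^sub>p \<noteq> d"
  then have less: "deg Fp \<mu>\<^sub>p < d" using deg_\<mu>p_le by simp
  interpret UF: UP_ring Fp "UP Fp" by unfold_locales simp
  define q :: "nat \<Rightarrow> rat" where "q i = of_int (\<mu>\<^sub>p i)" for i
  have q0: "q i = 0" if "i \<ge> d" for i
    using UF.deg_aboveD[OF _ \<mu>p_closed, of i] that less coeff_UP[OF \<mu>p_closed] by (simp add: q_def)
  have q: "q \<in> carrier (UP rat_ring)" "range q \<subseteq> zloc p"
    using q0 by (auto simp: UP_rat_iff q_def intro!: exI[of _ d])
  have \<pi>q: "\<pi>_poly p q = \<mu>\<^sub>p"
    using \<mu>p_closed by (auto simp: UP_Fp_iff \<pi>_poly_def q_def \<pi>_of_int fun_eq_iff)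
  define h where "h = poly_at rat_ring f q"
  have h_eq: "h = (\<lambda>t. \<Sum>i<d. q i * (f [^]\<^bsub>rat_mpoly\<^esub> i) t)"
    unfolding h_def using q0 by (rule poly_at_eq_sum)
  have h: "h \<in> carrier rat_mpoly" "range h \<subseteq> zloc p" "\<pi>_poly p h \<in> p_reduction p \<sigma> J"
    using \<pi>_poly_poly_at[OF f f_zloc q] \<mu>p_kills ring_hom_closed[OF rat.poly_at_hom[OF f] q(1)]
    by (simp_all add: h_def \<pi>q)
  then obtain h0 where h0: "h0 \<in> J" "range h0 \<subseteq> zloc p" "\<pi>_poly p h = \<pi>_poly p h0"
    unfolding p_reduction_eq by blast
  define y where "y t = (h t - h0 t) / of_nat p" for t
  have h0c: "h0 \<in> carrier rat_mpoly" by (rule rat_ideal_finite[OF ideal_J h0(1)])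
  have "y = (\<lambda>t. inverse (of_nat p) * (h - h0) t)"
    by (simp add: y_def fun_eq_iff field_simps)
  then have yc: "y \<in> carrier rat_mpoly"
    using rat_mpoly_closed(3)[OF rat_mpoly_closed(2)[OF h(1) h0c]] by simp
  have y_zloc: "range y \<subseteq> zloc p"
  proof
    fix x assume "x \<in> range y"
    then obtain t where t: "x = y t" by blast
    have ht: "h t \<in> zloc p" "h0 t \<in> zloc p" using h(2) h0(2) by auto
    have "\<pi> p (h0 t + (h t - h0 t)) = (\<pi> p (h0 t) + \<pi> p (h t - h0 t)) mod int p"
      using ht by (intro \<pi>_add zloc_diff)
    moreover have "\<pi> p (h t) = \<pi> p (h0 t)"
      using fun_cong[OF h0(3), of t] by (simp add: \<pi>_poly_def)
    ultimately have "[\<pi> p (h0 t) + \<pi> p (h t - h0 t) = \<pi> p (h0 t) + 0] (mod int p)"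
      using \<pi>_range[OF ht(2) ht(2)] by (simp add: cong_def)
    then have "[\<pi> p (h t - h0 t) = 0] (mod int p)"
      by (simp only: cong_add_lcancel)
    then have "\<pi> p (h t - h0 t) = 0"
      using \<pi>_range[of "h t - h0 t" 0] ht by (simp add: cong_def zloc_diff)
    then show "x \<in> zloc p"
      using \<pi>_eq_0_iff[of "h t - h0 t"] ht by (simp add: t y_def zloc_diff)
  qed
  have "h = h0 + (\<lambda>t. of_nat p * y t)"
    by (simp add: y_def fun_eq_iff prime_gt_0_nat[OF prime_p] less_imp_neq[symmetric])
  then have nfh: "nf J h = (\<lambda>t. 0) + (\<lambda>t. of_nat p * nf J y t)"
    using nf_add[OF ideal_J h0c rat_mpoly_closed(3)[OF yc]] nf_of_mem[OF ideal_J h0(1)]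
      nf_scale[OF ideal_J yc] by simp
  have "\<mu>\<^sub>p j = 0" if j: "j < d" for j
  proof -
    have "coord l S h j = q j"
      by (rule coord_of_cong[OF lS j h(1)])
        (use rat_ideal_zero[OF ideal_J] in \<open>simp add: h_eq\<close>)
    moreover have "coord l S h j = of_nat p * coord l S y j"
      by (simp add: coord_def nfh sum_distrib_left mult_ac)
    moreover have "coord l S y j \<in> zloc p"
      unfolding coord_def using int[OF j] nf_zloc[OF yc y_zloc] by (intro zloc_sum zloc_mult)
    moreover have "(of_nat p :: rat) \<noteq> 0"
      using prime_gt_0_nat[OF prime_p] by simp
    ultimately have "q j / of_nat p \<in> zloc p"
      by (metis nonzero_mult_div_cancel_left)
    then have "\<pi> p (q j) = 0"
      using \<pi>_eq_0_iff[of "q j"] q(2) by (simp add: image_subset_iff)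
    then show ?thesis
      using fun_cong[OF \<pi>q, of j] by (simp add: \<pi>_poly_def)
  qed
  then show False using less \<mu>p_monic by simp
qed

end

lemma usable_algebraicI:
  assumes "zero_dimensional rat_ring I" "term_ordering \<sigma>"
    and "f \<in> carrier (mpoly_ring rat_ring)" "usable_prime \<sigma> I f p"
  shows "usable_algebraic p \<sigma> I f"
proof -
  have p: "prime p" "\<not> int p dvd den f" "\<not> int p dvd den_gb \<sigma> I"
    using assms(4) by (auto simp: usable_prime_def)
  interpret algebraic_element \<sigma> I f
    by (intro algebraic_element.intro algebraic_element_axioms.intro term_order.intro assms(1-3))
  interpret usable_reduction p \<sigma> I
    by (intro usable_reduction.intro prime_reduction.intro usable_reduction_axioms.intro
        term_order_axioms p ideal_J)
  show ?thesis
    by (intro usable_algebraic.intro usable_algebraic_axioms.intro usable_reduction_axioms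
        algebraic_element_axioms range_subset_zloc_of_den p)
qed

theorem theorem3p20:
  fixes I :: "('n::finite pp \<Rightarrow> rat) set"
    and \<sigma> :: "'n pp rel"
    and f :: "'n pp \<Rightarrow> rat"
    and p :: nat
  assumes "zero_dimensional rat_ring I"
    and "term_ordering \<sigma>"
    and "f \<in> carrier (mpoly_ring rat_ring)"
    and "usable_prime \<sigma> I f p"
  shows
    "min_poly (residue_ring (int p)) (\<pi>_poly p f) (p_reduction p \<sigma> I)
       divides\<^bsub>UP (residue_ring (int p))\<^esub> \<pi>_poly p (min_poly rat_ring f I)
     \<and> finite {q. bad_prime \<sigma> I f q}
     \<and> (good_prime \<sigma> I f p \<longleftrightarrow>
          deg (residue_ring (int p))
            (min_poly (residue_ring (int p)) (\<pi>_poly p f) (p_reduction p \<sigma> I))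
          = deg rat_ring (min_poly rat_ring f I))"
proof (intro conjI)
  interpret usable_algebraic p \<sigma> I f
    by (rule usable_algebraicI[OF assms])
  show "\<mu>\<^sub>p divides\<^bsub>UP Fp\<^esub> \<pi>_poly p (min_poly rat_ring f I)"
    using \<mu>p_divides by (simp add: \<mu>_def)
  show "good_prime \<sigma> I f p \<longleftrightarrow> deg Fp \<mu>\<^sub>p = deg rat_ring (min_poly rat_ring f I)"
    using \<mu>p_eq_iff assms(4) by (simp add: good_prime_def \<mu>_def d_def)
  obtain l S where lS: "is_coordinate_matrix l S"
    using ex_coordinate_matrix by blast
  \<comment> \<open>The coordinate matrix is chosen once for all primes; a bad prime divides one of its denominators.\<close>
  let ?D = "(\<lambda>(j, x). snd (quotient_of (l j x))) ` ({..<d} \<times> S)"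
  have "\<exists>b\<in>?D. int q dvd b" if bad: "bad_prime \<sigma> I f q" for q
  proof (rule ccontr)
    assume no: "\<not> (\<exists>b\<in>?D. int q dvd b)"
    have usable_q: "usable_prime \<sigma> I f q"
      using bad by (simp add: bad_prime_def)
    interpret q: usable_algebraic q \<sigma> I f
      by (rule usable_algebraicI[OF assms(1-3) usable_q])
    have "l j x \<in> zloc q" if "j < d" "x \<in> S" for j x
      using no that by (auto simp: zloc_def)
    from q.deg_\<mu>p_of_integral_coordinates[OF lS this] have "good_prime \<sigma> I f q"
      using q.\<mu>p_eq_iff usable_q by (simp add: good_prime_def \<mu>_def)
    then show False using bad by (simp add: bad_prime_def)
  qed
  then have "{q. bad_prime \<sigma> I f q} \<subseteq> (\<Union>b\<in>?D. {q. int q dvd b})"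
    by blast
  moreover have "finite (\<Union>b\<in>?D. {q. int q dvd b})"
  proof (rule finite_UN_I)
    show "finite ?D" using lS by (simp add: is_coordinate_matrix_def)
    fix b assume "b \<in> ?D"
    then have "b > 0" by (auto simp: quotient_of_denom_pos')
    then have "{q. int q dvd b} \<subseteq> {..nat b}"
      using zdvd_imp_le by fastforce
    then show "finite {q. int q dvd b}" by (rule finite_subset) simp
  qed
  ultimately show "finite {q. bad_prime \<sigma> I f q}"
    by (rule finite_subset)
qed

end
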